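(* Let $n\ge 1$ be an integer, $0<\gamma<n$, $1<p<n/\gamma$, $1/q=1/p-\gamma/n$ and $w\in A_{p,q}$. Assume that $p\le\alpha<\beta<s\le\infty$ with $1/\beta=1/\alpha-\gamma/n$, and that $\mu\in\Delta_2$. Then the fractional integral operator $I_\gamma$ is bounded from $(L^p,L^s)^{\alpha}(w^p,w^q;\mu)$ into $(L^q,L^s)^{\beta}(w^q;\mu)$; that is, there is a constant $C>0$ independent of $f$ such that $\|I_\gamma f\|_{(L^q,L^s)^{\beta}(w^q;\mu)}\le C\|f\|_{(L^p,L^s)^{\alpha}(w^p,w^q;\mu)}$ for all $f\in(L^p,L^s)^{\alpha}(w^p,w^q;\mu)$.
   Context: A weight is a non-negative locally integrable function on $\mathbb R^n$; for a weight $w$ and measurable $E$, $w(E)=\int_E w(x)\,dx$, and $w^q(E)=\int_E w(x)^q\,dx$. $B(y,r)$ is the open Euclidean ball with center $y$ and radius $r$; $p'=p/(p-1)$. Fractional integral operator: $I_\gamma f(x)=\frac{1}{\zeta(\gamma)}\int_{\mathbb R^n}\frac{f(y)}{|x-y|^{n-\gamma}}\,dy$, with $\zeta(\gamma)=\frac{\pi^{n/2}2^\gamma\Gamma(\gamma/2)}{\Gamma((n-\gamma)/2)}$. For $1<p,q<\infty$, $w\in A_{p,q}$ means: there is $C>0$ such that for every ball $B$, $\left(\frac1{|B|}\int_B w^q\,dx\right)^{1/q}\left(\frac1{|B|}\int_B w^{-p'}\,dx\right)^{1/p'}\le C$. $\mu\in\Delta_2$ means that $\mu$ is a weight and there is $C>0$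 with $\mu(2B)\le C\mu(B)$ for every ball $B$ ($2B$ is the concentric ball with twice the radius). Weighted amalgam spaces: for $1\le p\le\alpha\le s\le\infty$ and weights $\nu,w,\mu$, the space $(L^p,L^s)^{\alpha}(\nu,w;\mu)$ consists of all locally integrable $f$ with $$\|f\|_{(L^p,L^s)^{\alpha}(\nu,w;\mu)}:=\sup_{r>0}\Big\|w(B(y,r))^{1/\alpha-1/p-1/s}\,\|f\chi_{B(y,r)}\|_{L^p(\nu)}\Big\|_{L^s(\mu)}<\infty,$$ where the $L^s(\mu)$-norm (norm with respect to the measure $\mu(y)\,dy$, usual modification when $s=\infty$) is taken in the variable $y$, and $\|g\|_{L^p(\nu)}=(\int|g|^p\nu\,dx)^{1/p}$. One writes $(L^p,L^s)^{\alpha}(w;\mu):=(L^p,L^s)^{\alpha}(w,w;\mu)$. *)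

theory Defs
  imports "HOL-Analysis.Analysis" "HOL-Probability.Essential_Supremum"
begin

text \<open>Real powers of extended non-negative reals, with the usual conventions at the end points:
  for \<open>a > 0\<close> the value is \<open>0\<close> at \<open>0\<close> and \<open>\<infinity>\<close> at \<open>\<infinity>\<close>, for \<open>a < 0\<close> it is the other way round, and
  the power with exponent \<open>0\<close> is \<open>1\<close>. (The real-valued \<open>powr\<close> has \<open>0 powr a = 0\<close> for every \<open>a\<close>, which
  would be wrong for negative powers of weights.)\<close>

definition epowr :: "ennreal \<Rightarrow> real \<Rightarrow> ennreal" (infixr "epowr" 80) where
  "x epowr a =
     (if a = 0 then 1
      else if x = 0 then (if a > 0 then 0 else top)
      else if x = top then (if a > 0 then top else 0)
      else ennreal (enn2real x powr a))"

definition locally_integrable :: "(real ^ 'n \<Rightarrow> 'b :: euclidean_space) \<Rightarrow> bool" where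
  "locally_integrable f \<longleftrightarrow> (\<forall>K. compact K \<longrightarrow> f absolutely_integrable_on K)"

definition weight :: "(real ^ 'n \<Rightarrow> real) \<Rightarrow> bool" where
  "weight w \<longleftrightarrow> (\<forall>x. 0 \<le> w x) \<and> locally_integrable w"

abbreviation wmeasure :: "(real ^ 'n \<Rightarrow> real) \<Rightarrow> (real ^ 'n) measure" where
  "wmeasure w \<equiv> density lebesgue (\<lambda>x. ennreal (w x))"

text \<open>The exponent \<open>s\<close> is an extended non-negative real, so that \<open>s = \<infinity>\<close> is the element \<open>top\<close>.\<close>

definition Lnorm :: "ennreal \<Rightarrow> 'a measure \<Rightarrow> ('a \<Rightarrow> ennreal) \<Rightarrow> ennreal" where
  "Lnorm s M g =
     (if s = top then esssup M g
      else (\<integral>\<^sup>+ x. g x epowr enn2real s \<partial>M) epowr (1 / enn2real s))"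

text \<open>The term \<open>enn2real (1 / s)\<close> is \<open>0\<close> for \<open>s = top\<close>, because \<open>1 / top = 0\<close> in \<^typ>\<open>ennreal\<close>.\<close>

definition amalgam_norm ::
    "ennreal \<Rightarrow> ennreal \<Rightarrow> ennreal \<Rightarrow> (real ^ 'n \<Rightarrow> real) \<Rightarrow> (real ^ 'n \<Rightarrow> real) \<Rightarrow> (real ^ 'n \<Rightarrow> real)
      \<Rightarrow> (real ^ 'n \<Rightarrow> complex) \<Rightarrow> ennreal" where
  "amalgam_norm p s \<alpha> \<nu> w \<mu> f =
     (SUP r\<in>{0<..}.
        Lnorm s (wmeasure \<mu>)
          (\<lambda>y. emeasure (wmeasure w) (ball y r)
                   epowr (enn2real (1 / \<alpha>) - enn2real (1 / p) - enn2real (1 / s))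
               * Lnorm p (wmeasure \<nu>) (\<lambda>x. ennreal (norm (f x)) * indicator (ball y r) x)))"

definition amalgam ::
    "ennreal \<Rightarrow> ennreal \<Rightarrow> ennreal \<Rightarrow> (real ^ 'n \<Rightarrow> real) \<Rightarrow> (real ^ 'n \<Rightarrow> real) \<Rightarrow> (real ^ 'n \<Rightarrow> real)
      \<Rightarrow> (real ^ 'n \<Rightarrow> complex) set" where
  "amalgam p s \<alpha> \<nu> w \<mu> = {f. locally_integrable f \<and> amalgam_norm p s \<alpha> \<nu> w \<mu> f < top}"

text \<open>In the condition below \<open>w\<close> may vanish at some points, and there its negative powers are
  \<open>\<infinity>\<close>. Since \<open>0 * top = 0\<close> in \<^typ>\<open>ennreal\<close>, finiteness of the integrals of \<open>w\<close> to the power \<open>-p'\<close> is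
  required separately; it only excludes the weights that vanish almost everywhere, for which the
  product is of the undefined form \<open>0 \<cdot> \<infinity>\<close>.\<close>

definition A_class :: "real \<Rightarrow> real \<Rightarrow> (real ^ 'n \<Rightarrow> real) set" where
  "A_class p q = {w. weight w \<and>
     (let p' = p / (p - 1) in
       (\<forall>y r. 0 < r \<longrightarrow> (\<integral>\<^sup>+ x\<in>ball y r. ennreal (w x) epowr (- p') \<partial>lebesgue) < top) \<and>
       (\<exists>C>0. \<forall>y r. 0 < r \<longrightarrow>
         ((\<integral>\<^sup>+ x\<in>ball y r. ennreal (w x) epowr q \<partial>lebesgue) / emeasure lebesgue (ball y r))
             epowr (1 / q)
         * ((\<integral>\<^sup>+ x\<in>ball y r. ennreal (w x) epowr (- p') \<partial>lebesgue) / emeasure lebesgue (ball y r))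
             epowr (1 / p')
         \<le> ennreal C))}"

definition Delta2 :: "(real ^ 'n \<Rightarrow> real) set" where
  "Delta2 = {\<mu>. weight \<mu> \<and>
     (\<exists>C>0. \<forall>y r. 0 < r \<longrightarrow>
        emeasure (wmeasure \<mu>) (ball y (2 * r)) \<le> ennreal C * emeasure (wmeasure \<mu>) (ball y r))}"

definition frac_const :: "nat \<Rightarrow> real \<Rightarrow> real" where
  "frac_const n \<gamma> = pi powr (real n / 2) * 2 powr \<gamma> * Gamma (\<gamma> / 2) / Gamma ((real n - \<gamma>) / 2)"

definition frac_integrand ::
    "real \<Rightarrow> (real ^ 'n \<Rightarrow> complex) \<Rightarrow> real ^ 'n \<Rightarrow> real ^ 'n \<Rightarrow> complex" where
  "frac_integrand \<gamma> f x y = f y / of_real (norm (x - y) powr (real CARD('n) - \<gamma>))"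

text \<open>The Bochner integral is \<open>0\<close> when the integrand is not integrable, so the existence
  of \<open>frac_integral \<gamma> f x\<close> has to be stated separately.\<close>

definition frac_integral :: "real \<Rightarrow> (real ^ 'n \<Rightarrow> complex) \<Rightarrow> real ^ 'n \<Rightarrow> complex" where
  "frac_integral \<gamma> f x =
     of_real (1 / frac_const CARD('n) \<gamma>) * (LINT y|lebesgue. frac_integrand \<gamma> f x y)"

end

theory Submission
  imports Defs
begin

text \<open>Put \<open>\<sigma> = w powr (- p')\<close> and \<open>u = w powr q\<close>. As \<open>\<sigma> powr (1/p') * u powr (1/q) = 1\<close> almost everywhere,
  Hoelder's inequality gives \<open>|E| powr (1 - \<gamma>/n) \<le> \<sigma>(E) powr (1/p') * u(E) powr (1/q)\<close> for every set \<open>E\<close>,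
  while the \<open>A\<close>-condition is the converse inequality on balls, up to a constant. Hence \<open>\<sigma>\<close> and \<open>u\<close> of
  a ball are controlled by their values on any subset of proportional Lebesgue measure; doubling and
  reverse doubling follow, and no reverse Hoelder inequality is needed.

  The strong type inequality from \<open>L^p(w^p)\<close> to \<open>L^q(w^q)\<close> is proved by duality. The kernel is dominated
  by a sum over finitely many shifted dyadic grids, and the resulting bilinear form by a sum over
  principal cubes \<open>Q\<close>, each of which has a part that is disjoint from all others and fills at least half of \<open>Q\<close>.
  By the \<open>A\<close>-condition the term of \<open>Q\<close> is at most \<open>\<sigma>(Q) powr (1/p) * u(Q) powr (1/q')\<close> times
  the weighted averages of the two functions, and the Carleson embedding finishes the proof.

  For a ball \<open>B\<close>, split \<open>f\<close> at \<open>2B\<close>. The strong type inequality handles the local part. Hoelder's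
  inequality and the \<open>A\<close>-condition bound the contribution of the \<open>k\<close>-th annulus by the local norm
  on \<open>2^k B\<close> times \<open>(u(B) / u(2^k B)) powr (1/\<beta> - 1/s)\<close>, which decays geometrically in \<open>k\<close> by reverse
  doubling. It remains to take the norm of \<open>L^s(\<mu>)\<close> in the centre of \<open>B\<close>.\<close>

section \<open>Powers of extended non-negative reals\<close>

text \<open>Both amalgam norms carry the same power of u(B): as 1/\<alpha> - 1/\<beta> and 1/p - 1/q
  both equal \<gamma>/n, the exponent e = 1/\<alpha> - 1/p - 1/s is also 1/\<beta> - 1/q - 1/s. From
  p \<le> \<alpha> one gets e \<le> 0, so that doubling allows the passage from B to 2B; from
  \<beta> < s one gets e + 1/q = 1/\<beta> - 1/s > 0, the exponent of the geometric decay. The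
  dilates of B keep its centre, so the supremum over the radii in the norm of f absorbs each of
  them. Existence of the integral needs its own argument: a finite norm only speaks of \<mu>-almost
  every centre. Unless \<mu> vanishes almost everywhere, doubling gives every ball positive
  \<mu>-mass, so that a good centre lies near the origin. All estimates concern the potential of |f|
  with values in [0, \<infinity>], where convergence is no issue. The selection of maximal cubes
  needs levels bounded below, hence an integrable function; the part of a locally integrable f on 2B
  is one.\<close>

lemma epowr_0 [simp]: "x epowr 0 = 1" by (simp add: epowr_def)
lemma zero_epowr [simp]: "0 < a \<Longrightarrow> 0 epowr a = 0" by (simp add: epowr_def)
lemma top_epowr [simp]: "0 < a \<Longrightarrow> top epowr a = top" by (simp add: epowr_def)
lemma one_epowr [simp]: "1 epowr a = 1" by (simp add: epowr_def)

lemma epowr_ennreal: "0 < x \<Longrightarrow> ennreal x epowr a = ennreal (x powr a)"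
  by (simp add: epowr_def)

lemma epowr_ennreal': "0 \<le> x \<Longrightarrow> 0 < a \<Longrightarrow> ennreal x epowr a = ennreal (x powr a)"
  by (cases "x = 0") (simp_all add: epowr_ennreal)

lemma epowr_1 [simp]: "x epowr 1 = x"
  by (cases x) (simp_all add: epowr_ennreal')

lemma epowr_mono: "x \<le> y \<Longrightarrow> 0 \<le> a \<Longrightarrow> x epowr a \<le> y epowr a"
  by (cases "a = 0"; cases x; cases y)
     (auto simp: epowr_ennreal' top_unique powr_mono2)

lemma epowr_mult: "0 < a \<Longrightarrow> (x * y) epowr a = x epowr a * y epowr a"
  by (cases x; cases y; cases "x = 0"; cases "y = 0")
     (auto simp: epowr_ennreal' powr_mult ennreal_mult_top ennreal_top_mult ennreal_mult[symmetric])

lemma epowr_epowr: "0 < a \<Longrightarrow> 0 < b \<Longrightarrow> (x epowr a) epowr b = x epowr (a * b)"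
  by (cases x) (auto simp: epowr_ennreal' powr_powr)

lemma epowr_add: "0 < a \<Longrightarrow> 0 < b \<Longrightarrow> x epowr (a + b) = x epowr a * x epowr b"
  by (cases x) (auto simp: epowr_ennreal' powr_add ennreal_mult ennreal_mult_top)

lemma epowr_eq_0_iff [simp]: "0 < a \<Longrightarrow> x epowr a = 0 \<longleftrightarrow> x = 0"
  by (cases x) (auto simp: epowr_ennreal')

lemma epowr_eq_top_iff [simp]: "0 < a \<Longrightarrow> x epowr a = top \<longleftrightarrow> x = top"
  by (auto simp: epowr_def)

lemma epowr_less_top_iff [simp]: "0 < a \<Longrightarrow> x epowr a < top \<longleftrightarrow> x < top"
  by (simp add: less_top[symmetric])

lemma epowr_less_cancel:
  assumes "0 < a"
  shows "x epowr a < y epowr a \<longleftrightarrow> x < y"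
proof
  assume "x epowr a < y epowr a"
  then show "x < y"
    using epowr_mono[of y x a] assms by (meson less_imp_le not_le)
next
  assume "x < y"
  then obtain u where u: "x = ennreal u" "0 \<le> u" by (cases x) auto
  show "x epowr a < y epowr a"
  proof (cases y)
    case (real v)
    then have "u < v" using u \<open>x < y\<close> by (simp add: ennreal_less_iff)
    then show ?thesis
      using u real assms by (simp add: epowr_ennreal' ennreal_less_iff powr_less_mono2)
  next
    case top
    then show ?thesis using u assms by (simp add: epowr_ennreal')
  qed
qed

lemma borel_measurable_epowr [measurable (raw)]:
  fixes f :: "'a \<Rightarrow> ennreal"
  assumes [measurable]: "f \<in> borel_measurable M"
  shows "(\<lambda>x. f x epowr a) \<in> borel_measurable M"
  unfolding epowr_def by measurable

text \<open>The sum is at most twice the maximum. The crude factor 2^a serves exponents above and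
  below 1 alike; it is used with q and with 1/q.\<close>

lemma epowr_add_le:
  fixes x y :: ennreal
  assumes "0 < a"
  shows "(x + y) epowr a \<le> ennreal (2 powr a) * (x epowr a + y epowr a)"
proof -
  have "x + y \<le> ennreal 2 * max x y"
    by (auto simp: max_def mult_2 intro: add_mono)
  then have "(x + y) epowr a \<le> (ennreal 2 * max x y) epowr a"
    using assms by (intro epowr_mono) auto
  also have "\<dots> = ennreal (2 powr a) * (max x y) epowr a"
    using assms by (simp only: epowr_mult epowr_ennreal)
  also have "(max x y) epowr a \<le> x epowr a + y epowr a"
    by (simp add: max_def)
  finally show ?thesis by (simp add: mult_left_mono)
qed

lemma nn_integral_count_space_ge_term:
  fixes f :: "'i \<Rightarrow> ennreal"
  assumes "i \<in> I"
  shows "f i \<le> (\<integral>\<^sup>+j. f j \<partial>count_space I)"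
proof -
  have "f i = (\<integral>\<^sup>+j. f j * indicator {i} j \<partial>count_space I)"
    using assms by (simp add: nn_integral_count_space_indicator nn_integral_indicator_singleton')
  also have "\<dots> \<le> (\<integral>\<^sup>+j. f j \<partial>count_space I)"
    by (intro nn_integral_mono) (auto simp: indicator_def)
  finally show ?thesis .
qed

text \<open>The embedding of l^1 into l^r: each f_i is at most the sum S, so f_i^r \<le> f_i
  S^(r-1).\<close>

lemma epowr_superadd_count_space:
  fixes f :: "'i \<Rightarrow> ennreal"
  assumes "1 \<le> r"
  shows "(\<integral>\<^sup>+i. f i epowr r \<partial>count_space I) \<le> (\<integral>\<^sup>+i. f i \<partial>count_space I) epowr r"
proof (cases "r = 1")
  case False
  with assms have r: "0 < r - 1" by auto
  let ?S = "\<integral>\<^sup>+i. f i \<partial>count_space I"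
  have le: "f i \<le> ?S" if "i \<in> I" for i
    using that by (rule nn_integral_count_space_ge_term)
  have "(\<integral>\<^sup>+i. f i epowr r \<partial>count_space I) = (\<integral>\<^sup>+i. f i * f i epowr (r - 1) \<partial>count_space I)"
    using epowr_add[of 1 "r - 1"] r by (intro nn_integral_cong) simp
  also have "\<dots> \<le> (\<integral>\<^sup>+i. f i * ?S epowr (r - 1) \<partial>count_space I)"
    using r le by (intro nn_integral_mono mult_left_mono epowr_mono) auto
  also have "\<dots> = ?S * ?S epowr (r - 1)"
    by (simp add: nn_integral_multc)
  also have "\<dots> = ?S epowr r"
    using epowr_add[of 1 "r - 1" ?S] r by simp
  finally show ?thesis .
qed simp

section \<open>Norms, Young's and Hoelder's inequalities with values in [0, \<infinity>]\<close>

abbreviation pnorm :: "real \<Rightarrow> 'a measure \<Rightarrow> ('a \<Rightarrow> ennreal) \<Rightarrow> ennreal" where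
  "pnorm p N f \<equiv> (\<integral>\<^sup>+x. f x epowr p \<partial>N) epowr (1/p)"

lemma Young_ennreal:
  fixes x y :: ennreal
  assumes "1 < p" "1 < q" "1/p + 1/q = 1"
  shows "x * y \<le> ennreal (1/p) * x epowr p + ennreal (1/q) * y epowr q"
proof (cases "x = top \<or> y = top")
  case True
  then show ?thesis using assms by (auto simp: ennreal_mult_top)
next
  case False
  then obtain a b where "x = ennreal a" "y = ennreal b" "0 \<le> a" "0 \<le> b"
    by (metis ennreal_cases)
  then show ?thesis
    using Youngs_inequality[of p q a b] assms
    by (simp add: epowr_ennreal' ennreal_mult[symmetric] ennreal_plus[symmetric] del: ennreal_plus)
qed

lemma Hoelder_nn_integral:
  fixes f g :: "'a \<Rightarrow> ennreal"
  assumes pq: "1 < p" "1 < q" "1/p + 1/q = 1"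
    and [measurable]: "f \<in> borel_measurable M" "g \<in> borel_measurable M"
  shows "(\<integral>\<^sup>+x. f x * g x \<partial>M)
           \<le> pnorm p M f * pnorm q M g"
proof -
  define A where "A = (\<integral>\<^sup>+x. f x epowr p \<partial>M)"
  define B where "B = (\<integral>\<^sup>+x. g x epowr q \<partial>M)"
  consider "A = 0 \<or> B = 0" | "A \<noteq> 0" "B \<noteq> 0" "A = top \<or> B = top" 
    | "A \<noteq> 0" "B \<noteq> 0" "A \<noteq> top" "B \<noteq> top" by blast
  then show ?thesis
  proof cases
    \<comment> \<open>The right side is 0 even if the other norm is infinite, so the left side has
      to vanish: one of the two functions is 0 almost everywhere.\<close>
    case 1
    then have "(AE x in M. f x epowr p = 0) \<or> (AE x in M. g x epowr q = 0)"
      unfolding A_def B_def by (subst (asm) (1 2) nn_integral_0_iff_AE) auto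
    then have "AE x in M. f x * g x = 0" using pq by auto
    then have "(\<integral>\<^sup>+x. f x * g x \<partial>M) = 0" by (subst nn_integral_0_iff_AE) auto
    then show ?thesis by simp
  next
    case 2
    then show ?thesis using pq
      by (auto simp: A_def[symmetric] B_def[symmetric] ennreal_mult_eq_top_iff)
  next
    case 3
    then obtain a b where ab: "A = ennreal a" "B = ennreal b" "0 < a" "0 < b"
      by (cases A; cases B) (auto simp: less_le)
    \<comment> \<open>Scaling \<open>f\<close> and \<open>g\<close> by their norms c and d reduces
      the claim to Young's inequality, whose two terms then integrate to 1/p and 1/q.\<close>
    define c where "c = a powr (1/p)"
    define d where "d = b powr (1/q)"
    have cd: "0 < c" "0 < d" "c powr p = a" "d powr q = b"
      using ab pq by (auto simp: c_def d_def powr_powr)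
    have [simp]: "(ennreal (1/c)) epowr p = ennreal (1/a)" "(ennreal (1/d)) epowr q = ennreal (1/b)"
      using cd by (auto simp: epowr_ennreal powr_divide)
    have "ennreal (1/c) * ennreal (1/d) * (\<integral>\<^sup>+x. f x * g x \<partial>M)
        = (\<integral>\<^sup>+x. (ennreal (1/c) * f x) * (ennreal (1/d) * g x) \<partial>M)"
      by (subst nn_integral_cmult[symmetric]) (auto simp: ac_simps)
    also have "\<dots> \<le> (\<integral>\<^sup>+x. ennreal (1/p) * (ennreal (1/c) * f x) epowr p 
                       + ennreal (1/q) * (ennreal (1/d) * g x) epowr q \<partial>M)"
      by (intro nn_integral_mono Young_ennreal pq)
    also have "\<dots> = ennreal (1/p) * (ennreal (1/a) * A) + ennreal (1/q) * (ennreal (1/b) * B)"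
      using pq by (simp add: epowr_mult nn_integral_add nn_integral_cmult A_def B_def)
    also have "\<dots> = ennreal (1/p * (1/a * a) + 1/q * (1/b*b))"
      using ab pq by (simp add: ennreal_mult[symmetric] ennreal_plus[symmetric] del: ennreal_plus)
    also have "\<dots> = 1" using ab pq by simp
    finally have "ennreal (1/c) * ennreal (1/d) * (\<integral>\<^sup>+x. f x * g x \<partial>M) \<le> 1" .
    then have "ennreal (c * d) * (ennreal (1/c) * ennreal (1/d) * (\<integral>\<^sup>+x. f x * g x \<partial>M)) \<le> ennreal (c * d) * 1"
      by (rule mult_left_mono) simp
    moreover have "ennreal (c * d) * (ennreal (1/c) * ennreal (1/d) * z) = z" for z
      using cd by (simp add: mult.assoc[symmetric] ennreal_mult[symmetric])
    ultimately have "(\<integral>\<^sup>+x. f x * g x \<partial>M) \<le> ennreal (c * d)" by simp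
    also have "\<dots> = A epowr (1/p) * B epowr (1/q)"
      using ab cd by (simp add: epowr_ennreal c_def d_def ennreal_mult)
    finally show ?thesis by (simp add: A_def B_def)
  qed
qed

text \<open>By Tonelli, since for each x at most one of the indicators is non-zero. Countability of
  \<open>I\<close> is what allows the exchange of the two integrals.\<close>

lemma nn_integral_disjoint_family_le:
  fixes E :: "'i \<Rightarrow> 'a set" and g :: "'a \<Rightarrow> ennreal"
  assumes I: "countable I" and E: "\<And>i. i \<in> I \<Longrightarrow> E i \<in> sets M" "disjoint_family_on E I"
    and g[measurable]: "g \<in> borel_measurable M"
  shows "(\<integral>\<^sup>+i. (\<integral>\<^sup>+x. g x * indicator (E i) x \<partial>M) \<partial>count_space I)
           = (\<integral>\<^sup>+x. g x * indicator (\<Union>i\<in>I. E i) x \<partial>M)"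
proof -
  have *: "(\<integral>\<^sup>+i. g x * indicator (E i) x \<partial>count_space I) = g x * indicator (\<Union>i\<in>I. E i) x" for x
  proof (cases "\<exists>i\<in>I. x \<in> E i")
    case True
    then obtain i where i: "i \<in> I" "x \<in> E i" by blast
    have "indicator (E j) x = (indicator {i} j :: ennreal)" if "j \<in> I" for j
      using i that E(2) by (auto simp: disjoint_family_on_def indicator_def)
    then have "(\<integral>\<^sup>+j. g x * indicator (E j) x \<partial>count_space I)
       = (\<integral>\<^sup>+j. g x * indicator {i} j \<partial>count_space I)"
      by (intro nn_integral_cong) simp
    also have "\<dots> = g x" using i
      by (simp add: nn_integral_count_space_indicator nn_integral_indicator_singleton')
    finally show ?thesis using i by (auto simp: indicator_def)
  next
    case False
    then have "(\<integral>\<^sup>+j. g x * indicator (E j) x \<partial>count_space I) = (\<integral>\<^sup>+j. 0 \<partial>count_space I)"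
      by (intro nn_integral_cong) auto
    then show ?thesis using False by auto
  qed
  show ?thesis
    by (subst nn_integral_count_space_nn_integral[symmetric]) (use I E * in \<open>auto intro!: nn_integral_cong\<close>)
qed

text \<open>The left end is excluded and the right end included because the level sets below are
  defined by strict lower bounds.\<close>

lemma powr_between:
  fixes a x :: real
  assumes "1 < a" "0 < x"
  obtains k :: int where "a powr k < x" "x \<le> a powr (k + 1)"
proof
  let ?k = "\<lceil>log a x\<rceil> - 1"
  have "?k < log a x" "log a x \<le> ?k + 1" by linarith+
  then show "a powr ?k < x" "x \<le> a powr (?k + 1)"
    using assms by (simp_all add: less_log_iff[symmetric] log_le_iff[symmetric])
qed

lemma nn_integral_count_space_int_geometric:
  fixes c :: real and k0 :: int
  assumes "0 < c"
  shows "(\<integral>\<^sup>+k. ennreal (2 powr (- c * k)) * indicator {k0..} k \<partial>count_space UNIV)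
           = ennreal (2 powr (- c * k0) / (1 - 2 powr (- c)))"
proof -
  have [simp]: "2 powr (- c) < 1"
    using assms powr_less_mono[of "- c" 0 2] by simp
  have "(\<integral>\<^sup>+k. ennreal (2 powr (- c * k)) * indicator {k0..} k \<partial>count_space UNIV)
     = (\<integral>\<^sup>+k. ennreal (2 powr (- c * real_of_int k)) \<partial>count_space {k0..})"
    by (simp add: nn_integral_count_space_indicator)
  also have "\<dots> = (\<integral>\<^sup>+i. ennreal (2 powr (- c * (k0 + int i))) \<partial>count_space UNIV)"
    by (rule nn_integral_bij_count_space[symmetric], rule bij_betwI[where g = "\<lambda>k. nat (k - k0)"]) auto
  also have "\<dots> = (\<integral>\<^sup>+i. ennreal (2 powr (- c * k0) * (2 powr (- c)) ^ i) \<partial>count_space UNIV)"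
    by (intro nn_integral_cong) (simp add: powr_add[symmetric] powr_realpow[symmetric] powr_powr algebra_simps)
  also have "\<dots> = (\<Sum>i. ennreal (2 powr (- c * k0) * (2 powr (- c)) ^ i))"
    by (rule nn_integral_count_space_nat)
  also have "\<dots> = ennreal (\<Sum>i. 2 powr (- c * k0) * (2 powr (- c)) ^ i)"
    using assms by (intro suminf_ennreal2 summable_mult summable_geometric) auto
  also have "(\<Sum>i. 2 powr (- c * k0) * (2 powr (- c)) ^ i) = 2 powr (- c * k0) / (1 - 2 powr (- c))"
    using assms by (subst suminf_mult) (auto simp: suminf_geometric intro!: summable_geometric)
  finally show ?thesis .
qed

lemma nn_integral_count_space_int_geometric':
  fixes c :: real and k0 :: int
  assumes "0 < c"
  shows "(\<integral>\<^sup>+k. ennreal (2 powr (c * k)) * indicator {..k0} k \<partial>count_space UNIV)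
           = ennreal (2 powr (c * k0) / (1 - 2 powr (- c)))"
proof -
  have "(\<integral>\<^sup>+k. ennreal (2 powr (c * k)) * indicator {..k0} k \<partial>count_space UNIV)
     = (\<integral>\<^sup>+k. ennreal (2 powr (c * (- k))) * indicator {..k0} (- k) \<partial>count_space UNIV)"
    using bij_uminus by (subst nn_integral_bij_count_space[symmetric, where g = uminus and A = UNIV and B = UNIV]) auto
  also have "\<dots> = (\<integral>\<^sup>+k. ennreal (2 powr (- c * k)) * indicator {- k0..} k \<partial>count_space UNIV)"
    by (intro nn_integral_cong) (auto simp: indicator_def)
  also have "\<dots> = ennreal (2 powr (c * k0) / (1 - 2 powr (- c)))"
    using nn_integral_count_space_int_geometric[OF assms, of "- k0"] by simp
  finally show ?thesis .
qed

section \<open>Dyadic grids and the maximal function\<close>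

abbreviation maximal_const :: "real \<Rightarrow> ennreal" where
  "maximal_const p \<equiv> ennreal (2 powr (2 * p) / (1 - 2 powr (1 - p)))"

text \<open>Larger levels k mean smaller cubes, and \<open>d\<close> stands for the dimension. Cubes
  are addressed by pairs of level and label rather than as sets, so that their size can be read off
  and sums over cubes are sums over a countable type. The abstract form serves all shifted grids at
  once.\<close>

locale dyadic_grid =
  fixes Q :: "int \<Rightarrow> 'i :: countable \<Rightarrow> 'a set" and M :: "'a measure" and d :: real
  assumes d_pos: "0 < d"
    and sets_Q [measurable]: "Q k m \<in> sets M"
    and disjoint: "m \<noteq> m' \<Longrightarrow> Q k m \<inter> Q k m' = {}"
    and cover: "x \<in> space M \<Longrightarrow> \<exists>m. x \<in> Q k m"
    and nested: "k' \<le> k \<Longrightarrow> Q k m \<inter> Q k' m' \<noteq> {} \<Longrightarrow> Q k m \<subseteq> Q k' m'"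
    and emeasure_Q: "emeasure M (Q k m) = ennreal (2 powr (- d * k))"
begin

definition cube :: "int \<times> 'i \<Rightarrow> 'a set" where
  "cube i = Q (fst i) (snd i)"

abbreviation level :: "int \<times> 'i \<Rightarrow> real" where
  "level i \<equiv> real_of_int (fst i)"

abbreviation scale :: "real \<Rightarrow> int \<times> 'i \<Rightarrow> ennreal" where
  "scale c i \<equiv> ennreal (2 powr (c * level i))"

abbreviation cube_integral :: "'a measure \<Rightarrow> ('a \<Rightarrow> ennreal) \<Rightarrow> int \<times> 'i \<Rightarrow> ennreal" where
  "cube_integral N g i \<equiv> (\<integral>\<^sup>+x. g x * indicator (cube i) x \<partial>N)"

lemma sets_cube [measurable]: "cube i \<in> sets M"
  by (simp add: cube_def)

lemma emeasure_cube: "emeasure M (cube i) = scale (- d) i"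
  by (simp add: cube_def emeasure_Q)

lemma cube_nonempty: "cube i \<noteq> {}"
  using emeasure_cube[of i] by auto

lemma cube_nested: "fst i' \<le> fst i \<Longrightarrow> cube i \<inter> cube i' \<noteq> {} \<Longrightarrow> cube i \<subseteq> cube i'"
  by (simp add: cube_def nested)

lemma cube_disjoint: "fst i = fst i' \<Longrightarrow> i \<noteq> i' \<Longrightarrow> cube i \<inter> cube i' = {}"
  by (cases i; cases i') (auto simp: cube_def dest: disjoint)

text \<open>Maximality is expressed by levels: no member of \<open>S\<close> that meets the cube is
  coarser. By nestedness this means that no member contains it properly.\<close>

definition maximal_cubes :: "(int \<times> 'i) set \<Rightarrow> (int \<times> 'i) set" where
  "maximal_cubes S = {i \<in> S. \<forall>i'\<in>S. cube i \<inter> cube i' \<noteq> {} \<longrightarrow> fst i \<le> fst i'}"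

lemma maximal_cubes_subset: "maximal_cubes S \<subseteq> S"
  by (auto simp: maximal_cubes_def)

lemma maximal_cubesD:
  "i \<in> maximal_cubes S \<Longrightarrow> i' \<in> S \<Longrightarrow> cube i \<inter> cube i' \<noteq> {} \<Longrightarrow> fst i \<le> fst i' \<and> cube i' \<subseteq> cube i"
  using cube_nested[of i i'] by (auto simp: maximal_cubes_def)

lemma disjoint_maximal_cubes: "disjoint_family_on cube (maximal_cubes S)"
  unfolding disjoint_family_on_def
proof (intro ballI impI)
  fix i i' assume i: "i \<in> maximal_cubes S" "i' \<in> maximal_cubes S" "i \<noteq> i'"
  show "cube i \<inter> cube i' = {}"
  proof (rule ccontr)
    assume *: "cube i \<inter> cube i' \<noteq> {}"
    have "fst i \<le> fst i'" "fst i' \<le> fst i"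
      using i * unfolding maximal_cubes_def by (auto simp only: mem_Collect_eq Int_commute)
    then show False using cube_disjoint[of i i'] i * by simp
  qed
qed

lemma maximal_cubes_cover:
  assumes bdd: "\<And>i. i \<in> S \<Longrightarrow> b \<le> fst i" and i: "i \<in> S"
  obtains i' where "i' \<in> maximal_cubes S" "fst i' \<le> fst i" "cube i \<subseteq> cube i'"
proof -
  obtain x where x: "x \<in> cube i" using cube_nonempty by blast
  \<comment> \<open>Counting levels from the lower bound b turns the search for the coarsest cube of
    \<open>S\<close> through x into a \<open>LEAST\<close> over the naturals.\<close>
  define P where "P n \<longleftrightarrow> (\<exists>i'\<in>S. x \<in> cube i' \<and> fst i' = b + int n)" for n
  have "P (nat (fst i - b))" using i x bdd[OF i] by (auto simp: P_def)
  then have "P (LEAST n. P n)" by (rule LeastI)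
  then obtain i' where i': "i' \<in> S" "x \<in> cube i'" "fst i' = b + int (LEAST n. P n)"
    by (auto simp: P_def)
  have least: "fst i' \<le> fst j" if "j \<in> S" "x \<in> cube j" for j
  proof -
    have "P (nat (fst j - b))" using that bdd[of j] by (auto simp: P_def)
    then have "(LEAST n. P n) \<le> nat (fst j - b)" by (rule Least_le)
    then show ?thesis using i' bdd[of j] that by simp
  qed
  have "i' \<in> maximal_cubes S"
    unfolding maximal_cubes_def
  proof (intro CollectI conjI ballI impI)
    fix j assume j: "j \<in> S" "cube i' \<inter> cube j \<noteq> {}"
    show "fst i' \<le> fst j"
    proof (rule ccontr)
      assume *: "\<not> ?thesis"
      then have "cube i' \<subseteq> cube j" using j by (intro cube_nested) auto
      then show False using least[of j] j i' * by auto
    qed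
  qed (rule i')
  moreover have le: "fst i' \<le> fst i" using i x by (rule least)
  moreover have "cube i \<subseteq> cube i'" using le x i'(2) by (intro cube_nested) auto
  ultimately show ?thesis by (rule that)
qed

lemma UN_maximal_cubes:
  assumes "\<And>i. i \<in> S \<Longrightarrow> b \<le> fst i"
  shows "(\<Union>i\<in>maximal_cubes S. cube i) = (\<Union>i\<in>S. cube i)"
proof
  show "(\<Union>i\<in>maximal_cubes S. cube i) \<subseteq> (\<Union>i\<in>S. cube i)"
    using maximal_cubes_subset by (rule UN_mono) simp
  show "(\<Union>i\<in>S. cube i) \<subseteq> (\<Union>i\<in>maximal_cubes S. cube i)"
  proof (rule UN_least)
    fix i assume "i \<in> S"
    then obtain i' where "i' \<in> maximal_cubes S" "cube i \<subseteq> cube i'"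
      using maximal_cubes_cover[OF assms] by metis
    then show "cube i \<subseteq> (\<Union>i\<in>maximal_cubes S. cube i)" by blast
  qed
qed

text \<open>The maximal cubes are disjoint and cover the same set, so the inequalities assumed for
  them can be added up.\<close>

lemma weak_type_bounded:
  fixes g :: "'a \<Rightarrow> ennreal"
  assumes N: "sets N = sets M" "sets N' = sets M" and g: "g \<in> borel_measurable N'"
    and S: "\<And>i. i \<in> S \<Longrightarrow> l * emeasure N (cube i) \<le> cube_integral N' g i"
    and bdd: "\<And>i. i \<in> S \<Longrightarrow> b \<le> fst i"
  shows "l * emeasure N (\<Union>i\<in>S. cube i) \<le> (\<integral>\<^sup>+x. g x \<partial>N')"
proof -
  have [measurable]: "cube i \<in> sets N" "cube i \<in> sets N'" for i by (simp_all add: N)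
  let ?S = "maximal_cubes S"
  have "emeasure N (\<Union>i\<in>S. cube i) = emeasure N (\<Union>i\<in>?S. cube i)"
    using UN_maximal_cubes[of S b] bdd by simp
  also have "\<dots> = (\<integral>\<^sup>+i. emeasure N (cube i) \<partial>count_space ?S)"
    by (intro emeasure_UN_countable disjoint_maximal_cubes) auto
  finally have "l * emeasure N (\<Union>i\<in>S. cube i) = (\<integral>\<^sup>+i. l * emeasure N (cube i) \<partial>count_space ?S)"
    by (simp add: nn_integral_cmult)
  also have "\<dots> \<le> (\<integral>\<^sup>+i. cube_integral N' g i \<partial>count_space ?S)"
    using maximal_cubes_subset[of S] by (intro nn_integral_mono S) auto
  also have "\<dots> = (\<integral>\<^sup>+x. g x * indicator (\<Union>i\<in>?S. cube i) x \<partial>N')"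
    by (intro nn_integral_disjoint_family_le disjoint_maximal_cubes g) auto
  also have "\<dots> \<le> (\<integral>\<^sup>+x. g x \<partial>N')"
    by (intro nn_integral_mono) (auto simp: indicator_def)
  finally show ?thesis .
qed

text \<open>Without a coarsest level there need be no maximal cubes. The cubes of level at least -n
  increase to all of \<open>S\<close>, and continuity of the measure from below gives the limit. The
  measures \<open>N\<close> and \<open>N'\<close> differ when a weighted integral is compared with
  the measure \<open>M\<close> of the cubes.\<close>

lemma weak_type:
  fixes g :: "'a \<Rightarrow> ennreal"
  assumes N: "sets N = sets M" "sets N' = sets M" and g: "g \<in> borel_measurable N'"
    and S: "\<And>i. i \<in> S \<Longrightarrow> l * emeasure N (cube i) \<le> cube_integral N' g i"
  shows "l * emeasure N (\<Union>i\<in>S. cube i) \<le> (\<integral>\<^sup>+x. g x \<partial>N')"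
proof -
  have [measurable]: "cube i \<in> sets N" "cube i \<in> sets N'" for i by (simp_all add: N)
  define A where "A n = (\<Union>i\<in>{i\<in>S. - int n \<le> fst i}. cube i)" for n
  have "(\<Union>i\<in>S. cube i) = (\<Union>n. A n)"
  proof (intro antisym UN_least)
    fix i assume "i \<in> S"
    then have "cube i \<subseteq> A (nat (- fst i))" unfolding A_def by (intro UN_upper) simp
    then show "cube i \<subseteq> (\<Union>n. A n)" by blast
  next
    fix n show "A n \<subseteq> (\<Union>i\<in>S. cube i)" unfolding A_def by (rule UN_mono) auto
  qed
  moreover have "(SUP n. emeasure N (A n)) = emeasure N (\<Union>n. A n)"
  proof (rule SUP_emeasure_incseq)
    show "range A \<subseteq> sets N" by (auto simp: A_def)
    show "incseq A" unfolding A_def incseq_def by (intro allI impI UN_mono) auto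
  qed
  ultimately have "l * emeasure N (\<Union>i\<in>S. cube i) = (SUP n. l * emeasure N (A n))"
    by (simp add: SUP_mult_left_ennreal[symmetric])
  also have "\<dots> \<le> (\<integral>\<^sup>+x. g x \<partial>N')"
    unfolding A_def by (intro SUP_least weak_type_bounded N g S) auto
  finally show ?thesis .
qed

section \<open>The dyadic maximal function\<close>

definition average :: "'a measure \<Rightarrow> ('a \<Rightarrow> ennreal) \<Rightarrow> int \<times> 'i \<Rightarrow> ennreal" where
  "average N g i = cube_integral N g i / emeasure N (cube i)"

text \<open>Averages are taken with respect to \<open>N\<close> itself, which makes the constants in
  the bounds below independent of \<open>N\<close>.\<close>

definition maximal_function :: "'a measure \<Rightarrow> ('a \<Rightarrow> ennreal) \<Rightarrow> 'a \<Rightarrow> ennreal" where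
  "maximal_function N g x = (SUP i. average N g i * indicator (cube i) x)"

lemma borel_measurable_maximal_function [measurable]:
  assumes "sets N = sets M"
  shows "maximal_function N g \<in> borel_measurable N"
proof -
  have [measurable]: "cube i \<in> sets N" for i by (simp add: assms)
  show ?thesis unfolding maximal_function_def[abs_def] by measurable
qed

lemma average_le_maximal_function: "x \<in> cube i \<Longrightarrow> average N g i \<le> maximal_function N g x"
  unfolding maximal_function_def by (rule SUP_upper2[of i]) auto

lemma less_maximal_function_iff:
  "l < maximal_function N g x \<longleftrightarrow> (\<exists>i. x \<in> cube i \<and> l < average N g i)"
  unfolding maximal_function_def less_SUP_iff by (auto simp: indicator_def)

lemma weak_type_maximal_function:
  fixes g :: "'a \<Rightarrow> ennreal"
  assumes N: "sets N = sets M" and g: "g \<in> borel_measurable N"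
    and N_Q: "\<And>i. emeasure N (cube i) \<noteq> 0" "\<And>i. emeasure N (cube i) \<noteq> top"
  shows "l * emeasure N {x \<in> space N. l < maximal_function N g x} \<le> (\<integral>\<^sup>+x. g x \<partial>N)"
proof -
  have "cube i \<subseteq> space N" for i
    using sets.sets_into_space[of "cube i" N] by (simp add: N)
  then have "{x \<in> space N. l < maximal_function N g x} = (\<Union>i\<in>{i. l < average N g i}. cube i)"
    by (auto simp: less_maximal_function_iff)
  moreover have "l * emeasure N (\<Union>i\<in>{i. l < average N g i}. cube i) \<le> (\<integral>\<^sup>+x. g x \<partial>N)"
  proof (rule weak_type[OF N N g])
    fix i assume "i \<in> {i. l < average N g i}"
    then have "l * emeasure N (cube i) \<le> average N g i * emeasure N (cube i)"
      by (intro mult_right_mono) auto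
    also have "\<dots> = cube_integral N g i"
      using N_Q[of i] by (simp add: average_def ennreal_divide_times ennreal_times_divide mult_divide_eq_ennreal)
    finally show "l * emeasure N (cube i) \<le> cube_integral N g i" .
  qed
  ultimately show ?thesis by simp
qed

text \<open>Truncation as in Marcinkiewicz interpolation: the part of \<open>g\<close> not exceeding
  l contributes at most l to every average.\<close>

lemma maximal_function_le_add:
  fixes g :: "'a \<Rightarrow> ennreal"
  assumes N: "sets N = sets M" and [measurable]: "g \<in> borel_measurable N"
    and N_Q: "\<And>i. emeasure N (cube i) \<noteq> 0" "\<And>i. emeasure N (cube i) \<noteq> top"
  shows "maximal_function N g x \<le> maximal_function N (\<lambda>x. g x * indicator {x. l < g x} x) x + l"
  unfolding maximal_function_def[of N g]
proof (rule SUP_least)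
  fix i
  have [measurable]: "cube i \<in> sets N" by (simp add: N)
  have "cube_integral N g i
     \<le> (\<integral>\<^sup>+x. g x * indicator {x. l < g x} x * indicator (cube i) x + l * indicator (cube i) x \<partial>N)"
    by (intro nn_integral_mono) (auto simp: indicator_def not_less)
  also have "\<dots> = (\<integral>\<^sup>+x. g x * indicator {x. l < g x} x * indicator (cube i) x \<partial>N) + l * emeasure N (cube i)"
    by (subst nn_integral_add) (auto simp: nn_integral_cmult_indicator)
  finally have "average N g i \<le>
     ((\<integral>\<^sup>+x. g x * indicator {x. l < g x} x * indicator (cube i) x \<partial>N) + l * emeasure N (cube i)) / emeasure N (cube i)"
    unfolding average_def by (rule divide_right_mono_ennreal)
  also have "\<dots> = average N (\<lambda>x. g x * indicator {x. l < g x} x) i + l"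
    using N_Q[of i] by (simp add: average_def add_divide_distrib_ennreal mult_divide_eq_ennreal)
  finally have "average N g i \<le> average N (\<lambda>x. g x * indicator {x. l < g x} x) i + l" .
  then show "average N g i * indicator (cube i) x \<le> maximal_function N (\<lambda>x. g x * indicator {x. l < g x} x) x + l"
    using average_le_maximal_function[of x i N "\<lambda>x. g x * indicator {x. l < g x} x"]
    by (cases "x \<in> cube i") (auto intro: order_trans add_right_mono)
qed

end

section \<open>Discrete layer-cake estimates and the strong type bound\<close>

text \<open>One term suffices when v is finite and positive: the j with 2^j < v \<le> 2^(j+1),
  because the coefficient is 2^((j+1)p). When v is infinite all terms occur and the sum
  diverges.\<close>

lemma epowr_le_dyadic_sum:
  fixes v :: ennreal
  assumes "1 < p"
  shows "v epowr p \<le> (\<integral>\<^sup>+j. ennreal (2 powr ((real_of_int j + 1) * p)) * indicator {j. ennreal (2 powr real_of_int j) < v} j \<partial>count_space UNIV)"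
    (is "_ \<le> ?S")
proof -
  have term_le: "ennreal (2 powr ((real_of_int j + 1) * p)) \<le> ?S" if "ennreal (2 powr j) < v" for j
    using nn_integral_count_space_ge_term[of j UNIV "\<lambda>j. ennreal (2 powr ((real_of_int j + 1) * p)) * indicator {j. ennreal (2 powr real_of_int j) < v} j"]
      that by simp
  show ?thesis
  proof (cases v)
    case (real r)
    show ?thesis
    proof (cases "r = 0")
      case False
      with real have "0 < r" by simp
      obtain j where j: "2 powr real_of_int j < r" "r \<le> 2 powr (real_of_int j + 1)"
        using powr_between[of 2 r] \<open>0 < r\<close> by auto
      have "v epowr p = ennreal (r powr p)" using real \<open>0 < r\<close> by (simp add: epowr_ennreal)
      also have "\<dots> \<le> ennreal ((2 powr (real_of_int j + 1)) powr p)"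
        using j \<open>0 < r\<close> assms by (intro ennreal_leI powr_mono2) auto
      also have "\<dots> = ennreal (2 powr ((real_of_int j + 1) * p))" by (simp add: powr_powr)
      also have "\<dots> \<le> ?S" using j real by (intro term_le) (simp add: ennreal_less_iff)
      finally show ?thesis .
    qed (use assms real in auto)
  next
    case top
    have "ennreal (real n) \<le> ?S" for n
    proof -
      have "real n \<le> 2 ^ n" using of_nat_less_two_power[of n, where ?'a = real] by simp
      also have "\<dots> = 2 powr real n" by (simp add: powr_realpow)
      also have "\<dots> \<le> 2 powr ((real n + 1) * p)"
        using assms mult_mono[of "real n" "real n + 1" 1 p] by (intro powr_mono) auto
      finally have "ennreal (real n) \<le> ennreal (2 powr ((real_of_int (int n) + 1) * p))"
        by (simp add: ennreal_leI)
      also have "\<dots> \<le> ?S" by (rule term_le) (simp add: top)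
      finally show ?thesis .
    qed
    then have "\<not> ?S < of_nat n" for n
      by (simp add: not_less ennreal_of_nat_eq_real_of_nat)
    then have "?S = top"
      using ennreal_Ex_less_of_nat[of ?S] by (metis less_top)
    then show ?thesis by simp
  qed
qed

text \<open>Only the j with 2^j < 2v occur, and since p > 1 the sum is geometric towards minus
  infinity, hence of the order of v^(p-1). The halved threshold matches the truncation of a function
  at half the level.\<close>

lemma dyadic_sum_le_epowr:
  fixes v :: ennreal
  assumes "1 < p"
  shows "v * (\<integral>\<^sup>+j. ennreal (2 powr ((p - 1) * real_of_int j)) * indicator {j. ennreal (2 powr real_of_int j / 2) < v} j \<partial>count_space UNIV)
      \<le> ennreal (2 powr (p - 1) / (1 - 2 powr (1 - p))) * v epowr p"
proof (cases v)
  case (real r)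
  show ?thesis
  proof (cases "r = 0")
    case False
    with real have r: "0 < r" by simp
    obtain j0 where j0: "2 powr real_of_int j0 < 2 * r" "2 * r \<le> 2 powr (real_of_int j0 + 1)"
      using powr_between[of 2 "2 * r"] r by auto
    have "j \<le> j0" if "2 powr real_of_int j / 2 < r" for j
    proof -
      have "2 powr real_of_int j < 2 powr (real_of_int j0 + 1)" using that j0 by linarith
      then have "real_of_int j < real_of_int j0 + 1"
        by (rule powr_less_cancel_iff[THEN iffD1, rotated]) simp
      then show ?thesis by simp
    qed
    then have "(\<integral>\<^sup>+j. ennreal (2 powr ((p - 1) * real_of_int j)) * indicator {j. ennreal (2 powr real_of_int j / 2) < v} j \<partial>count_space UNIV)
      \<le> (\<integral>\<^sup>+j. ennreal (2 powr ((p - 1) * real_of_int j)) * indicator {..j0} j \<partial>count_space UNIV)"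
      using real by (intro nn_integral_mono) (auto simp: indicator_def ennreal_less_iff)
    also have "\<dots> = ennreal (2 powr ((p - 1) * j0) / (1 - 2 powr (1 - p)))"
      using nn_integral_count_space_int_geometric'[of "p - 1" j0] assms by simp
    also have "\<dots> \<le> ennreal ((2 * r) powr (p - 1) / (1 - 2 powr (1 - p)))"
    proof -
      have "2 powr (1 - p) \<le> 1" using assms powr_mono[of "1 - p" 0 2] by simp
      moreover have "2 powr ((p - 1) * j0) \<le> (2 * r) powr (p - 1)"
        using powr_mono2[of "p - 1" "2 powr j0" "2 * r"] j0 assms by (simp add: powr_powr mult.commute)
      ultimately show ?thesis by (intro ennreal_leI divide_right_mono) auto
    qed
    finally have "v * (\<integral>\<^sup>+j. ennreal (2 powr ((p - 1) * real_of_int j)) * indicator {j. ennreal (2 powr real_of_int j / 2) < v} j \<partial>count_space UNIV)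
       \<le> ennreal r * ennreal ((2 * r) powr (p - 1) / (1 - 2 powr (1 - p)))"
      using real by (intro mult_mono) auto
    also have "\<dots> = ennreal (2 powr (p - 1) / (1 - 2 powr (1 - p)) * r powr p)"
    proof -
      have "r * (2 * r) powr (p - 1) = 2 powr (p - 1) * r powr p"
        using r by (simp add: powr_mult powr_diff)
      then show ?thesis using r by (subst ennreal_mult'[symmetric]) simp_all
    qed
    also have "\<dots> = ennreal (2 powr (p - 1) / (1 - 2 powr (1 - p))) * v epowr p"
      using r real by (subst ennreal_mult'') (simp_all add: epowr_ennreal)
    finally show ?thesis .
  qed (use real in auto)
next
  case top
  have "2 powr (1 - p) < 1" using assms powr_less_mono[of "1 - p" 0 2] by simp
  then show ?thesis using assms top by (simp add: ennreal_mult_top)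
qed

context dyadic_grid
begin

text \<open>Marcinkiewicz interpolation over dyadic levels: for the level 2^j, \<open>g\<close> is
  truncated at 2^j / 2 and the weak type bound is applied to the upper part, since the lower part
  cannot raise the maximal function above 2^j / 2. The two exchanges of sum and integral are
  Tonelli's theorem.\<close>

lemma strong_type_maximal_function:
  fixes g :: "'a \<Rightarrow> ennreal"
  assumes p: "1 < p" and N: "sets N = sets M" and g[measurable]: "g \<in> borel_measurable N"
    and N_Q: "\<And>i. emeasure N (cube i) \<noteq> 0" "\<And>i. emeasure N (cube i) \<noteq> top"
  shows "(\<integral>\<^sup>+x. maximal_function N g x epowr p \<partial>N)
           \<le> maximal_const p * (\<integral>\<^sup>+x. g x epowr p \<partial>N)"
proof -
  note [measurable] = borel_measurable_maximal_function[OF N]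
  let ?l = "\<lambda>j::int. ennreal (2 powr j)" and ?h = "\<lambda>j::int. ennreal (2 powr j / 2)"
  let ?E = "\<lambda>j. {x \<in> space N. ?l j < maximal_function N g x}"
  let ?c = "\<lambda>j::int. ennreal (2 powr ((real_of_int j + 1) * p))"
  let ?g = "\<lambda>j x. g x * indicator {x. ?h j < g x} x"
  have weak: "?c j * emeasure N (?E j) \<le> ennreal (2 powr (p + 1)) *
      (\<integral>\<^sup>+x. g x * (ennreal (2 powr ((p - 1) * real_of_int j)) * indicator {j. ?h j < g x} j) \<partial>N)" for j
  proof -
    have "?E j \<subseteq> {x \<in> space N. ?h j < maximal_function N (?g j) x}"
    proof safe
      fix x assume "?l j < maximal_function N g x"
      also have "\<dots> \<le> maximal_function N (?g j) x + ?h j"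
        by (rule maximal_function_le_add[OF N g N_Q])
      finally have *: "?l j < maximal_function N (?g j) x + ?h j" .
      show "?h j < maximal_function N (?g j) x"
      proof (rule ccontr)
        assume "\<not> ?thesis"
        then have "maximal_function N (?g j) x + ?h j \<le> ?h j + ?h j" by (simp add: add_right_mono)
        also have "\<dots> = ?l j" by (simp add: ennreal_plus[symmetric] del: ennreal_plus)
        finally show False using * by simp
      qed
    qed
    then have "?h j * emeasure N (?E j) \<le> ?h j * emeasure N {x \<in> space N. ?h j < maximal_function N (?g j) x}"
      by (intro mult_left_mono emeasure_mono) auto
    also have "\<dots> \<le> (\<integral>\<^sup>+x. ?g j x \<partial>N)"
      by (rule weak_type_maximal_function[OF N _ N_Q]) measurable
    finally have *: "?h j * emeasure N (?E j) \<le> (\<integral>\<^sup>+x. ?g j x \<partial>N)" .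
    \<comment> \<open>The exponents are balanced by (j + 1)p = (p + 1) + (p - 1)j + (j - 1).\<close>
    have "?c j * emeasure N (?E j) = ennreal (2 powr (p + 1)) * ennreal (2 powr ((p - 1) * j)) * (?h j * emeasure N (?E j))"
      by (simp add: ennreal_mult'[symmetric] mult.assoc[symmetric] powr_add[symmetric] powr_diff powr_minus_divide
          powr_mult_base algebra_simps)
         (simp add: powr_add powr_diff field_simps)
    also have "\<dots> \<le> ennreal (2 powr (p + 1)) * ennreal (2 powr ((p - 1) * j)) * (\<integral>\<^sup>+x. ?g j x \<partial>N)"
      by (intro mult_left_mono *) auto
    also have "\<dots> = ennreal (2 powr (p + 1)) *
      (\<integral>\<^sup>+x. g x * (ennreal (2 powr ((p - 1) * real_of_int j)) * indicator {j. ?h j < g x} j) \<partial>N)"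
      unfolding mult.assoc
      by (subst nn_integral_cmult[symmetric]) (auto intro!: arg_cong[where f = "(*) _"] nn_integral_cong simp: indicator_def ac_simps)
    finally show ?thesis .
  qed
  have "(\<integral>\<^sup>+x. maximal_function N g x epowr p \<partial>N)
     \<le> (\<integral>\<^sup>+x. (\<integral>\<^sup>+j. ?c j * indicator (?E j) x \<partial>count_space UNIV) \<partial>N)"
  proof (rule nn_integral_mono)
    fix x assume "x \<in> space N"
    then show "maximal_function N g x epowr p \<le> (\<integral>\<^sup>+j. ?c j * indicator (?E j) x \<partial>count_space UNIV)"
      using epowr_le_dyadic_sum[OF p, of "maximal_function N g x"] by (simp add: indicator_def)
  qed
  also have "\<dots> = (\<integral>\<^sup>+j. ?c j * emeasure N (?E j) \<partial>count_space UNIV)"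
    by (subst nn_integral_count_space_nn_integral) (auto simp: nn_integral_cmult_indicator)
  also have "\<dots> \<le> (\<integral>\<^sup>+j. ennreal (2 powr (p + 1)) *
      (\<integral>\<^sup>+x. g x * (ennreal (2 powr ((p - 1) * real_of_int j)) * indicator {j. ?h j < g x} j) \<partial>N) \<partial>count_space UNIV)"
    by (intro nn_integral_mono weak)
  also have "\<dots> = ennreal (2 powr (p + 1)) *
      (\<integral>\<^sup>+x. g x * (\<integral>\<^sup>+j. ennreal (2 powr ((p - 1) * real_of_int j)) * indicator {j. ?h j < g x} j \<partial>count_space UNIV) \<partial>N)"
  proof -
    have "(\<lambda>x. g x * (ennreal (2 powr ((p - 1) * real_of_int j)) * indicator {j. ?h j < g x} j)) \<in> borel_measurable N" for j
    proof -
      have "(\<lambda>x. g x * (ennreal (2 powr ((p - 1) * real_of_int j)) * indicator {x. ?h j < g x} x)) \<in> borel_measurable N"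
        by measurable
      then show ?thesis by (simp add: indicator_def)
    qed
    then show ?thesis
      by (simp add: nn_integral_cmult nn_integral_count_space_nn_integral[symmetric])
  qed
  also have "\<dots> \<le> ennreal (2 powr (p + 1)) *
      (\<integral>\<^sup>+x. ennreal (2 powr (p - 1) / (1 - 2 powr (1 - p))) * g x epowr p \<partial>N)"
    by (intro mult_left_mono nn_integral_mono dyadic_sum_le_epowr p) auto
  also have "\<dots> = maximal_const p * (\<integral>\<^sup>+x. g x epowr p \<partial>N)"
  proof -
    have "2 powr (p + 1) * 2 powr (p - 1) = (2::real) powr (2 * p)"
      by (simp add: powr_add[symmetric])
    then show ?thesis
      by (subst nn_integral_cmult) (auto simp: mult.assoc[symmetric] ennreal_mult'[symmetric])
  qed
  finally show ?thesis .
qed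

text \<open>On E j the maximal function of \<open>g\<close> is at least the average over the cube,
  so each term is at most C times the integral of its p-th power over E j; disjointness lets these
  be added. Index and cube are kept apart because principal cubes are indexed together with a
  threshold.\<close>

lemma Carleson_embedding:
  fixes g :: "'a \<Rightarrow> ennreal" and c :: "'j \<Rightarrow> int \<times> 'i"
  assumes p: "1 < p" and N: "sets N = sets M" and g[measurable]: "g \<in> borel_measurable N"
    and N_Q: "\<And>i. emeasure N (cube i) \<noteq> 0" "\<And>i. emeasure N (cube i) \<noteq> top"
    and J: "countable J"
    and E: "\<And>j. j \<in> J \<Longrightarrow> E j \<in> sets M" "\<And>j. j \<in> J \<Longrightarrow> E j \<subseteq> cube (c j)" "disjoint_family_on E J"
    and sparse: "\<And>j. j \<in> J \<Longrightarrow> emeasure N (cube (c j)) \<le> C * emeasure N (E j)"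
  shows "(\<integral>\<^sup>+j. emeasure N (cube (c j)) * average N g (c j) epowr p \<partial>count_space J)
           \<le> C * (maximal_const p * (\<integral>\<^sup>+x. g x epowr p \<partial>N))"
proof -
  note [measurable] = borel_measurable_maximal_function[OF N]
  have EN: "E j \<in> sets N" if "j \<in> J" for j using E(1)[OF that] by (simp add: N)
  let ?F = "\<lambda>x. maximal_function N g x epowr p"
  have "emeasure N (cube (c j)) * average N g (c j) epowr p
      \<le> C * (\<integral>\<^sup>+x. ?F x * indicator (E j) x \<partial>N)" if j: "j \<in> J" for j
  proof -
    have "emeasure N (cube (c j)) * average N g (c j) epowr p
        \<le> C * emeasure N (E j) * average N g (c j) epowr p"
      by (intro mult_right_mono sparse j) auto
    also have "\<dots> = C * (\<integral>\<^sup>+x. average N g (c j) epowr p * indicator (E j) x \<partial>N)"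
      using EN[OF j] by (subst nn_integral_cmult_indicator) (simp_all add: ac_simps)
    also have "\<dots> \<le> C * (\<integral>\<^sup>+x. ?F x * indicator (E j) x \<partial>N)"
      using E(2)[OF j] p
      by (intro mult_left_mono nn_integral_mono) (auto simp: indicator_def intro!: epowr_mono average_le_maximal_function)
    finally show ?thesis .
  qed
  then have "(\<integral>\<^sup>+j. emeasure N (cube (c j)) * average N g (c j) epowr p \<partial>count_space J)
     \<le> (\<integral>\<^sup>+j. C * (\<integral>\<^sup>+x. ?F x * indicator (E j) x \<partial>N) \<partial>count_space J)"
    by (intro nn_integral_mono) simp
  also have "\<dots> = C * (\<integral>\<^sup>+x. ?F x * indicator (\<Union>j\<in>J. E j) x \<partial>N)"
    using E EN J by (simp add: nn_integral_cmult nn_integral_disjoint_family_le)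
  also have "\<dots> \<le> C * (\<integral>\<^sup>+x. ?F x \<partial>N)"
    by (intro mult_left_mono nn_integral_mono) (auto simp: indicator_def)
  also have "\<dots> \<le> C * (maximal_const p * (\<integral>\<^sup>+x. g x epowr p \<partial>N))"
    by (intro mult_left_mono strong_type_maximal_function p N g N_Q) auto
  finally show ?thesis .
qed

text \<open>Consecutive thresholds have ratio \<open>2 powr (d + 1)\<close>: passing to the parent cube loses at most a
  factor \<open>2 powr d\<close> in the average, so the cubes of the next level cover at most half of a maximal
  cube of the present one.\<close>

abbreviation threshold :: "int \<Rightarrow> ennreal" where
  "threshold j \<equiv> ennreal (2 powr ((d + 1) * real_of_int j))"

text \<open>At each level the subcubes are disjoint, so their integrals add up to at most the one
  over \<open>i0\<close>; the factor 2^(-ck) makes the sum over the levels k \<ge>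
  \<open>fst i0\<close> geometric.\<close>

lemma sum_subcubes_le:
  fixes h :: "'a \<Rightarrow> ennreal"
  assumes c: "0 < c" and N: "sets N = sets M" and h[measurable]: "h \<in> borel_measurable N"
  shows "(\<integral>\<^sup>+i. scale (- c) i * cube_integral N h i
             * indicator {i. fst i0 \<le> fst i \<and> cube i \<subseteq> cube i0} i \<partial>count_space UNIV)
       \<le> ennreal (2 powr (- c * level i0) / (1 - 2 powr (- c))) * cube_integral N h i0"
    (is "?L \<le> _ * ?H i0")
proof -
  have [measurable]: "cube i \<in> sets N" for i by (simp add: N)
  have level: "(\<integral>\<^sup>+m. ?H (k, m) * indicator {m. cube (k, m) \<subseteq> cube i0} m \<partial>count_space UNIV) \<le> ?H i0" for k
  proof -
    have "(\<integral>\<^sup>+m. ?H (k, m) * indicator {m. cube (k, m) \<subseteq> cube i0} m \<partial>count_space UNIV)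
        = (\<integral>\<^sup>+m. ?H (k, m) \<partial>count_space {m. cube (k, m) \<subseteq> cube i0})"
      by (simp add: nn_integral_count_space_indicator)
    also have "\<dots> = (\<integral>\<^sup>+x. h x * indicator (\<Union>m\<in>{m. cube (k, m) \<subseteq> cube i0}. cube (k, m)) x \<partial>N)"
    proof (rule nn_integral_disjoint_family_le)
      show "disjoint_family_on (\<lambda>m. cube (k, m)) {m. cube (k, m) \<subseteq> cube i0}"
        unfolding disjoint_family_on_def by (intro ballI impI cube_disjoint) auto
    qed auto
    also have "\<dots> \<le> ?H i0"
      by (intro nn_integral_mono mult_left_mono) (auto simp: indicator_def)
    finally show ?thesis .
  qed
  have "?L = (\<integral>\<^sup>+k. (\<integral>\<^sup>+m. ennreal (2 powr (- c * real_of_int k)) * ?H (k, m)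
      * indicator {i. fst i0 \<le> fst i \<and> cube i \<subseteq> cube i0} (k, m) \<partial>count_space UNIV) \<partial>count_space UNIV)"
    by (subst nn_integral_fst_count_space[symmetric]) simp
  also have "\<dots> = (\<integral>\<^sup>+k. ennreal (2 powr (- c * real_of_int k)) * indicator {fst i0..} k *
      (\<integral>\<^sup>+m. ?H (k, m) * indicator {m. cube (k, m) \<subseteq> cube i0} m \<partial>count_space UNIV) \<partial>count_space UNIV)"
    by (intro nn_integral_cong, subst nn_integral_cmult[symmetric])
       (auto intro!: nn_integral_cong simp: indicator_def)
  also have "\<dots> \<le> (\<integral>\<^sup>+k. ennreal (2 powr (- c * real_of_int k)) * indicator {fst i0..} k * ?H i0 \<partial>count_space UNIV)"
    by (intro nn_integral_mono mult_left_mono level) auto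
  also have "\<dots> = ennreal (2 powr (- c * level i0) / (1 - 2 powr (- c))) * ?H i0"
    using nn_integral_count_space_int_geometric[OF c, of "fst i0"] by (simp add: nn_integral_multc)
  finally show ?thesis .
qed

section \<open>Principal cubes and their disjoint parts\<close>

text \<open>\<open>scale d i\<close> is the reciprocal of the measure of the cube under
  \<open>M\<close>: these are the cubes on which the mean of g dN with respect to \<open>M\<close>,
  not to \<open>N\<close>, exceeds the threshold. Under \<open>M\<close> a parent has exactly 2^d
  times the measure, so passing to it divides the mean by at most 2^d.\<close>

definition level_cubes :: "'a measure \<Rightarrow> ('a \<Rightarrow> ennreal) \<Rightarrow> int \<Rightarrow> (int \<times> 'i) set" where
  "level_cubes N g j = {i. threshold j
      < scale d i * cube_integral N g i}"

text \<open>A very large cube has a small mean, because the integral over it is at most the finite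
  total integral g0. The bound solves 2^((d+1)j) < 2^(dk) g0 for k.\<close>

lemma level_cubes_bounded_below:
  assumes "(\<integral>\<^sup>+x. g x \<partial>N) < top"
  obtains b where "\<And>i. i \<in> level_cubes N g j \<Longrightarrow> b \<le> fst i"
proof -
  obtain g0 where g0: "(\<integral>\<^sup>+x. g x \<partial>N) = ennreal g0" "0 \<le> g0"
    using assms by (cases "\<integral>\<^sup>+x. g x \<partial>N") auto
  have "\<lfloor>log 2 (2 powr ((d + 1) * j) / g0) / d\<rfloor> \<le> fst i" if i: "i \<in> level_cubes N g j" for i
  proof -
    have "cube_integral N g i \<le> ennreal g0"
      unfolding g0(1)[symmetric] by (intro nn_integral_mono) (auto simp: indicator_def)
    then have "scale d i * cube_integral N g i
        \<le> scale d i * ennreal g0"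
      by (intro mult_left_mono) auto
    with i have "threshold j < scale d i * ennreal g0"
      unfolding level_cubes_def mem_Collect_eq by (rule less_le_trans)
    then have *: "2 powr ((d + 1) * j) < 2 powr (d * level i) * g0"
      using g0 by (simp add: ennreal_mult[symmetric] ennreal_less_iff)
    then have "0 < g0" using g0 by (cases "g0 = 0") auto
    then have "2 powr ((d + 1) * j) / g0 < 2 powr (d * level i)" using * by (simp add: field_simps)
    then have "log 2 (2 powr ((d + 1) * j) / g0) < d * level i"
      using \<open>0 < g0\<close> by (simp add: log_less_iff)
    then have "log 2 (2 powr ((d + 1) * j) / g0) / d < fst i"
      using d_pos by (simp add: field_simps)
    then show ?thesis by linarith
  qed
  then show ?thesis by (rule that)
qed

lemma level_cubes_Suc: "j \<le> j' \<Longrightarrow> level_cubes N g j' \<subseteq> level_cubes N g j"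
proof
  fix i assume j: "j \<le> j'" and i: "i \<in> level_cubes N g j'"
  have "threshold j \<le> threshold j'"
    using j d_pos by (intro ennreal_leI powr_mono mult_left_mono) auto
  then show "i \<in> level_cubes N g j"
    using i unfolding level_cubes_def mem_Collect_eq by (rule le_less_trans)
qed

definition principal_cubes :: "'a measure \<Rightarrow> ('a \<Rightarrow> ennreal) \<Rightarrow> (int \<times> int \<times> 'i) set" where
  "principal_cubes N g = (SIGMA j:UNIV. maximal_cubes (level_cubes N g j))"

definition principal_part :: "'a measure \<Rightarrow> ('a \<Rightarrow> ennreal) \<Rightarrow> int \<times> int \<times> 'i \<Rightarrow> 'a set" where
  "principal_part N g l = cube (snd l) - (\<Union>i\<in>level_cubes N g (fst l + 1). cube i)"

text \<open>For equal thresholds the maximal cubes are disjoint; for different ones the part with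
  the lower threshold omits every cube selected at any higher one, as \<open>level_cubes\<close>
  decreases with the threshold.\<close>

lemma disjoint_principal_part:
  "disjoint_family_on (principal_part N g) (principal_cubes N g)"
proof -
  have *: "principal_part N g l \<inter> principal_part N g l' = {}"
    if "l \<in> principal_cubes N g" "l' \<in> principal_cubes N g" "fst l < fst l'" for l l'
  proof -
    have "snd l' \<in> level_cubes N g (fst l')"
      using that by (auto simp: principal_cubes_def maximal_cubes_def)
    then have "snd l' \<in> level_cubes N g (fst l + 1)"
      using level_cubes_Suc[of "fst l + 1" "fst l'"] that by auto
    then show ?thesis unfolding principal_part_def by blast
  qed
  show ?thesis
    unfolding disjoint_family_on_def
  proof (intro ballI impI)
    fix l l' assume l: "l \<in> principal_cubes N g" "l' \<in> principal_cubes N g" "l \<noteq> l'"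
    show "principal_part N g l \<inter> principal_part N g l' = {}"
    proof (cases "fst l = fst l'")
      case True
      then have "snd l \<noteq> snd l'" using l by (metis prod_eqI)
      then have "cube (snd l) \<inter> cube (snd l') = {}"
        using l True by (intro disjoint_family_onD[OF disjoint_maximal_cubes[of "level_cubes N g (fst l)"]])
          (auto simp: principal_cubes_def)
      then show ?thesis unfolding principal_part_def by blast
    next
      case False
      then show ?thesis using *[of l l'] *[of l' l] l by (metis Int_commute linorder_neqE)
    qed
  qed
qed

text \<open>By maximality the parent cube is not selected, so its mean is at most the threshold; the
  mean over the cube itself is larger by a factor of at most 2^d.\<close>

lemma principal_average_le:
  assumes l: "l \<in> principal_cubes N g" and N: "sets N = sets M" and g[measurable]: "g \<in> borel_measurable N"
  shows "scale d (snd l) * cube_integral N g (snd l)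
          \<le> ennreal (2 powr (d + (d + 1) * real_of_int (fst l)))"
proof -
  obtain j k m where jkm: "l = (j, k, m)" by (cases l)
  have max: "(k, m) \<in> maximal_cubes (level_cubes N g j)"
    using l by (simp add: principal_cubes_def jkm)
  obtain x where x: "x \<in> cube (k, m)" using cube_nonempty by blast
  then have "x \<in> space M" using sets.sets_into_space[OF sets_cube] by blast
  then obtain m' where m': "x \<in> cube (k - 1, m')" using cover[of x "k - 1"] by (auto simp: cube_def)
  have sub: "cube (k, m) \<subseteq> cube (k - 1, m')" using x m' by (intro cube_nested) auto
  have "(k - 1, m') \<notin> level_cubes N g j"
    using maximal_cubesD[OF max, of "(k - 1, m')"] x m' by auto
  then have *: "ennreal (2 powr (d * (real_of_int k - 1))) * cube_integral N g (k - 1, m')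
      \<le> threshold j"
    by (simp add: level_cubes_def not_less)
  have "ennreal (2 powr (d * k)) * cube_integral N g (k, m)
      \<le> ennreal (2 powr d) * (ennreal (2 powr (d * (real_of_int k - 1))) * cube_integral N g (k - 1, m'))"
  proof -
    have "ennreal (2 powr (d * k)) = ennreal (2 powr d) * ennreal (2 powr (d * (real_of_int k - 1)))"
      by (simp add: ennreal_mult'[symmetric] powr_add[symmetric] algebra_simps)
    then show ?thesis
      using sub unfolding mult.assoc[symmetric]
      by (intro mult_mono nn_integral_mono) (auto simp: indicator_def)
  qed
  also have "\<dots> \<le> ennreal (2 powr d) * threshold j"
    by (intro mult_left_mono *) auto
  also have "\<dots> = ennreal (2 powr (d + (d + 1) * j))"
    by (simp add: ennreal_mult'[symmetric] powr_add)
  finally show ?thesis by (simp add: jkm)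
qed

lemma emeasure_principal_part:
  assumes l: "l \<in> principal_cubes N g" and N: "sets N = sets M" and g[measurable]: "g \<in> borel_measurable N"
  shows "emeasure M (cube (snd l)) \<le> 2 * emeasure M (principal_part N g l)"
proof -
  have [measurable]: "cube i \<in> sets N" for i by (simp add: N)
  obtain j i where ji: "l = (j, i)" by (cases l)
  have max: "i \<in> maximal_cubes (level_cubes N g j)"
    using l by (simp add: principal_cubes_def ji)
  let ?G = "\<lambda>i. cube_integral N g i"
  define S where "S = {i'\<in>level_cubes N g (j + 1). cube i' \<subseteq> cube i}"
  define U where "U = (\<Union>i'\<in>S. cube i')"
  have [measurable]: "U \<in> sets M" by (auto simp: U_def)
  have U: "cube i \<inter> (\<Union>i'\<in>level_cubes N g (j + 1). cube i') = U"
  proof -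
    have "i' \<in> S" if "i' \<in> level_cubes N g (j + 1)" "cube i \<inter> cube i' \<noteq> {}" for i'
      using maximal_cubesD[OF max _ that(2)] level_cubes_Suc[of j "j + 1"] that(1) by (auto simp: S_def)
    then show ?thesis unfolding U_def by (auto simp: S_def)
  qed
  have "threshold (j + 1) * emeasure M U \<le> cube_integral N g i"
    unfolding U_def
  proof (rule weak_type[OF refl N])
    fix i' assume i': "i' \<in> S"
    have "threshold (j + 1) * emeasure M (cube i')
       \<le> scale d i' * ?G i' * emeasure M (cube i')"
      using i' by (intro mult_right_mono) (auto simp: S_def level_cubes_def)
    also have "\<dots> = ?G i' * (scale d i' * scale (- d) i')"
      by (simp add: emeasure_cube ac_simps)
    also have "\<dots> = ?G i'" by (simp add: ennreal_mult'[symmetric] powr_add[symmetric])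
    \<comment> \<open>Restricting \<open>g\<close> to the cube \<open>i\<close> costs nothing on its
      subcubes, and makes the weak type bound end with the integral over \<open>i\<close> instead of
      the total one.\<close>
    also have "\<dots> \<le> (\<integral>\<^sup>+x. g x * indicator (cube i) x * indicator (cube i') x \<partial>N)"
      using i' by (intro nn_integral_mono) (auto simp: S_def indicator_def)
    finally show "threshold (j + 1) * emeasure M (cube i') \<le> \<dots>" .
  qed measurable
  then have "scale d i * (threshold (j + 1) * emeasure M U)
     \<le> ennreal (2 powr (d + (d + 1) * j))"
    using principal_average_le[OF l N g] by (simp add: ji) (rule order_trans[OF mult_left_mono], auto)
  moreover have "emeasure M (cube i) = emeasure M (principal_part N g l) + emeasure M U"
  proof -
    have "principal_part N g l = cube i - U" using U by (auto simp: principal_part_def ji)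
    moreover have "U \<subseteq> cube i" by (auto simp: U_def S_def)
    ultimately have "cube i = principal_part N g l \<union> U" "principal_part N g l \<inter> U = {}" by auto
    then show ?thesis using \<open>principal_part N g l = cube i - U\<close>
      by (subst plus_emeasure) auto
  qed
  moreover obtain u v where "emeasure M U = ennreal u" "emeasure M (principal_part N g l) = ennreal v" "0 \<le> u" "0 \<le> v"
  proof -
    have "emeasure M U + emeasure M (principal_part N g l) < top"
      using calculation(2) emeasure_cube[of i] by (metis add.commute ennreal_less_top)
    then have "emeasure M U < top" "emeasure M (principal_part N g l) < top" by auto
    then show ?thesis
      using that by (metis ennreal_enn2real enn2real_nonneg)
  qed
  ultimately have u: "2 powr (d * level i) * (2 powr ((d + 1) * (j + 1)) * u) \<le> 2 powr (d + (d + 1) * j)"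
    and v: "2 powr (- d * level i) = v + u"
    by (simp_all add: emeasure_cube ennreal_mult'[symmetric] ennreal_plus[symmetric] del: ennreal_plus)
  have "(d + 1) * (j + 1) = (d + (d + 1) * j) + 1" by (simp add: algebra_simps)
  then have "2 powr ((d + 1) * (j + 1)) = 2 powr (d + (d + 1) * j) * (2 powr 1 :: real)"
    by (simp only: powr_add)
  then have "2 powr (d * level i) * (2 powr ((d + 1) * (j + 1)) * u) = 2 powr (d + (d + 1) * j) * (2 * 2 powr (d * level i) * u)"
    by simp
  with u have "2 powr (d + (d + 1) * j) * (2 * 2 powr (d * level i) * u) \<le> 2 powr (d + (d + 1) * j) * 1"
    by (simp only: mult_1_right)
  then have "2 * 2 powr (d * level i) * u \<le> 1"
    by (rule mult_left_le_imp_le) simp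
  then have "2 * u \<le> 2 powr (- d * level i)" by (simp add: powr_minus field_simps)
  then have "v + u \<le> 2 * v" using v by simp
  then show ?thesis
    using v \<open>0 \<le> v\<close> \<open>emeasure M (principal_part N g l) = ennreal v\<close>
    by (simp add: ji emeasure_cube ennreal_mult''[symmetric] flip: ennreal_numeral)
qed

text \<open>A cube whose mean lies between thresholds j and j + 1 is charged to the maximal cube of
  threshold j that contains it. Once its mean is replaced by threshold j + 1, the sum over the
  charged cubes is geometric by 2^(-ck); at the principal cube the threshold is turned back into a
  mean, at the cost of 2^(d+1).\<close>

lemma dyadic_form_le_principal_form:
  fixes g h :: "'a \<Rightarrow> ennreal"
  assumes c: "0 < c" and N: "sets N1 = sets M" "sets N2 = sets M"
    and g[measurable]: "g \<in> borel_measurable N1" and h[measurable]: "h \<in> borel_measurable N2"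
    and fin: "(\<integral>\<^sup>+x. g x \<partial>N1) < top"
  shows "(\<integral>\<^sup>+i. scale (d - c) i * cube_integral N1 g i
             * cube_integral N2 h i \<partial>count_space UNIV)
    \<le> ennreal (2 powr (d + 1) / (1 - 2 powr (- c))) *
       (\<integral>\<^sup>+l. scale (d - c) (snd l) * cube_integral N1 g (snd l)
             * cube_integral N2 h (snd l) \<partial>count_space (principal_cubes N1 g))"
proof -
  let ?G = "\<lambda>i. cube_integral N1 g i"
  let ?H = "\<lambda>i. cube_integral N2 h i"
  let ?J = "principal_cubes N1 g"
  let ?t = "\<lambda>i l. threshold (fst l + 1) * (scale (- c) i * ?H i
     * indicator {i. fst (snd l) \<le> fst i \<and> cube i \<subseteq> cube (snd l)} i)"
  have "scale (d - c) i * ?G i * ?H i \<le> (\<integral>\<^sup>+l. ?t i l \<partial>count_space ?J)" for i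
  proof (cases "?G i = 0")
    case False
    have "?G i \<le> (\<integral>\<^sup>+x. g x \<partial>N1)" by (intro nn_integral_mono) (auto simp: indicator_def)
    then have "?G i < top" using fin by auto
    then obtain r where r: "?G i = ennreal r" "0 < r"
      using False by (cases "?G i") (auto simp: less_le)
    obtain j where j: "(2 powr (d + 1)) powr real_of_int j < 2 powr (d * level i) * r"
        "2 powr (d * level i) * r \<le> (2 powr (d + 1)) powr (j + 1)"
      using powr_between[of "2 powr (d + 1)" "2 powr (d * level i) * r"] r d_pos
      by (auto simp: gr_one_powr)
    have "i \<in> level_cubes N1 g j"
      using j r by (simp add: level_cubes_def powr_powr ennreal_mult''[symmetric] ennreal_less_iff)
    moreover obtain b where "\<And>i. i \<in> level_cubes N1 g j \<Longrightarrow> b \<le> fst i"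
      using level_cubes_bounded_below[OF fin] by blast
    ultimately obtain i' where i': "i' \<in> maximal_cubes (level_cubes N1 g j)" "fst i' \<le> fst i" "cube i \<subseteq> cube i'"
      using maximal_cubes_cover by metis
    have "scale (d - c) i * ?G i * ?H i
       = ennreal (2 powr (d * level i) * r) * (scale (- c) i * ?H i)"
      using r by (simp add: ennreal_mult''[symmetric] mult.assoc[symmetric])
        (simp add: powr_diff powr_minus left_diff_distrib field_simps)
    also have "\<dots> \<le> ?t i (j, i')"
      using j i' by (auto simp: powr_powr intro!: mult_right_mono ennreal_leI)
    also have "\<dots> \<le> (\<integral>\<^sup>+l. ?t i l \<partial>count_space ?J)"
      using i' by (intro nn_integral_count_space_ge_term) (auto simp: principal_cubes_def)
    finally show ?thesis .
  qed simp
  then have "(\<integral>\<^sup>+i. scale (d - c) i * ?G i * ?H i \<partial>count_space UNIV)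
     \<le> (\<integral>\<^sup>+i. (\<integral>\<^sup>+l. ?t i l \<partial>count_space ?J) \<partial>count_space UNIV)"
    by (intro nn_integral_mono)
  also have "\<dots> = (\<integral>\<^sup>+l. (\<integral>\<^sup>+i. ?t i l \<partial>count_space UNIV) \<partial>count_space ?J)"
    by (intro nn_integral_count_space_nn_integral) auto
  also have "\<dots> = (\<integral>\<^sup>+l. threshold (fst l + 1) *
      (\<integral>\<^sup>+i. scale (- c) i * ?H i
     * indicator {i. fst (snd l) \<le> fst i \<and> cube i \<subseteq> cube (snd l)} i \<partial>count_space UNIV) \<partial>count_space ?J)"
    by (simp add: nn_integral_cmult)
  also have "\<dots> \<le> (\<integral>\<^sup>+l. ennreal (2 powr (d + 1) / (1 - 2 powr (- c))) *
      (scale (d - c) (snd l) * ?G (snd l) * ?H (snd l)) \<partial>count_space ?J)"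
  proof (rule nn_integral_mono)
    fix l assume "l \<in> space (count_space ?J)"
    then have "snd l \<in> level_cubes N1 g (fst l)"
      by (auto simp: principal_cubes_def maximal_cubes_def)
    then have *: "threshold (fst l) \<le> scale d (snd l) * ?G (snd l)"
      by (simp add: level_cubes_def)
    have pos: "0 < 1 - 2 powr (- c)" using c powr_less_mono[of "- c" 0 2] by simp
    have "threshold (fst l + 1) *
      (\<integral>\<^sup>+i. scale (- c) i * ?H i * indicator {i. fst (snd l) \<le> fst i \<and> cube i \<subseteq> cube (snd l)} i \<partial>count_space UNIV)
      \<le> threshold (fst l + 1) * (ennreal (2 powr (- c * level (snd l)) / (1 - 2 powr (- c))) * ?H (snd l))"
      by (intro mult_left_mono sum_subcubes_le c N h) auto
    also have "\<dots> = ennreal (2 powr (d + 1)) * threshold (fst l) * (ennreal (2 powr (- c * level (snd l)) / (1 - 2 powr (- c))) * ?H (snd l))"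
      by (simp add: ennreal_mult'[symmetric] powr_add[symmetric] algebra_simps)
    also have "\<dots>
        \<le> ennreal (2 powr (d + 1)) * (scale d (snd l) * ?G (snd l)) * (ennreal (2 powr (- c * level (snd l)) / (1 - 2 powr (- c))) * ?H (snd l))"
      by (intro mult_right_mono mult_left_mono *) auto
    also have "\<dots> = (ennreal (2 powr (d + 1)) * scale d (snd l) * ennreal (2 powr (- c * level (snd l)) / (1 - 2 powr (- c))))
        * (?G (snd l) * ?H (snd l))"
      by (simp only: ac_simps)
    also have "ennreal (2 powr (d + 1)) * scale d (snd l) * ennreal (2 powr (- c * level (snd l)) / (1 - 2 powr (- c)))
       = ennreal (2 powr (d + 1) / (1 - 2 powr (- c))) * scale (d - c) (snd l)"
    proof -
      have "2 powr ((d - c) * level (snd l)) = 2 powr (d * level (snd l)) * 2 powr (- c * level (snd l))"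
        by (simp add: powr_add[symmetric] algebra_simps)
      then show ?thesis
        using pos by (simp add: ennreal_mult''[symmetric])
    qed
    also have "\<dots> * (?G (snd l) * ?H (snd l)) = ennreal (2 powr (d + 1) / (1 - 2 powr (- c))) *
      (scale (d - c) (snd l) * ?G (snd l) * ?H (snd l))"
      by (simp only: ac_simps)
    finally show "threshold (fst l + 1) *
      (\<integral>\<^sup>+i. scale (- c) i * ?H i * indicator {i. fst (snd l) \<le> fst i \<and> cube i \<subseteq> cube (snd l)} i \<partial>count_space UNIV)
      \<le> \<dots>" .
  qed
  finally show ?thesis by (simp add: nn_integral_cmult)
qed

text \<open>Here \<open>1/p + 1/r \<ge> 1\<close>. After Hoelder's inequality with exponents \<open>p\<close> and \<open>p'\<close>, the excess is absorbed by
  the embedding of the sequence space \<open>l^r\<close> into \<open>l^p'\<close>.\<close>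

theorem dyadic_form_bound:
  fixes g h :: "'a \<Rightarrow> ennreal"
  assumes c: "0 < c" and N: "sets N1 = sets M" "sets N2 = sets M"
    and g[measurable]: "g \<in> borel_measurable N1" and h[measurable]: "h \<in> borel_measurable N2"
    and fin: "(\<integral>\<^sup>+x. g x \<partial>N1) < top"
    and p: "1 < p" "1 < p'" "1/p + 1/p' = 1" and r: "1 < r" "r \<le> p'"
    and N1: "\<And>i. emeasure N1 (cube i) \<noteq> 0" "\<And>i. emeasure N1 (cube i) \<noteq> top"
    and N2: "\<And>i. emeasure N2 (cube i) \<noteq> 0" "\<And>i. emeasure N2 (cube i) \<noteq> top"
    and testing: "\<And>i. scale (d - c) i * emeasure N1 (cube i) * emeasure N2 (cube i)
        \<le> K * (emeasure N1 (cube i) epowr (1/p) * emeasure N2 (cube i) epowr (1/r))"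
    and A1: "\<And>i E. E \<in> sets M \<Longrightarrow> E \<subseteq> cube i \<Longrightarrow> emeasure M (cube i) \<le> 2 * emeasure M E \<Longrightarrow>
        emeasure N1 (cube i) \<le> C * emeasure N1 E"
    and A2: "\<And>i E. E \<in> sets M \<Longrightarrow> E \<subseteq> cube i \<Longrightarrow> emeasure M (cube i) \<le> 2 * emeasure M E \<Longrightarrow>
        emeasure N2 (cube i) \<le> C * emeasure N2 E"
  shows "(\<integral>\<^sup>+i. scale (d - c) i * cube_integral N1 g i
             * cube_integral N2 h i \<partial>count_space UNIV)
    \<le> ennreal (2 powr (d + 1) / (1 - 2 powr (- c))) * K *
       (C * maximal_const p) epowr (1/p) *
       (C * maximal_const r) epowr (1/r) *
       (pnorm p N1 g * pnorm r N2 h)"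
proof -
  let ?G = "\<lambda>i. cube_integral N1 g i"
  let ?H = "\<lambda>i. cube_integral N2 h i"
  let ?J = "principal_cubes N1 g"
  let ?X = "\<lambda>l. emeasure N1 (cube (snd l)) epowr (1/p) * average N1 g (snd l)"
  let ?Y = "\<lambda>l. emeasure N2 (cube (snd l)) epowr (1/r) * average N2 h (snd l)"
  have G: "?G i = emeasure N1 (cube i) * average N1 g i" for i
    using N1[of i] by (simp add: average_def ennreal_times_divide mult_divide_eq_ennreal mult.commute[of "emeasure N1 (cube i)"])
  have H: "?H i = emeasure N2 (cube i) * average N2 h i" for i
    using N2[of i] by (simp add: average_def ennreal_times_divide mult_divide_eq_ennreal mult.commute[of "emeasure N2 (cube i)"])
  have E: "principal_part N1 g l \<in> sets M" "principal_part N1 g l \<subseteq> cube (snd l)" for l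
    unfolding principal_part_def by auto
  have X: "(\<integral>\<^sup>+l. ?X l epowr p \<partial>count_space ?J) \<le> C * (maximal_const p * (\<integral>\<^sup>+x. g x epowr p \<partial>N1))"
  proof -
    have eq: "?X l epowr p = emeasure N1 (cube (snd l)) * average N1 g (snd l) epowr p" for l
      using p by (simp add: epowr_mult epowr_epowr)
    show ?thesis unfolding eq
      by (rule Carleson_embedding[OF p(1) N(1) g N1 _ E(1) E(2) disjoint_principal_part A1[OF E emeasure_principal_part[OF _ N(1) g]]]) auto
  qed
  have Y: "(\<integral>\<^sup>+l. ?Y l epowr p' \<partial>count_space ?J) \<le> (C * (maximal_const r * (\<integral>\<^sup>+x. h x epowr r \<partial>N2))) epowr (p'/r)"
  proof -
    have eq: "?Y l epowr p' = (emeasure N2 (cube (snd l)) * average N2 h (snd l) epowr r) epowr (p'/r)" for l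
      using p r by (simp add: epowr_mult epowr_epowr)
    have "(\<integral>\<^sup>+l. ?Y l epowr p' \<partial>count_space ?J)
       \<le> (\<integral>\<^sup>+l. emeasure N2 (cube (snd l)) * average N2 h (snd l) epowr r \<partial>count_space ?J) epowr (p'/r)"
      unfolding eq using r by (intro epowr_superadd_count_space) simp
    also have "\<dots> \<le> (C * (maximal_const r * (\<integral>\<^sup>+x. h x epowr r \<partial>N2))) epowr (p'/r)"
      using r p by (intro epowr_mono Carleson_embedding[OF r(1) N(2) h N2 _ E(1) E(2) disjoint_principal_part A2[OF E emeasure_principal_part[OF _ N(1) g]]]) auto
    finally show ?thesis .
  qed
  have "(\<integral>\<^sup>+i. scale (d - c) i * ?G i * ?H i \<partial>count_space UNIV)
    \<le> ennreal (2 powr (d + 1) / (1 - 2 powr (- c))) *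
       (\<integral>\<^sup>+l. scale (d - c) (snd l) * ?G (snd l) * ?H (snd l) \<partial>count_space ?J)"
    by (rule dyadic_form_le_principal_form[OF c N g h fin])
  also have "\<dots> \<le> ennreal (2 powr (d + 1) / (1 - 2 powr (- c))) * (\<integral>\<^sup>+l. K * (?X l * ?Y l) \<partial>count_space ?J)"
  proof (intro mult_left_mono nn_integral_mono)
    fix l :: "int \<times> int \<times> 'i"
    let ?i = "snd l"
    have "scale (d - c) ?i * ?G ?i * ?H ?i
      = (scale (d - c) ?i * emeasure N1 (cube ?i) * emeasure N2 (cube ?i)) * (average N1 g ?i * average N2 h ?i)"
      unfolding G H by (simp only: ac_simps)
    also have "\<dots> \<le> (K * (emeasure N1 (cube ?i) epowr (1/p) * emeasure N2 (cube ?i) epowr (1/r))) * (average N1 g ?i * average N2 h ?i)"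
      by (intro mult_right_mono testing) auto
    finally show "scale (d - c) ?i * ?G ?i * ?H ?i \<le> K * (?X l * ?Y l)"
      by (simp only: ac_simps)
  qed auto
  also have "(\<integral>\<^sup>+l. K * (?X l * ?Y l) \<partial>count_space ?J) = K * (\<integral>\<^sup>+l. ?X l * ?Y l \<partial>count_space ?J)"
    by (simp add: nn_integral_cmult)
  also have "(\<integral>\<^sup>+l. ?X l * ?Y l \<partial>count_space ?J) \<le> (\<integral>\<^sup>+l. ?X l epowr p \<partial>count_space ?J) epowr (1/p) * (\<integral>\<^sup>+l. ?Y l epowr p' \<partial>count_space ?J) epowr (1/p')"
    by (intro Hoelder_nn_integral p) auto
  also have "\<dots> \<le> (C * (maximal_const p * (\<integral>\<^sup>+x. g x epowr p \<partial>N1))) epowr (1/p) *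
      ((C * (maximal_const r * (\<integral>\<^sup>+x. h x epowr r \<partial>N2))) epowr (p'/r)) epowr (1/p')"
    using p by (intro mult_mono epowr_mono X Y) auto
  also have "\<dots> = ((C * maximal_const p) * (\<integral>\<^sup>+x. g x epowr p \<partial>N1)) epowr (1/p) *
      ((C * maximal_const r) * (\<integral>\<^sup>+x. h x epowr r \<partial>N2)) epowr (1/r)"
    using p r by (simp add: epowr_epowr mult.assoc)
  also have "\<dots> = (C * maximal_const p) epowr (1/p) *
       (C * maximal_const r) epowr (1/r) *
       (pnorm p N1 g * pnorm r N2 h)"
    using p r by (simp add: epowr_mult mult.assoc mult.commute mult.left_commute)
  finally show ?thesis by (simp add: mult.assoc mult_left_mono)
qed

end

section \<open>Shifted dyadic cubes\<close>

abbreviation vol :: "'a :: euclidean_space set \<Rightarrow> ennreal" where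
  "vol \<equiv> emeasure lebesgue"

abbreviation wvol :: "(real ^ 'n \<Rightarrow> real) \<Rightarrow> (real ^ 'n) set \<Rightarrow> ennreal" where
  "wvol w \<equiv> emeasure (wmeasure w)"

text \<open>The sign of the shift alternates with the level: \<open>2 * (1/3) - (- 1/3)\<close> is an integer, so that the
  shifted grids of consecutive levels are nested.\<close>

definition grid_shift :: "bool ^ 'n \<Rightarrow> int \<Rightarrow> 'n \<Rightarrow> real" where
  "grid_shift t k i = (if t $ i then (if even k then 1/3 else - 1/3) else 0)"

definition grid_label :: "bool ^ 'n \<Rightarrow> int \<Rightarrow> real ^ 'n \<Rightarrow> 'n \<Rightarrow> int" where
  "grid_label t k x i = \<lfloor>2 powr k * x $ i + grid_shift t k i\<rfloor>"

definition grid_cube :: "bool ^ 'n \<Rightarrow> int \<Rightarrow> int ^ 'n \<Rightarrow> (real ^ 'n) set" where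
  "grid_cube t k m = {x. \<forall>i. grid_label t k x i = m $ i}"

text \<open>The label at level k is determined by the one at level k + 1, which gives nestedness. It
  combines floor y = floor (2 y) div 2 with the fact that twice the shift of level k minus the shift
  of level k + 1 is 1, -1 or 0.\<close>

lemma grid_label_parent:
  "grid_label t k x i = (grid_label t (k + 1) x i + (if t $ i then (if even k then 1 else - 1) else 0)) div 2"
proof -
  have half: "\<lfloor>y\<rfloor> = \<lfloor>2 * y\<rfloor> div 2" for y :: real
    by linarith
  have "2 * (2 powr k * x $ i + grid_shift t k i)
     = (2 powr (k + 1) * x $ i + grid_shift t (k + 1) i) + of_int (if t $ i then (if even k then 1 else - 1) else 0)"
    by (simp add: grid_shift_def powr_add)
  then show ?thesis
    unfolding grid_label_def half[of "2 powr k * x $ i + grid_shift t k i"] by (simp only: floor_add_int)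
qed

lemma grid_label_coarser:
  assumes "k' \<le> k" "\<And>i. grid_label t k x i = grid_label t k y i"
  shows "grid_label t k' x i = grid_label t k' y i"
  using assms(1)
proof (induction k' arbitrary: i rule: int_le_induct)
  case base
  then show ?case using assms(2) .
next
  case (step j)
  then show ?case using grid_label_parent[of t "j - 1" x i] grid_label_parent[of t "j - 1" y i] by simp
qed

lemma grid_cube_iff:
  "x \<in> grid_cube t k m \<longleftrightarrow>
    (\<forall>i. (m $ i - grid_shift t k i) / 2 powr k \<le> x $ i \<and> x $ i < (m $ i + 1 - grid_shift t k i) / 2 powr k)"
proof -
  have "\<lfloor>2 powr k * x $ i + grid_shift t k i\<rfloor> = m $ i \<longleftrightarrow>
     (m $ i - grid_shift t k i) / 2 powr k \<le> x $ i \<and> x $ i < (m $ i + 1 - grid_shift t k i) / 2 powr k" for i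
    by (simp add: floor_eq_iff field_simps)
  then show ?thesis by (simp add: grid_cube_def grid_label_def)
qed

lemma grid_cube_borel [measurable]: "grid_cube t k m \<in> sets borel"
proof -
  have "grid_cube t k m = (\<Inter>i. {x. (m $ i - grid_shift t k i) / 2 powr k \<le> x $ i} \<inter>
      {x. x $ i < (m $ i + 1 - grid_shift t k i) / 2 powr k})"
    by (auto simp: grid_cube_iff)
  moreover have "closed {x :: real ^ 'n. a \<le> x $ i}" "open {x :: real ^ 'n. x $ i < a}" for a i
    by (auto intro!: closed_Collect_le open_Collect_less continuous_intros)
  ultimately show ?thesis
    by (auto intro!: sets.countable_INT'' sets.Int borel_closed borel_open)
qed

lemma emeasure_grid_cube:
  fixes t :: "bool ^ 'n"
  shows "vol (grid_cube t k m) = ennreal (2 powr (- real CARD('n) * k))"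
proof -
  define a :: "real ^ 'n" where "a = (\<chi> i. (m $ i - grid_shift t k i) / 2 powr k)"
  define b :: "real ^ 'n" where "b = (\<chi> i. (m $ i + 1 - grid_shift t k i) / 2 powr k)"
  have sub: "box a b \<subseteq> grid_cube t k m" "grid_cube t k m \<subseteq> cbox a b"
    by (auto simp: grid_cube_iff mem_box_cart a_def b_def less_imp_le)
  have diff: "b - a = (\<chi> i. 2 powr (- real_of_int k))"
    by (auto simp: a_def b_def vec_eq_iff diff_divide_distrib[symmetric] powr_minus_divide)
  have prod: "(\<Prod>v\<in>Basis. (b - a) \<bullet> v) = 2 powr (- real CARD('n) * k)"
  proof -
    have "(b - a) \<bullet> v = 2 powr (- real_of_int k)" if "v \<in> Basis" for v
      using that unfolding diff by (auto simp: Basis_vec_def inner_axis)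
    then have "(\<Prod>v\<in>Basis. (b - a) \<bullet> v) = (2 powr (- real_of_int k)) ^ CARD('n)"
      by simp
    also have "\<dots> = 2 powr (- real CARD('n) * k)"
      by (simp add: powr_realpow[symmetric] powr_powr mult.commute)
    finally show ?thesis .
  qed
  have le: "a \<bullet> v \<le> b \<bullet> v" if "v \<in> Basis" for v
  proof -
    have "(b - a) \<bullet> v = 2 powr (- real_of_int k)"
      using that unfolding diff by (auto simp: Basis_vec_def inner_axis)
    moreover have "(0::real) < 2 powr (- real_of_int k)" by simp
    ultimately show ?thesis by (simp add: inner_diff_left del: powr_gt_zero)
  qed
  have "emeasure lborel (grid_cube t k m) = ennreal (2 powr (- real CARD('n) * k))"
  proof (rule antisym)
    show "emeasure lborel (grid_cube t k m) \<le> ennreal (2 powr (- real CARD('n) * k))"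
      using emeasure_mono[OF sub(2), of lborel] le prod
      by (simp add: emeasure_lborel_cbox_eq)
    show "ennreal (2 powr (- real CARD('n) * k)) \<le> emeasure lborel (grid_cube t k m)"
      using emeasure_mono[OF sub(1), of lborel] le prod
      by (simp add: emeasure_lborel_box_eq)
  qed
  then show ?thesis by simp
qed

interpretation grid: dyadic_grid "grid_cube t" lebesgue "real CARD('n)" for t :: "bool ^ 'n"
proof
  show "0 < real CARD('n)" by simp
  show "grid_cube t k m \<in> sets lebesgue" for k m by simp
  show "grid_cube t k m \<inter> grid_cube t k m' = {}" if "m \<noteq> m'" for k m m'
    using that by (auto simp: grid_cube_def vec_eq_iff)
  show "\<exists>m. x \<in> grid_cube t k m" for x k
    by (rule exI[of _ "\<chi> i. grid_label t k x i"]) (simp add: grid_cube_def)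
  show "grid_cube t k m \<subseteq> grid_cube t k' m'" if k: "k' \<le> k" and ne: "grid_cube t k m \<inter> grid_cube t k' m' \<noteq> {}" for k k' m m'
  proof
    fix x assume x: "x \<in> grid_cube t k m"
    obtain y where y: "y \<in> grid_cube t k m" "y \<in> grid_cube t k' m'" using ne by blast
    have "grid_label t k' x i = grid_label t k' y i" for i
      using x y k by (intro grid_label_coarser[of k' k]) (auto simp: grid_cube_def)
    then show "x \<in> grid_cube t k' m'" using y by (simp add: grid_cube_def)
  qed
  show "vol (grid_cube t k m) = ennreal (2 powr (- real CARD('n) * real_of_int k))" for k m
    by (rule emeasure_grid_cube)
qed

text \<open>The Euclidean norm is bounded crudely by the sum of the coordinates; the factor 2 makes
  the inequality strict, as the ball is open.\<close>

lemma cube_subset_ball: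
  fixes t :: "bool ^ 'n"
  assumes x: "x \<in> grid.cube t i"
  shows "grid.cube t i \<subseteq> ball x (2 * real CARD('n) * 2 powr (- real_of_int (fst i)))"
proof
  fix y assume y: "y \<in> grid.cube t i"
  let ?k = "fst i" and ?m = "snd i"
  have xy: "x \<in> grid_cube t ?k ?m" "y \<in> grid_cube t ?k ?m" using x y by (auto simp: grid.cube_def)
  have "\<bar>(x - y) $ j\<bar> \<le> 2 powr (- real_of_int ?k)" for j
  proof -
    have "(?m $ j + 1 - grid_shift t ?k j) / 2 powr ?k - (?m $ j - grid_shift t ?k j) / 2 powr ?k = 2 powr (- real_of_int ?k)"
      by (simp add: diff_divide_distrib[symmetric] powr_minus_divide)
    then show ?thesis
      using xy[unfolded grid_cube_iff, rule_format, of j] by (simp add: abs_le_iff)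
  qed
  then have "norm (x - y) \<le> real CARD('n) * 2 powr (- real_of_int ?k)"
    using norm_le_l1_cart[of "x - y"] sum_bounded_above[of UNIV "\<lambda>j. \<bar>(x - y) $ j\<bar>" "2 powr (- real_of_int ?k)"]
    by simp
  also have "\<dots> < 2 * real CARD('n) * 2 powr (- real_of_int ?k)" by simp
  finally show "y \<in> ball x (2 * real CARD('n) * 2 powr (- real_of_int (fst i)))" by (simp add: dist_norm)
qed

text \<open>The one-third trick: two points at distance below \<open>1/3\<close> that are separated by an integer
  are not separated by any point of \<open>\<int> \<plusminus> 1/3\<close>.\<close>

lemma floor_shift_third:
  fixes a b :: real
  assumes ab: "\<bar>a - b\<bar> < 1/3" and ne: "\<lfloor>a\<rfloor> \<noteq> \<lfloor>b\<rfloor>" and s: "s = 1/3 \<or> s = - 1/3"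
  shows "\<lfloor>a + s\<rfloor> = \<lfloor>b + s\<rfloor>"
proof -
  have *: "\<lfloor>a + s\<rfloor> = \<lfloor>b + s\<rfloor>" if "\<bar>a - b\<bar> < 1/3" "\<lfloor>a\<rfloor> < \<lfloor>b\<rfloor>" for a b
  proof -
    have "a < \<lfloor>b\<rfloor>" using that(2) by linarith
    moreover have "\<lfloor>b\<rfloor> \<le> b" by simp
    ultimately have r: "\<lfloor>b\<rfloor> - 1/3 < a" "a < \<lfloor>b\<rfloor>" "\<lfloor>b\<rfloor> \<le> b" "b < \<lfloor>b\<rfloor> + 1/3"
      using that(1) by linarith+
    show ?thesis
      using s
    proof
      assume "s = 1/3"
      then have "\<lfloor>a + s\<rfloor> = \<lfloor>b\<rfloor>" "\<lfloor>b + s\<rfloor> = \<lfloor>b\<rfloor>" using r by linarith+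
      then show ?thesis by simp
    next
      assume "s = - 1/3"
      then have "\<lfloor>a + s\<rfloor> = \<lfloor>b\<rfloor> - 1" "\<lfloor>b + s\<rfloor> = \<lfloor>b\<rfloor> - 1" using r by linarith+
      then show ?thesis by simp
    qed
  qed
  show ?thesis
  proof (cases "\<lfloor>a\<rfloor> < \<lfloor>b\<rfloor>")
    case True
    then show ?thesis using *[of a b] ab by simp
  next
    case False
    then show ?thesis using *[of b a] ab ne by (simp add: abs_minus_commute)
  qed
qed

lemma exists_common_cube:
  fixes x y :: "real ^ 'n"
  assumes "2 powr k * norm (x - y) < 1/3"
  obtains t m where "x \<in> grid_cube t k m" "y \<in> grid_cube t k m"
proof -
  \<comment> \<open>Shift exactly those coordinates in which the unshifted grid separates x and y.
    The choice depends on the pair, hence the 2^n grids.\<close>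
  define t :: "bool ^ 'n" where "t = (\<chi> i. \<lfloor>2 powr k * x $ i\<rfloor> \<noteq> \<lfloor>2 powr k * y $ i\<rfloor>)"
  have "grid_label t k y i = grid_label t k x i" for i
  proof (cases "\<lfloor>2 powr k * x $ i\<rfloor> = \<lfloor>2 powr k * y $ i\<rfloor>")
    case True
    then show ?thesis by (simp add: grid_label_def grid_shift_def t_def)
  next
    case False
    have "\<bar>2 powr k * x $ i - 2 powr k * y $ i\<bar> = 2 powr k * \<bar>(x - y) $ i\<bar>"
      by (simp add: right_diff_distrib[symmetric] abs_mult)
    also have "\<dots> \<le> 2 powr k * norm (x - y)"
      by (intro mult_left_mono component_le_norm_cart) auto
    finally have "\<bar>2 powr k * x $ i - 2 powr k * y $ i\<bar> < 1/3" using assms by linarith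
    then have "\<lfloor>2 powr k * x $ i + grid_shift t k i\<rfloor> = \<lfloor>2 powr k * y $ i + grid_shift t k i\<rfloor>"
      by (rule floor_shift_third) (use False in \<open>auto simp: grid_shift_def t_def\<close>)
    then show ?thesis by (simp add: grid_label_def)
  qed
  then show ?thesis
    by (intro that[of t "\<chi> i. grid_label t k x i"]) (auto simp: grid_cube_def)
qed

text \<open>Some grid has a cube that contains x and y and has side length comparable to
  \<open>norm (x - y)\<close>; its single term dominates. The level has 2^k < 1 / (3
  \<open>norm (x - y)\<close>) \<le> 2^(k+1), so that 6 is 3 times the ratio of the scales. At x = y
  the left side is \<open>0 powr (- e)\<close>, which is 0.\<close>

lemma kernel_le_dyadic:
  fixes x y :: "real ^ 'n"
  assumes e: "0 < e"
  shows "ennreal (norm (x - y) powr (- e)) \<le> ennreal (6 powr e) *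
    (\<Sum>t\<in>UNIV. \<integral>\<^sup>+i. ennreal (2 powr (e * real_of_int (fst i))) * indicator (grid.cube t i) x * indicator (grid.cube t i) y \<partial>count_space UNIV)"
    (is "_ \<le> _ * (\<Sum>t\<in>UNIV. ?S t)")
proof (cases "x = y")
  case False
  then have pos: "0 < norm (x - y)" by simp
  obtain k where k: "2 powr real_of_int k < 1 / (3 * norm (x - y))" "1 / (3 * norm (x - y)) \<le> 2 powr (real_of_int k + 1)"
    using powr_between[of 2 "1 / (3 * norm (x - y))"] pos by auto
  have "2 powr real_of_int k * norm (x - y) < 1/3" using k(1) pos by (simp add: field_simps)
  then obtain t m where tm: "x \<in> grid_cube t k m" "y \<in> grid_cube t k m" by (rule exists_common_cube)
  have "1 / norm (x - y) \<le> 6 * 2 powr real_of_int k"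
    using k(2) pos by (simp add: powr_add field_simps)
  then have "(1 / norm (x - y)) powr e \<le> (6 * 2 powr real_of_int k) powr e"
    using e by (intro powr_mono2) auto
  then have "norm (x - y) powr (- e) \<le> 6 powr e * 2 powr (e * k)"
    using pos by (simp add: powr_divide powr_minus_divide powr_mult powr_powr mult.commute)
  then have "ennreal (norm (x - y) powr (- e)) \<le> ennreal (6 powr e) * ennreal (2 powr (e * k))"
    by (simp add: ennreal_mult'[symmetric] ennreal_leI)
  also have "ennreal (2 powr (e * k)) \<le> ?S t"
    using nn_integral_count_space_ge_term[of "(k, m)" UNIV "\<lambda>i. ennreal (2 powr (e * real_of_int (fst i))) * indicator (grid.cube t i) x * indicator (grid.cube t i) y"] tm
    by (simp add: grid.cube_def)
  also have "?S t \<le> (\<Sum>t\<in>UNIV. ?S t)" by (rule member_le_sum) auto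
  finally show ?thesis by (simp add: mult_left_mono)
qed simp

section \<open>The potential and its dyadic majorant\<close>

lemma borel_measurable_nn_integral_count_space:
  fixes f :: "'i \<Rightarrow> 'a \<Rightarrow> ennreal"
  assumes I: "countable I" and f: "\<And>i. i \<in> I \<Longrightarrow> f i \<in> borel_measurable M"
  shows "(\<lambda>x. \<integral>\<^sup>+i. f i x \<partial>count_space I) \<in> borel_measurable M"
proof -
  interpret sigma_finite_measure "count_space I"
    using I by (rule sigma_finite_measure_count_space_countable)
  have "(\<lambda>(i, x). f i x) \<in> borel_measurable (count_space I \<Otimes>\<^sub>M M)"
    using I f by (intro measurable_pair_measure_countable1) auto
  then have "(\<lambda>(x, i). f i x) \<in> borel_measurable (M \<Otimes>\<^sub>M count_space I)"
    by (subst measurable_pair_swap_iff) (simp add: case_prod_unfold)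
  then show ?thesis by (rule borel_measurable_nn_integral)
qed

text \<open>The fractional integral of a non-negative function without the factor
  1/\<zeta>(\<gamma>), the value \<infinity> being allowed. By the convention for
  \<open>powr\<close> the kernel is 0 at y = x, a single point and hence a null set.\<close>

definition potential :: "real \<Rightarrow> (real ^ 'n \<Rightarrow> ennreal) \<Rightarrow> real ^ 'n \<Rightarrow> ennreal" where
  "potential \<gamma> F x = (\<integral>\<^sup>+y. F y * ennreal (norm (x - y) powr (\<gamma> - real CARD('n))) \<partial>lebesgue)"

lemma potential_le_dyadic:
  fixes x :: "real ^ 'n"
  assumes \<gamma>: "\<gamma> < real CARD('n)" and F[measurable]: "F \<in> borel_measurable lebesgue"
  defines "e \<equiv> real CARD('n) - \<gamma>"
  shows "potential \<gamma> F x \<le> ennreal (6 powr e) *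
    (\<Sum>t\<in>UNIV. \<integral>\<^sup>+i. ennreal (2 powr (e * real_of_int (fst i))) *
        (\<integral>\<^sup>+y. F y * indicator (grid.cube t i) y \<partial>lebesgue) * indicator (grid.cube t i) x \<partial>count_space UNIV)"
proof -
  let ?c = "\<lambda>i. ennreal (2 powr (e * real_of_int (fst i)))"
  have e: "0 < e" using \<gamma> by (simp add: e_def)
  have "potential \<gamma> F x = (\<integral>\<^sup>+y. F y * ennreal (norm (x - y) powr (- e)) \<partial>lebesgue)"
    by (simp add: potential_def e_def)
  also have "\<dots> \<le> (\<integral>\<^sup>+y. F y * (ennreal (6 powr e) *
    (\<Sum>t\<in>UNIV. \<integral>\<^sup>+i. ?c i * indicator (grid.cube t i) x * indicator (grid.cube t i) y \<partial>count_space UNIV)) \<partial>lebesgue)"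
    by (intro nn_integral_mono mult_left_mono kernel_le_dyadic e) auto
  also have "\<dots> = (\<integral>\<^sup>+y. ennreal (6 powr e) *
    (\<Sum>t\<in>UNIV. \<integral>\<^sup>+i. ?c i * indicator (grid.cube t i) x * (F y * indicator (grid.cube t i) y) \<partial>count_space UNIV) \<partial>lebesgue)"
    by (simp add: nn_integral_cmult[symmetric] sum_distrib_left ac_simps)
  also have "\<dots> = ennreal (6 powr e) *
    (\<Sum>t\<in>UNIV. \<integral>\<^sup>+y. \<integral>\<^sup>+i. ?c i * indicator (grid.cube t i) x * (F y * indicator (grid.cube t i) y) \<partial>count_space UNIV \<partial>lebesgue)"
    by (subst nn_integral_cmult) (auto intro!: borel_measurable_sum borel_measurable_nn_integral_count_space simp: nn_integral_sum borel_measurable_nn_integral_count_space)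
  also have "\<dots> = ennreal (6 powr e) *
    (\<Sum>t\<in>UNIV. \<integral>\<^sup>+i. \<integral>\<^sup>+y. ?c i * indicator (grid.cube t i) x * (F y * indicator (grid.cube t i) y) \<partial>lebesgue \<partial>count_space UNIV)"
    by (subst nn_integral_count_space_nn_integral) auto
  also have "\<dots> = ennreal (6 powr e) *
    (\<Sum>t\<in>UNIV. \<integral>\<^sup>+i. ?c i * (\<integral>\<^sup>+y. F y * indicator (grid.cube t i) y \<partial>lebesgue) * indicator (grid.cube t i) x \<partial>count_space UNIV)"
  proof -
    have "(\<integral>\<^sup>+y. ?c i * indicator (grid.cube t i) x * (F y * indicator (grid.cube t i) y) \<partial>lebesgue)
      = ?c i * (\<integral>\<^sup>+y. F y * indicator (grid.cube t i) y \<partial>lebesgue) * indicator (grid.cube t i) x" for t i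
      by (subst nn_integral_cmult) (auto simp: ac_simps)
    then show ?thesis by simp
  qed
  finally show ?thesis .
qed

section \<open>The weighted inequality for the potential\<close>

text \<open>The converse of Hoelder's inequality: h = min(D, n)^(q-1) on A n satisfies both h^r = f
  n and f n \<le> D h, so the hypothesis bounds the integral of f n by C times its own power
  1/r.\<close>

lemma nn_integral_epowr_le_by_duality:
  fixes D :: "'a \<Rightarrow> ennreal"
  assumes qr: "1 < q" "1 < r" "1/q + 1/r = 1"
    and D[measurable]: "D \<in> borel_measurable N"
    and A: "range A \<subseteq> sets N" "incseq A" "(\<Union>n. A n) = space N" "\<And>n. emeasure N (A n) < top"
    and dual: "\<And>h. h \<in> borel_measurable N \<Longrightarrow>
      (\<integral>\<^sup>+x. D x * h x \<partial>N) \<le> C * pnorm r N h"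
  shows "pnorm q N D \<le> C"
proof -
  have [measurable]: "A n \<in> sets N" for n using A(1) by auto
  \<comment> \<open>the truncations have finite norm, which can therefore be cancelled\<close>
  define f where "f n x = min (D x) (of_nat n) epowr q * indicator (A n) x" for n x
  have [measurable]: "f n \<in> borel_measurable N" for n unfolding f_def by measurable
  have q1: "(q - 1) * r = q" using qr by (auto simp: field_simps)
  have bound: "(\<integral>\<^sup>+x. f n x \<partial>N) \<le> C epowr q" for n
  proof -
    define h where "h x = min (D x) (of_nat n) epowr (q - 1) * indicator (A n) x" for x
    have [measurable]: "h \<in> borel_measurable N" unfolding h_def by measurable
    let ?I = "\<integral>\<^sup>+x. f n x \<partial>N"
    have hr: "h x epowr r = f n x" for x
      using qr q1 by (cases "x \<in> A n") (auto simp: h_def f_def epowr_epowr)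
    have "f n x \<le> D x * h x" for x
    proof -
      have "min (D x) (of_nat n) epowr q = min (D x) (of_nat n) * min (D x) (of_nat n) epowr (q - 1)"
        using epowr_add[of 1 "q - 1"] qr by simp
      also have "\<dots> \<le> D x * min (D x) (of_nat n) epowr (q - 1)" by (intro mult_right_mono) auto
      finally show ?thesis by (auto simp: f_def h_def indicator_def)
    qed
    then have "?I \<le> (\<integral>\<^sup>+x. D x * h x \<partial>N)" by (intro nn_integral_mono)
    also have "\<dots> \<le> C * ?I epowr (1/r)" using dual[of h] by (simp add: hr)
    finally have I: "?I \<le> C * ?I epowr (1/r)" .
    have "?I \<le> (\<integral>\<^sup>+x. of_nat n epowr q * indicator (A n) x \<partial>N)"
      unfolding f_def using qr by (intro nn_integral_mono mult_right_mono epowr_mono) auto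
    also have "\<dots> < top"
      using A(4)[of n] qr by (subst nn_integral_cmult_indicator) (auto simp: ennreal_mult_less_top of_nat_less_top)
    finally have fin: "?I < top" .
    show ?thesis
    proof (cases "?I = 0")
      case False
      have "?I = ?I epowr (1/q) * ?I epowr (1/r)"
        using epowr_add[of "1/q" "1/r" ?I] qr by simp
      then have "?I epowr (1/r) * ?I epowr (1/q) \<le> ?I epowr (1/r) * C"
        using I by (simp add: mult.commute)
      then have "?I epowr (1/q) \<le> C"
        using False fin qr by (subst (asm) ennreal_mult_le_mult_iff) (auto simp: less_top)
      then have "(?I epowr (1/q)) epowr q \<le> C epowr q" using qr by (intro epowr_mono) auto
      then show ?thesis using qr by (simp add: epowr_epowr)
    qed simp
  qed
  \<comment> \<open>Approximation from strictly below also covers the points where \<open>D\<close>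
    is infinite.\<close>
  have "D x epowr q \<le> (SUP n. f n x)" if x: "x \<in> space N" for x
  proof (rule dense_le)
    fix z assume z: "z < D x epowr q"
    obtain n0 where n0: "x \<in> A n0" using x A(3) by blast
    have "(z epowr (1/q)) epowr q < D x epowr q" using z qr by (simp add: epowr_epowr)
    then have z': "z epowr (1/q) < D x" using qr by (simp add: epowr_less_cancel)
    then have "z epowr (1/q) < top" using top.extremum_strict by (auto simp: less_top[symmetric])
    then obtain n1 where n1: "z epowr (1/q) < of_nat n1" using ennreal_Ex_less_of_nat by blast
    define n where "n = max n0 n1"
    have "z epowr (1/q) < of_nat n" using n1 unfolding n_def by (rule less_le_trans) (simp add: of_nat_mono)
    then have "z epowr (1/q) \<le> min (D x) (of_nat n)" using z' by (simp add: less_imp_le)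
    then have "(z epowr (1/q)) epowr q \<le> min (D x) (of_nat n) epowr q" using qr by (intro epowr_mono) auto
    moreover have "x \<in> A n" using n0 A(2) by (auto simp: n_def dest!: incseqD[of A n0 "max n0 n1"])
    ultimately have "z \<le> f n x" using qr by (simp add: f_def epowr_epowr)
    then show "z \<le> (SUP n. f n x)" by (rule SUP_upper2[OF UNIV_I])
  qed
  then have "(\<integral>\<^sup>+x. D x epowr q \<partial>N) \<le> (\<integral>\<^sup>+x. (SUP n. f n x) \<partial>N)"
    by (intro nn_integral_mono)
  also have "\<dots> = (SUP n. \<integral>\<^sup>+x. f n x \<partial>N)"
  proof (rule nn_integral_monotone_convergence_SUP)
    show "incseq f"
      unfolding incseq_def le_fun_def f_def using A(2) qr
      by (auto intro!: mult_mono epowr_mono min.mono simp: indicator_def incseq_def of_nat_mono)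
  qed measurable
  also have "\<dots> \<le> C epowr q" by (intro SUP_least bound)
  finally have "pnorm q N D \<le> (C epowr q) epowr (1/q)"
    using qr by (intro epowr_mono) auto
  then show ?thesis using qr by (simp add: epowr_epowr)
qed

section \<open>Pairs of weights linked by the A-condition\<close>

text \<open>\<open>s\<close> and \<open>u\<close> stand for w^(-p') and w^q, but all that is
  recorded of this is \<open>reciprocal\<close>, finiteness on balls and the A-condition. The latter
  has its averages multiplied out, which produces the power \<theta> = 1/p' + 1/q of the
  volume.\<close>

locale Apq_pair =
  fixes s u :: "real ^ 'n \<Rightarrow> real" and p p' q \<gamma> \<theta> K :: real
  assumes s[measurable]: "s \<in> borel_measurable lebesgue" and u[measurable]: "u \<in> borel_measurable lebesgue"
    and \<gamma>: "0 < \<gamma>" "\<gamma> < real CARD('n)"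
    and p: "1 < p" "1 < p'" "1/p + 1/p' = 1"
    and q: "0 < q" "1/q = 1/p - \<gamma> / real CARD('n)"
    and \<theta>_def: "\<theta> = 1 - \<gamma> / real CARD('n)"
    and K: "0 < K"
    and reciprocal: "AE x in lebesgue. ennreal (s x) epowr (1/p') * ennreal (u x) epowr (1/q) = 1"
    and ball_finite: "\<And>y r. wvol s (ball y r) < top" "\<And>y r. wvol u (ball y r) < top"
    and Apq: "\<And>y r. 0 < r \<Longrightarrow> wvol s (ball y r) epowr (1/p') * wvol u (ball y r) epowr (1/q)
        \<le> ennreal K * vol (ball y r) epowr \<theta>"
begin

lemma theta: "0 < \<theta>" "\<theta> < 1" "1/p' + 1/q = \<theta>"
proof -
  show "0 < \<theta>" "\<theta> < 1" using \<gamma> by (simp_all add: \<theta>_def)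
  show "1/p' + 1/q = \<theta>" using p(3) q(2) by (simp add: \<theta>_def)
qed

lemma p_less_q: "p < q"
proof -
  have "1/q < 1/p" using q \<gamma> by simp
  then show ?thesis using p q(1) by (simp add: field_simps)
qed

text \<open>Hoelder's inequality is used twice: first against the indicator of E with exponents
  1/\<theta> and 1/(1-\<theta>), since 1/p' + 1/q = \<theta> < 1, then between the two weights with
  exponents 1/a and 1/b, a + b = 1. Finally the power 1-\<theta> of the volume of E is
  cancelled.\<close>

lemma measure_le_product:
  assumes E[measurable]: "E \<in> sets lebesgue" and fin: "vol E < top"
  shows "vol E epowr \<theta>
    \<le> wvol s E epowr (1/p') * wvol u E epowr (1/q)"
proof (cases "vol E = 0")
  case False
  let ?m = "vol E"
  let ?s = "\<lambda>x. ennreal (s x) * indicator E x" and ?u = "\<lambda>x. ennreal (u x) * indicator E x"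
  have S: "wvol s E = (\<integral>\<^sup>+x. ?s x \<partial>lebesgue)" by (subst emeasure_density) auto
  have U: "wvol u E = (\<integral>\<^sup>+x. ?u x \<partial>lebesgue)" by (subst emeasure_density) auto
  have pos: "0 < 1/p'" "0 < 1/q" using p(2) q(1) by simp_all
  define a where "a = 1/p' / \<theta>"
  define b where "b = 1/q / \<theta>"
  have "a + b = (1/p' + 1/q) / \<theta>" unfolding a_def b_def by (simp add: add_divide_distrib)
  also have "\<dots> = 1" using theta by (simp only: theta(3)) (use theta in simp)
  finally have ab: "0 < a" "0 < b" "a + b = 1" using pos theta by (auto simp: a_def b_def)
  have ab1: "1 < 1/a" "1 < 1/b" using ab by (auto simp: field_simps)
  have "?m = (\<integral>\<^sup>+x. indicator E x \<partial>lebesgue)" by simp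
  also have "\<dots> = (\<integral>\<^sup>+x. (?s x epowr (1/p') * ?u x epowr (1/q)) * indicator E x \<partial>lebesgue)"
    using reciprocal by (intro nn_integral_cong_AE) (auto elim!: eventually_mono simp: indicator_def)
  also have "\<dots> \<le> (\<integral>\<^sup>+x. (?s x epowr (1/p') * ?u x epowr (1/q)) epowr (1/\<theta>) \<partial>lebesgue) epowr (1 / (1/\<theta>))
      * (\<integral>\<^sup>+x. indicator E x epowr (1 / (1 - \<theta>)) \<partial>lebesgue) epowr (1 / (1 / (1 - \<theta>)))"
    using theta by (intro Hoelder_nn_integral) (auto simp: field_simps)
  also have "(\<integral>\<^sup>+x. (?s x epowr (1/p') * ?u x epowr (1/q)) epowr (1/\<theta>) \<partial>lebesgue)
      = (\<integral>\<^sup>+x. ?s x epowr a * ?u x epowr b \<partial>lebesgue)"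
    using pos theta by (simp add: epowr_mult epowr_epowr a_def b_def)
  also have "(\<integral>\<^sup>+x. indicator E x epowr (1 / (1 - \<theta>)) \<partial>lebesgue) = (\<integral>\<^sup>+x. indicator E x \<partial>lebesgue)"
    using theta by (intro nn_integral_cong) (auto simp: indicator_def)
  also have "(\<integral>\<^sup>+x. indicator E x \<partial>lebesgue) = ?m" by simp
  also have "(\<integral>\<^sup>+x. ?s x epowr a * ?u x epowr b \<partial>lebesgue) \<le>
      (\<integral>\<^sup>+x. (?s x epowr a) epowr (1/a) \<partial>lebesgue) epowr (1/(1/a)) * (\<integral>\<^sup>+x. (?u x epowr b) epowr (1/b) \<partial>lebesgue) epowr (1/(1/b))"
    using ab ab1 by (intro Hoelder_nn_integral) auto
  also have "\<dots> = wvol s E epowr a * wvol u E epowr b"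
    using ab by (simp add: epowr_epowr S U)
  finally have "?m \<le> (wvol s E epowr a * wvol u E epowr b) epowr \<theta> * ?m epowr (1 - \<theta>)"
    using theta by (simp add: mult_right_mono epowr_mono)
  also have "(wvol s E epowr a * wvol u E epowr b) epowr \<theta>
     = wvol s E epowr (1/p') * wvol u E epowr (1/q)"
    using ab theta by (simp add: epowr_mult epowr_epowr) (simp add: a_def b_def)
  finally have "?m epowr (1 - \<theta>) * ?m epowr \<theta> \<le> ?m epowr (1 - \<theta>) * (wvol s E epowr (1/p') * wvol u E epowr (1/q))"
    using epowr_add[of "1 - \<theta>" \<theta> ?m] theta by (simp add: mult.commute)
  then show ?thesis
    using False fin theta by (subst (asm) ennreal_mult_le_mult_iff) auto
qed (use theta in auto)

lemma emeasure_nonzero: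
  assumes "E \<in> sets lebesgue" "vol E \<noteq> 0" "vol E < top"
  shows "wvol s E \<noteq> 0" "wvol u E \<noteq> 0"
proof -
  have "0 < vol E epowr \<theta>" using assms(2) theta(1) by (simp only: zero_less_iff_neq_zero epowr_eq_0_iff) simp
  then have "0 < wvol s E epowr (1/p') * wvol u E epowr (1/q)"
    using measure_le_product[OF assms(1,3)] by (rule less_le_trans)
  then show "wvol s E \<noteq> 0" "wvol u E \<noteq> 0"
    using p(2) q(1) by (auto simp: ennreal_zero_less_mult_iff)
qed

text \<open>The A-condition on the ball, followed by \<open>measure_le_product\<close> on E,
  compares the two products. In each case one factor on E is enlarged to the ball and cancelled,
  which leaves the bound for the other.\<close>

lemma comparable_ball:
  assumes r: "0 < r" and E[measurable]: "E \<in> sets lebesgue" and sub: "E \<subseteq> ball y r"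
    and c: "0 < c" "vol (ball y r) \<le> ennreal c * vol E"
  shows "wvol s (ball y r) \<le> ennreal ((K * c powr \<theta>) powr p') * wvol s E"
    and "wvol u (ball y r) \<le> ennreal ((K * c powr \<theta>) powr q) * wvol u E"
proof -
  let ?S = "wvol s" and ?U = "wvol u" and ?B = "ball y r"
  let ?c = "ennreal (K * c powr \<theta>)"
  have finB: "vol ?B < top" using emeasure_bounded_finite[OF bounded_ball] by auto
  have "0 < unit_ball_vol (real CARD('n))" by simp
  with r have posB: "vol ?B \<noteq> 0" by (simp add: emeasure_ball del: unit_ball_vol_pos)
  have finE: "vol E < top"
    using finB emeasure_mono[OF sub, of lebesgue] by (auto intro: le_less_trans)
  have "?S ?B epowr (1/p') * ?U ?B epowr (1/q) \<le> ennreal K * vol ?B epowr \<theta>"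
    by (rule Apq[OF r])
  also have "\<dots> \<le> ennreal K * (ennreal c * vol E) epowr \<theta>"
    using theta c by (intro mult_left_mono epowr_mono) auto
  also have "\<dots> = ?c * vol E epowr \<theta>"
    using theta c K by (simp add: epowr_mult epowr_ennreal ennreal_mult' mult.assoc)
  also have "\<dots> \<le> ?c * (?S E epowr (1/p') * ?U E epowr (1/q))"
    by (intro mult_left_mono measure_le_product E finE) auto
  finally have main: "?S ?B epowr (1/p') * ?U ?B epowr (1/q) \<le> ?c * (?S E epowr (1/p') * ?U E epowr (1/q))" .
  have EB: "?S E \<le> ?S ?B" "?U E \<le> ?U ?B" using sub by (auto intro!: emeasure_mono)
  have nz: "?S ?B \<noteq> 0" "?U ?B \<noteq> 0" by (rule emeasure_nonzero[OF _ posB finB], simp)+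
  have "?U ?B epowr (1/q) * ?S ?B epowr (1/p') \<le> ?c * (?S E epowr (1/p') * ?U ?B epowr (1/q))"
    unfolding mult.commute[of "?U ?B epowr (1/q)"]
    using EB(2) q(1) by (intro order_trans[OF main] mult_left_mono epowr_mono) auto
  then have "?U ?B epowr (1/q) * ?S ?B epowr (1/p') \<le> ?U ?B epowr (1/q) * (?c * ?S E epowr (1/p'))"
    by (simp only: ac_simps)
  then have "?S ?B epowr (1/p') \<le> ?c * ?S E epowr (1/p')"
    using nz ball_finite(2)[of y r] q(1) by (subst (asm) ennreal_mult_le_mult_iff) auto
  then have "(?S ?B epowr (1/p')) epowr p' \<le> (?c * ?S E epowr (1/p')) epowr p'"
    using p(2) by (intro epowr_mono) auto
  then show "?S ?B \<le> ennreal ((K * c powr \<theta>) powr p') * ?S E"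
    using p(2) K c by (simp add: epowr_epowr epowr_mult epowr_ennreal)
  have "?S ?B epowr (1/p') * ?U ?B epowr (1/q) \<le> ?c * (?S ?B epowr (1/p') * ?U E epowr (1/q))"
    using EB(1) p(2) by (intro order_trans[OF main] mult_left_mono mult_right_mono epowr_mono) auto
  then have "?S ?B epowr (1/p') * ?U ?B epowr (1/q) \<le> ?S ?B epowr (1/p') * (?c * ?U E epowr (1/q))"
    by (simp only: ac_simps)
  then have "?U ?B epowr (1/q) \<le> ?c * ?U E epowr (1/q)"
    using nz ball_finite(1)[of y r] p(2) by (subst (asm) ennreal_mult_le_mult_iff) auto
  then have "(?U ?B epowr (1/q)) epowr q \<le> (?c * ?U E epowr (1/q)) epowr q"
    using q(1) by (intro epowr_mono) auto
  then show "?U ?B \<le> ennreal ((K * c powr \<theta>) powr q) * ?U E"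
    using q(1) K c by (simp add: epowr_epowr epowr_mult epowr_ennreal)
qed

lemma cube_in_ball:
  fixes t :: "bool ^ 'n"
  obtains y r where "0 < r" "grid.cube t i \<subseteq> ball y r"
    "vol (ball y r) = ennreal (unit_ball_vol (real CARD('n)) * (2 * real CARD('n)) ^ CARD('n)) * vol (grid.cube t i)"
proof -
  obtain y where y: "y \<in> grid.cube t i" using grid.cube_nonempty by blast
  let ?r = "2 * real CARD('n) * 2 powr (- real_of_int (fst i))"
  have "vol (ball y ?r) = ennreal (unit_ball_vol (real CARD('n)) * ?r ^ CARD('n))"
    by (simp add: emeasure_ball)
  also have "?r ^ CARD('n) = (2 * real CARD('n)) ^ CARD('n) * 2 powr (- real CARD('n) * fst i)"
    by (simp add: power_mult_distrib powr_realpow[symmetric] powr_powr mult.commute)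
  also have "ennreal (unit_ball_vol (real CARD('n)) * \<dots>) =
     ennreal (unit_ball_vol (real CARD('n)) * (2 * real CARD('n)) ^ CARD('n)) * vol (grid.cube t i)"
    by (simp add: grid.emeasure_cube ennreal_mult'[symmetric] mult.assoc)
  finally show ?thesis using that[of ?r y] cube_subset_ball[OF y] by simp
qed

text \<open>Writing the function as \<open>s\<close> times g makes both sides norms with respect to
  the fixed measures, and pairing with h turns the dyadic majorant into bilinear forms covered by
  \<open>grid.dyadic_form_bound\<close>.\<close>

lemma potential_bound:
  obtains C where "0 < C" "\<And>g. g \<in> borel_measurable lebesgue \<Longrightarrow> (\<integral>\<^sup>+x. g x \<partial>wmeasure s) < top \<Longrightarrow>
    pnorm q (wmeasure u) (potential \<gamma> (\<lambda>y. ennreal (s y) * g y))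
      \<le> ennreal C * pnorm p (wmeasure s) g"
proof -
  let ?n = "real CARD('n)" and ?S = "wmeasure s" and ?U = "wmeasure u"
  define v where "v = unit_ball_vol ?n * (2 * ?n) ^ CARD('n)"
  have v: "0 < v" by (simp add: v_def)
  \<comment> \<open>The exponent dual to q; p < q gives r \<le> p', as the bound for dyadic forms
    requires.\<close>
  define r where "r = q / (q - 1)"
  have q1: "1 < q" using p p_less_q by simp
  have r: "1 < r" "1/q + 1/r = 1" using q1 by (auto simp: r_def field_simps)
  have "1/p' \<le> 1/r"
  proof -
    have "1/q \<le> 1/p" using p p_less_q by (simp add: field_simps)
    then show ?thesis using p(3) r(2) by linarith
  qed
  then have rp: "r \<le> p'" using p r by (simp add: field_simps)
  have N: "sets ?S = sets lebesgue" "sets ?U = sets lebesgue" by simp_all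
  \<comment> \<open>A ball around a cube has v times its volume, and a set filling half of the cube
    costs another factor 2.\<close>
  define c where "c = 2 * v"
  have c: "0 < c" using v by (simp add: c_def)
  define C0 where "C0 = max ((K * c powr \<theta>) powr p') ((K * c powr \<theta>) powr q)"
  have finQ: "vol (grid.cube t i) < top" "vol (grid.cube t i) \<noteq> 0" for t i
    by (simp_all add: grid.emeasure_cube)
  have S: "emeasure ?S (grid.cube t i) \<noteq> 0" "emeasure ?S (grid.cube t i) \<noteq> top"
    and U: "emeasure ?U (grid.cube t i) \<noteq> 0" "emeasure ?U (grid.cube t i) \<noteq> top" for t i
  proof -
    obtain y \<rho> where "grid.cube t i \<subseteq> ball y \<rho>" by (rule cube_in_ball)
    then have "emeasure ?S (grid.cube t i) \<le> emeasure ?S (ball y \<rho>)" "emeasure ?U (grid.cube t i) \<le> emeasure ?U (ball y \<rho>)"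
      by (auto intro!: emeasure_mono)
    then show "emeasure ?S (grid.cube t i) \<noteq> top" "emeasure ?U (grid.cube t i) \<noteq> top"
      using ball_finite[of y \<rho>] by (auto simp: top_unique)
    show "emeasure ?S (grid.cube t i) \<noteq> 0" "emeasure ?U (grid.cube t i) \<noteq> 0"
      by (rule emeasure_nonzero[OF _ finQ(2) finQ(1)], simp)+
  qed
  have A: "emeasure ?S (grid.cube t i) \<le> ennreal C0 * emeasure ?S E" "emeasure ?U (grid.cube t i) \<le> ennreal C0 * emeasure ?U E"
    if E: "E \<in> sets lebesgue" "E \<subseteq> grid.cube t i" "vol (grid.cube t i) \<le> 2 * vol E" for t i E
  proof -
    obtain y \<rho> where \<rho>: "0 < \<rho>" "grid.cube t i \<subseteq> ball y \<rho>" "vol (ball y \<rho>) = ennreal v * vol (grid.cube t i)"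
      unfolding v_def by (rule cube_in_ball)
    have "vol (ball y \<rho>) \<le> ennreal v * (2 * vol E)"
      unfolding \<rho>(3) by (intro mult_left_mono E) auto
    also have "\<dots> = ennreal c * vol E"
    proof -
      have "ennreal c = ennreal v * 2" using v by (simp add: c_def ennreal_mult'' mult.commute[of _ "2::ennreal"])
      then show ?thesis by (simp only: mult.assoc)
    qed
    finally have le: "vol (ball y \<rho>) \<le> ennreal c * vol E" .
    have "emeasure ?S (grid.cube t i) \<le> emeasure ?S (ball y \<rho>)" using \<rho> by (intro emeasure_mono) auto
    also have "\<dots> \<le> ennreal ((K * c powr \<theta>) powr p') * emeasure ?S E"
      using E \<rho> c le by (intro comparable_ball(1)) auto
    also have "\<dots> \<le> ennreal C0 * emeasure ?S E"
      by (intro mult_right_mono ennreal_leI) (auto simp: C0_def)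
    finally show "emeasure ?S (grid.cube t i) \<le> ennreal C0 * emeasure ?S E" .
    have "emeasure ?U (grid.cube t i) \<le> emeasure ?U (ball y \<rho>)" using \<rho> by (intro emeasure_mono) auto
    also have "\<dots> \<le> ennreal ((K * c powr \<theta>) powr q) * emeasure ?U E"
      using E \<rho> c le by (intro comparable_ball(2)) auto
    also have "\<dots> \<le> ennreal C0 * emeasure ?U E"
      by (intro mult_right_mono ennreal_leI) (auto simp: C0_def)
    finally show "emeasure ?U (grid.cube t i) \<le> ennreal C0 * emeasure ?U E" .
  qed
  \<comment> \<open>The factor 2^((n-\<gamma>)k) is the reciprocal of the power \<theta> of the
    volume of the cube, because n \<theta> = n - \<gamma>; the A-condition on a surrounding ball
    does the rest.\<close>
  have testing: "ennreal (2 powr ((?n - \<gamma>) * real_of_int (fst i))) * emeasure ?S (grid.cube t i) * emeasure ?U (grid.cube t i)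
      \<le> ennreal (K * v powr \<theta>) * (emeasure ?S (grid.cube t i) epowr (1/p) * emeasure ?U (grid.cube t i) epowr (1/r))" for t i
  proof -
    let ?Q = "grid.cube t i"
    obtain y \<rho> where \<rho>: "0 < \<rho>" "?Q \<subseteq> ball y \<rho>" "vol (ball y \<rho>) = ennreal v * vol ?Q"
      unfolding v_def by (rule cube_in_ball)
    have "emeasure ?S ?Q epowr (1/p') * emeasure ?U ?Q epowr (1/q) \<le> emeasure ?S (ball y \<rho>) epowr (1/p') * emeasure ?U (ball y \<rho>) epowr (1/q)"
      using \<rho> p(2) q(1) by (intro mult_mono epowr_mono emeasure_mono) auto
    also have "\<dots> \<le> ennreal K * (ennreal v * vol ?Q) epowr \<theta>"
      using Apq[OF \<rho>(1), of y] \<rho>(3) by simp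
    also have "\<dots> = ennreal (K * v powr \<theta> * 2 powr (- ?n * fst i * \<theta>))"
      using v theta K by (simp add: grid.emeasure_cube epowr_mult epowr_ennreal ennreal_mult'[symmetric] powr_powr powr_mult mult.assoc)
    finally have *: "emeasure ?S ?Q epowr (1/p') * emeasure ?U ?Q epowr (1/q) \<le> ennreal (K * v powr \<theta> * 2 powr (- ?n * fst i * \<theta>))" .
    have "ennreal (2 powr ((?n - \<gamma>) * real_of_int (fst i))) * (emeasure ?S ?Q epowr (1/p') * emeasure ?U ?Q epowr (1/q))
      \<le> ennreal (2 powr ((?n - \<gamma>) * real_of_int (fst i))) * ennreal (K * v powr \<theta> * 2 powr (- ?n * fst i * \<theta>))"
      by (intro mult_left_mono *) auto
    also have "\<dots> = ennreal (K * v powr \<theta>)"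
    proof -
      have "?n * \<theta> = ?n - \<gamma>" by (simp add: \<theta>_def field_simps)
      then have "- ?n * fst i * \<theta> = - ((?n - \<gamma>) * fst i)" by (simp add: mult.assoc mult.left_commute flip: \<open>?n * \<theta> = ?n - \<gamma>\<close>)
      then have "2 powr ((?n - \<gamma>) * fst i) * 2 powr (- ?n * fst i * \<theta>) = (1 :: real)"
        by (simp only: powr_add[symmetric]) simp
      then have "2 powr ((?n - \<gamma>) * fst i) * (K * v powr \<theta> * 2 powr (- ?n * fst i * \<theta>)) = K * v powr \<theta>"
        by (simp only: mult.left_commute[of "2 powr ((?n - \<gamma>) * fst i)"] mult_1_right)
      then show ?thesis by (simp only: ennreal_mult'[OF powr_ge_zero, symmetric])
    qed
    finally have **: "ennreal (2 powr ((?n - \<gamma>) * real_of_int (fst i))) * (emeasure ?S ?Q epowr (1/p') * emeasure ?U ?Q epowr (1/q)) \<le> ennreal (K * v powr \<theta>)" .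
    \<comment> \<open>Splitting 1 = 1/p' + 1/p and 1 = 1/q + 1/r separates the powers in the
      A-condition from those left for the Carleson embedding.\<close>
    have s: "emeasure ?S ?Q = emeasure ?S ?Q epowr (1/p') * emeasure ?S ?Q epowr (1/p)"
      using epowr_add[of "1/p'" "1/p"] p by (simp add: add.commute)
    have u: "emeasure ?U ?Q = emeasure ?U ?Q epowr (1/q) * emeasure ?U ?Q epowr (1/r)"
      using epowr_add[of "1/q" "1/r"] q(1) r by simp
    have "ennreal (2 powr ((?n - \<gamma>) * real_of_int (fst i))) * emeasure ?S ?Q * emeasure ?U ?Q
      = ennreal (2 powr ((?n - \<gamma>) * real_of_int (fst i))) * (emeasure ?S ?Q epowr (1/p') * emeasure ?U ?Q epowr (1/q)) * (emeasure ?S ?Q epowr (1/p) * emeasure ?U ?Q epowr (1/r))"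
      by (subst s, subst u) (simp only: ac_simps)
    also have "\<dots> \<le> ennreal (K * v powr \<theta>) * (emeasure ?S ?Q epowr (1/p) * emeasure ?U ?Q epowr (1/r))"
      by (intro mult_right_mono **) auto
    finally show ?thesis .
  qed
  define C1 where "C1 = ennreal (2 powr (?n + 1) / (1 - 2 powr (- \<gamma>))) * ennreal (K * v powr \<theta>) *
       (ennreal C0 * maximal_const p) epowr (1/p) *
       (ennreal C0 * maximal_const r) epowr (1/r)"
  define C2 where "C2 = ennreal (6 powr (?n - \<gamma>)) * (of_nat CARD(bool ^ 'n) * C1)"
  have "C2 < top"
    using p r by (auto simp: C1_def C2_def ennreal_mult_less_top power_less_top_ennreal)
  define C where "C = enn2real C2 + 1"
  have C: "0 < C" "C2 \<le> ennreal C" using \<open>C2 < top\<close>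
    by (auto simp: C_def ennreal_enn2real intro!: add_nonneg_pos)
  show ?thesis
  proof (rule that[OF C(1)])
    fix g :: "real ^ 'n \<Rightarrow> ennreal" assume g[measurable]: "g \<in> borel_measurable lebesgue" and fin: "(\<integral>\<^sup>+x. g x \<partial>?S) < top"
    let ?G = "pnorm p ?S g"
    let ?\<phi> = "\<lambda>t i. \<integral>\<^sup>+x. g x * indicator (grid.cube t i) x \<partial>?S"
    let ?c = "\<lambda>i::int \<times> (int ^ 'n). ennreal (2 powr ((?n - \<gamma>) * real_of_int (fst i)))"
    define T where "T t x = (\<integral>\<^sup>+i. ?c i * ?\<phi> t i * indicator (grid.cube t i) x \<partial>count_space UNIV)" for t x
    define D where "D x = ennreal (6 powr (?n - \<gamma>)) * (\<Sum>t\<in>UNIV. T t x)" for x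
    have [measurable]: "T t \<in> borel_measurable lebesgue" for t
      unfolding T_def by (intro borel_measurable_nn_integral_count_space) auto
    have [measurable]: "D \<in> borel_measurable lebesgue" unfolding D_def by measurable
    have JD: "potential \<gamma> (\<lambda>y. ennreal (s y) * g y) x \<le> D x" for x
    proof -
      have "(\<integral>\<^sup>+y. (ennreal (s y) * g y) * indicator (grid.cube t i) y \<partial>lebesgue) = ?\<phi> t i" for t i
        by (subst nn_integral_density) (auto simp: mult.assoc)
      then show ?thesis
        using potential_le_dyadic[of \<gamma> "\<lambda>y. ennreal (s y) * g y" x] \<gamma> by (simp add: D_def T_def)
    qed
    have dual: "(\<integral>\<^sup>+x. D x * h x \<partial>?U) \<le> (C2 * ?G) * pnorm r ?U h"
      if "h \<in> borel_measurable ?U" for h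
    proof -
      have [measurable]: "h \<in> borel_measurable lebesgue" using that by simp
      let ?H = "pnorm r ?U h"
      have one: "(\<integral>\<^sup>+x. T t x * h x \<partial>?U) \<le> C1 * (?G * ?H)" for t
      proof -
        have "(\<integral>\<^sup>+x. T t x * h x \<partial>?U)
          = (\<integral>\<^sup>+x. \<integral>\<^sup>+i. ?c i * ?\<phi> t i * (h x * indicator (grid.cube t i) x) \<partial>count_space UNIV \<partial>?U)"
          unfolding T_def by (subst nn_integral_multc[symmetric]) (auto simp: ac_simps)
        also have "\<dots> = (\<integral>\<^sup>+i. \<integral>\<^sup>+x. ?c i * ?\<phi> t i * (h x * indicator (grid.cube t i) x) \<partial>?U \<partial>count_space UNIV)"
          by (intro nn_integral_count_space_nn_integral) auto
        also have "\<dots> = (\<integral>\<^sup>+i. ?c i * ?\<phi> t i * (\<integral>\<^sup>+x. h x * indicator (grid.cube t i) x \<partial>?U) \<partial>count_space UNIV)"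
          by (subst nn_integral_cmult) auto
        \<comment> \<open>The decay parameter c of the dyadic bound is \<gamma> here, so that d - c
          is n - \<gamma>, the order of the kernel.\<close>
        also have "\<dots> \<le> C1 * (?G * ?H)"
          unfolding C1_def
          by (rule grid.dyadic_form_bound[OF \<gamma>(1) N _ that fin p r(1) rp S U testing A]) simp
        finally show ?thesis .
      qed
      have "(\<integral>\<^sup>+x. D x * h x \<partial>?U) = ennreal (6 powr (?n - \<gamma>)) *
        (\<Sum>t\<in>UNIV. \<integral>\<^sup>+x. T t x * h x \<partial>?U)"
        unfolding D_def mult.assoc sum_distrib_right
        by (subst nn_integral_cmult) (auto simp: nn_integral_sum)
      also have "\<dots> \<le> ennreal (6 powr (?n - \<gamma>)) * (\<Sum>t\<in>(UNIV :: (bool ^ 'n) set). C1 * (?G * ?H))"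
        by (intro mult_left_mono sum_mono one) auto
      also have "\<dots> = (C2 * ?G) * ?H" by (simp add: C2_def mult.assoc)
      finally show ?thesis .
    qed
    have "pnorm q ?U D \<le> C2 * ?G"
    proof (rule nn_integral_epowr_le_by_duality[OF q1 r _ _ _ _ _ dual])
      show "range (\<lambda>n. ball 0 (real n)) \<subseteq> sets ?U" by auto
      show "incseq (\<lambda>n. ball (0::real^'n) (real n))" by (auto simp: incseq_def)
      show "(\<Union>n. ball (0::real^'n) (real n)) = space ?U" using reals_Archimedean2 by auto
      show "emeasure ?U (ball 0 (real n)) < top" for n by (rule ball_finite)
    qed auto
    moreover have "pnorm q ?U (potential \<gamma> (\<lambda>y. ennreal (s y) * g y))
        \<le> pnorm q ?U D"
      using q1 by (intro epowr_mono nn_integral_mono JD) auto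
    moreover have "C2 * ?G \<le> ennreal C * ?G" using C(2) by (rule mult_right_mono) simp
    ultimately show "pnorm q ?U (potential \<gamma> (\<lambda>y. ennreal (s y) * g y))
      \<le> ennreal C * ?G"
      by (meson order_trans)
  qed
qed

end

section \<open>Amalgam norms\<close>

lemma sigma_finite_lebesgue: "sigma_finite_measure (lebesgue :: 'a :: euclidean_space measure)"
proof
  show "\<exists>A. countable A \<and> A \<subseteq> sets lebesgue \<and> \<Union>A = space lebesgue \<and> (\<forall>a\<in>A. vol (a :: 'a set) \<noteq> \<infinity>)"
  proof (intro exI conjI ballI)
    show "countable (range (\<lambda>n. ball (0::'a) (real n)))" by simp
    show "range (\<lambda>n. ball (0::'a) (real n)) \<subseteq> sets lebesgue" by auto
    show "(\<Union>n. ball (0::'a) (real n)) = space lebesgue" using reals_Archimedean2 by auto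
    fix a assume "a \<in> range (\<lambda>n. ball (0::'a) (real n))"
    then show "vol a \<noteq> \<infinity>" using emeasure_bounded_finite[of a] by auto
  qed
qed

abbreviation ball_integral :: "('a :: euclidean_space \<Rightarrow> ennreal) \<Rightarrow> 'a \<Rightarrow> real \<Rightarrow> ennreal" where
  "ball_integral F y r \<equiv> (\<integral>\<^sup>+x. F x * indicator (ball y r) x \<partial>lebesgue)"

lemma borel_measurable_snd_lebesgue: "snd \<in> borel \<Otimes>\<^sub>M lebesgue \<rightarrow>\<^sub>M borel"
proof -
  have "(\<lambda>x. x) \<in> lebesgue \<rightarrow>\<^sub>M borel" by (rule measurable_completion) simp
  then have "(\<lambda>x. x) \<circ> snd \<in> borel \<Otimes>\<^sub>M lebesgue \<rightarrow>\<^sub>M borel"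
    by (rule measurable_comp[OF measurable_snd])
  then show ?thesis by (simp add: comp_def)
qed

text \<open>The centre ranges over the Borel sets and x over the Lebesgue sets: \<open>h\<close> is
  only Lebesgue measurable, whereas y enters through the distance alone. In this way the product
  need not be completed.\<close>

lemma borel_measurable_nn_integral_ball:
  fixes h :: "'a :: euclidean_space \<Rightarrow> ennreal"
  assumes [measurable]: "h \<in> borel_measurable lebesgue"
  shows "(\<lambda>y. \<integral>\<^sup>+x. h x * indicator (ball y r) x \<partial>lebesgue) \<in> borel_measurable lebesgue"
proof -
  interpret sigma_finite_measure "lebesgue :: 'a measure" by (rule sigma_finite_lebesgue)
  have "(\<lambda>y. \<integral>\<^sup>+x. h x * (if dist y x < r then 1 else 0) \<partial>lebesgue) \<in> borel_measurable borel"
  proof (rule borel_measurable_nn_integral)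
    note [measurable] = borel_measurable_dist[OF measurable_fst borel_measurable_snd_lebesgue]
    have "(\<lambda>z. h (snd z) * (if dist (fst z) (snd z) < r then 1 else 0)) \<in> borel_measurable (borel \<Otimes>\<^sub>M lebesgue)"
      by measurable
    then show "(\<lambda>(y, x). h x * (if dist y x < r then 1 else 0)) \<in> borel_measurable (borel \<Otimes>\<^sub>M lebesgue)"
      by (simp add: case_prod_unfold)
  qed
  then have *: "(\<lambda>y. \<integral>\<^sup>+x. h x * (if dist y x < r then 1 else 0) \<partial>lebesgue) \<in> borel_measurable lebesgue"
    by (intro measurable_completion) simp
  have "(if dist y x < r then 1 else 0) = (indicator (ball y r) x :: ennreal)" for x y :: 'a
    by (simp add: indicator_def)
  then show ?thesis using * by (simp only:)
qed

text \<open>Minkowski's inequality for countably many functions with a common bound on their norms.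
  For finite s it comes from Jensen's inequality with weights \<open>a k\<close>, which is Hoelder's
  inequality for a = a^(1/t') a^(1/t); for s = \<infinity> the bounds hold simultaneously almost
  everywhere.\<close>

lemma Lnorm_le_weighted_sum:
  fixes \<Phi> :: "'a \<Rightarrow> ennreal" and \<Psi> :: "nat \<Rightarrow> 'a \<Rightarrow> ennreal" and a :: "nat \<Rightarrow> real"
  assumes s: "1 < s"
    and [measurable]: "\<Phi> \<in> borel_measurable M" "\<And>k. \<Psi> k \<in> borel_measurable M"
    and le: "\<And>y. \<Phi> y \<le> (\<Sum>k. ennreal (a k) * \<Psi> k y)"
    and a: "\<And>k. 0 \<le> a k" "a sums S" and A: "\<And>k. Lnorm s M (\<Psi> k) \<le> A"
  shows "Lnorm s M \<Phi> \<le> ennreal S * A"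
proof -
  have S: "(\<Sum>k. ennreal (a k)) = ennreal S"
    by (rule suminf_ennreal_eq[OF a])
  show ?thesis
  proof (cases "s = top")
    case True
    have "AE y in M. \<Psi> k y \<le> A" for k
    proof -
      have "AE y in M. \<Psi> k y \<le> esssup M (\<Psi> k)" by (rule esssup_AE)
      moreover have "esssup M (\<Psi> k) \<le> A" using A[of k] True by (simp add: Lnorm_def)
      ultimately show ?thesis by (auto elim!: eventually_mono intro: order_trans)
    qed
    then have "AE y in M. \<forall>k. \<Psi> k y \<le> A" by (simp add: AE_all_countable)
    then have "AE y in M. \<Phi> y \<le> ennreal S * A"
    proof eventually_elim
      case (elim y)
      have "\<Phi> y \<le> (\<Sum>k. ennreal (a k) * \<Psi> k y)" by (rule le)
      also have "\<dots> \<le> (\<Sum>k. ennreal (a k) * A)" using elim by (intro suminf_le mult_left_mono) auto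
      also have "\<dots> = ennreal S * A" by (simp add: S)
      finally show ?case .
    qed
    then show ?thesis using True by (simp add: Lnorm_def esssup_I)
  next
    case False
    define t where "t = enn2real s"
    have st: "s = ennreal t" using False by (simp add: t_def less_top)
    with s have t: "1 < t" by (metis ennreal_1 ennreal_less_iff zero_le_one)
    define t' where "t' = t / (t - 1)"
    have t': "1 < t'" "1/t' + 1/t = 1" using t by (auto simp: t'_def field_simps)
    have L: "Lnorm s M f = pnorm t M f" for f
      using False by (simp add: Lnorm_def t_def)
    have AP: "(\<integral>\<^sup>+x. \<Psi> k x epowr t \<partial>M) \<le> A epowr t" for k
    proof -
      have "((\<integral>\<^sup>+x. \<Psi> k x epowr t \<partial>M) epowr (1/t)) epowr t \<le> A epowr t"
        using A[of k] t unfolding L by (intro epowr_mono) auto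
      then show ?thesis using t by (simp add: epowr_epowr)
    qed
    have pt: "\<Phi> y epowr t \<le> ennreal S epowr (t/t') * (\<Sum>k. ennreal (a k) * \<Psi> k y epowr t)" for y
    proof -
      have "\<Phi> y \<le> (\<integral>\<^sup>+k. ennreal (a k) * \<Psi> k y \<partial>count_space UNIV)"
        using le[of y] by (simp add: nn_integral_count_space_nat)
      also have "\<dots> = (\<integral>\<^sup>+k. ennreal (a k) epowr (1/t') * (ennreal (a k) epowr (1/t) * \<Psi> k y) \<partial>count_space UNIV)"
      proof (rule nn_integral_cong)
        fix k
        have "ennreal (a k) = ennreal (a k) epowr (1/t') * ennreal (a k) epowr (1/t)"
          using epowr_add[of "1/t'" "1/t" "ennreal (a k)"] t t' by simp
        then show "ennreal (a k) * \<Psi> k y = ennreal (a k) epowr (1/t') * (ennreal (a k) epowr (1/t) * \<Psi> k y)"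
          by (metis mult.assoc)
      qed
      also have "\<dots> \<le> (\<integral>\<^sup>+k. (ennreal (a k) epowr (1/t')) epowr t' \<partial>count_space UNIV) epowr (1/t') *
          (\<integral>\<^sup>+k. (ennreal (a k) epowr (1/t) * \<Psi> k y) epowr t \<partial>count_space UNIV) epowr (1/t)"
        using t t' by (intro Hoelder_nn_integral) auto
      also have "\<dots> = ennreal S epowr (1/t') * (\<Sum>k. ennreal (a k) * \<Psi> k y epowr t) epowr (1/t)"
        using t t' by (simp add: epowr_epowr epowr_mult nn_integral_count_space_nat S)
      finally have "\<Phi> y epowr t \<le> (ennreal S epowr (1/t') * (\<Sum>k. ennreal (a k) * \<Psi> k y epowr t) epowr (1/t)) epowr t"
        using t by (intro epowr_mono) auto
      then show ?thesis using t t' by (simp add: epowr_mult epowr_epowr)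
    qed
    have "(\<integral>\<^sup>+y. \<Phi> y epowr t \<partial>M) \<le> (\<integral>\<^sup>+y. ennreal S epowr (t/t') * (\<Sum>k. ennreal (a k) * \<Psi> k y epowr t) \<partial>M)"
      by (intro nn_integral_mono pt)
    also have "\<dots> = ennreal S epowr (t/t') * (\<Sum>k. ennreal (a k) * (\<integral>\<^sup>+y. \<Psi> k y epowr t \<partial>M))"
      by (simp add: nn_integral_cmult nn_integral_suminf)
    also have "\<dots> \<le> ennreal S epowr (t/t') * (\<Sum>k. ennreal (a k) * A epowr t)"
      by (intro mult_left_mono suminf_le AP) auto
    also have "\<dots> = ennreal S epowr (t/t') * ennreal S epowr 1 * A epowr t"
      by (simp add: S mult.assoc)
    also have "ennreal S epowr (t/t') * ennreal S epowr 1 = ennreal S epowr t"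
    proof -
      have "t/t' + 1 = t" using t by (simp add: t'_def field_simps)
      then show ?thesis using epowr_add[of "t/t'" 1 "ennreal S"] t t' by simp
    qed
    also have "ennreal S epowr t * A epowr t = (ennreal S * A) epowr t" using t by (simp add: epowr_mult)
    finally have "(\<integral>\<^sup>+y. \<Phi> y epowr t \<partial>M) epowr (1/t) \<le> ((ennreal S * A) epowr t) epowr (1/t)"
      using t by (intro epowr_mono) auto
    then show ?thesis using t by (simp add: L epowr_epowr)
  qed
qed

lemma ball_lebesgue_measurable [measurable]: "ball y r \<in> sets lebesgue"
  by simp

lemma locally_integrable_measurable:
  fixes f :: "real ^ 'n \<Rightarrow> 'b :: euclidean_space"
  assumes f: "locally_integrable f"
  shows "f \<in> borel_measurable lebesgue"
proof (rule borel_measurable_LIMSEQ_metric)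
  have loc: "f absolutely_integrable_on cball 0 (real i)" for i
    using f by (auto simp: locally_integrable_def)
  show "(\<lambda>x. indicat_real (cball 0 (real i)) x *\<^sub>R f x) \<in> borel_measurable lebesgue" for i
    using loc[of i] unfolding set_integrable_def by (rule borel_measurable_integrable)
  fix x :: "real ^ 'n"
  have "\<forall>\<^sub>F i in sequentially. norm x \<le> real i"
    by (rule eventually_sequentiallyI[of "nat \<lceil>norm x\<rceil>"]) linarith
  then have "\<forall>\<^sub>F i in sequentially. indicat_real (cball 0 (real i)) x *\<^sub>R f x = f x"
    by eventually_elim simp
  then show "(\<lambda>i. indicat_real (cball 0 (real i)) x *\<^sub>R f x) \<longlonglongrightarrow> f x"
    by (rule tendsto_eventually)
qed

section \<open>From a weight in the A-class to a pair of weights\<close>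

locale Apq_weight =
  fixes w :: "real ^ 'n \<Rightarrow> real" and p p' q \<gamma> :: real
  assumes p: "1 < p" and p'_def: "p' = p / (p - 1)" and q: "0 < q" "1/q = 1/p - \<gamma> / real CARD('n)"
    and \<gamma>: "0 < \<gamma>" "\<gamma> < real CARD('n)"
    and w: "w \<in> A_class p q"
begin

abbreviation "\<sigma> \<equiv> \<lambda>x. w x powr (- p')"
abbreviation "u \<equiv> \<lambda>x. w x powr q"
abbreviation "v \<equiv> \<lambda>x. w x powr p"

lemma p': "1 < p'" "1/p + 1/p' = 1" "p' * p = p' + p"
  using p by (auto simp: p'_def field_simps)

lemma q_gt: "p < q" "1 < q"
proof -
  have "1/q < 1/p" using q(2) \<gamma> by simp
  then show "p < q" using p q(1) by (simp add: field_simps)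
  then show "1 < q" using p by simp
qed

lemma w_nonneg: "0 \<le> w x"
  using w by (simp add: A_class_def weight_def)

lemma w_measurable [measurable]: "w \<in> borel_measurable lebesgue"
  using w by (intro locally_integrable_measurable) (simp add: A_class_def weight_def)

lemma dual_integral_finite: "(\<integral>\<^sup>+x\<in>ball y r. ennreal (w x) epowr (- p') \<partial>lebesgue) < top"
  using w by (cases "0 < r") (auto simp: A_class_def Let_def p'_def ball_empty)

text \<open>Where w vanishes, its power -p' is \<infinity>; as the integrals of this power over
  balls are finite, it happens on a null set.\<close>

lemma AE_w_pos: "AE x in lebesgue. 0 < w x"
proof -
  have "AE x in lebesgue. x \<in> ball 0 (real n) \<longrightarrow> 0 < w x" for n
  proof -
    have "AE x in lebesgue. ennreal (w x) epowr (- p') * indicator (ball 0 (real n)) x \<noteq> \<infinity>"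
      by (rule nn_integral_PInf_AE) (use dual_integral_finite[of 0 "real n"] in auto)
    then show ?thesis
    proof eventually_elim
      case (elim x)
      show ?case
      proof
        assume x: "x \<in> ball 0 (real n)"
        have "w x \<noteq> 0" using elim x p'(1) by (auto simp: epowr_def)
        then show "0 < w x" using w_nonneg[of x] by simp
      qed
    qed
  qed
  then have "AE x in lebesgue. \<forall>n. x \<in> ball 0 (real n) \<longrightarrow> 0 < w x" unfolding AE_all_countable by blast
  then show ?thesis
  proof eventually_elim
    case (elim x)
    obtain n where "norm x < real n" using reals_Archimedean2 by blast
    then show ?case using elim by auto
  qed
qed

text \<open>The real power \<open>0 powr (- p')\<close> is 0 where \<open>epowr\<close> gives
  \<infinity>, so the two integrands differ at the zeros of w; these form a null set.\<close>

lemma emeasure_\<sigma>: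
  assumes [measurable]: "E \<in> sets lebesgue"
  shows "wvol \<sigma> E = (\<integral>\<^sup>+x\<in>E. ennreal (w x) epowr (- p') \<partial>lebesgue)"
proof -
  have "wvol \<sigma> E = (\<integral>\<^sup>+x. ennreal (\<sigma> x) * indicator E x \<partial>lebesgue)"
    by (subst emeasure_density) auto
  also have "\<dots> = (\<integral>\<^sup>+x\<in>E. ennreal (w x) epowr (- p') \<partial>lebesgue)"
    using AE_w_pos by (intro nn_integral_cong_AE) (auto elim!: eventually_mono simp: epowr_ennreal)
  finally show ?thesis .
qed

lemma emeasure_u:
  assumes [measurable]: "E \<in> sets lebesgue"
  shows "wvol u E = (\<integral>\<^sup>+x\<in>E. ennreal (w x) epowr q \<partial>lebesgue)"
  using q(1) w_nonneg by (subst emeasure_density) (auto simp: epowr_ennreal')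

lemma Apq_ball:
  obtains K where "0 < K" "\<And>y r. 0 < r \<Longrightarrow>
    (wvol u (ball y r) / vol (ball y r)) epowr (1/q) *
    (wvol \<sigma> (ball y r) / vol (ball y r)) epowr (1/p') \<le> ennreal K"
proof -
  have "\<exists>C>0. \<forall>y r. 0 < r \<longrightarrow>
         ((\<integral>\<^sup>+ x\<in>ball y r. ennreal (w x) epowr q \<partial>lebesgue) / vol (ball y r)) epowr (1 / q)
         * ((\<integral>\<^sup>+ x\<in>ball y r. ennreal (w x) epowr (- p') \<partial>lebesgue) / vol (ball y r)) epowr (1 / p')
         \<le> ennreal C"
    using w unfolding A_class_def Let_def p'_def by blast
  then show ?thesis using that by (auto simp: emeasure_u emeasure_\<sigma>)
qed

lemma \<sigma>_ball: "wvol \<sigma> (ball y r) < top" "0 < r \<Longrightarrow> 0 < wvol \<sigma> (ball y r)"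
proof -
  show "wvol \<sigma> (ball y r) < top" using dual_integral_finite by (simp add: emeasure_\<sigma>)
  show "0 < wvol \<sigma> (ball y r)" if r: "0 < r"
  proof (rule ccontr)
    assume "\<not> ?thesis"
    then have "(\<integral>\<^sup>+x. ennreal (\<sigma> x) * indicator (ball y r) x \<partial>lebesgue) = 0"
      by (subst (asm) emeasure_density) auto
    then have "AE x in lebesgue. ennreal (\<sigma> x) * indicator (ball y r) x = 0"
      by (subst (asm) nn_integral_0_iff_AE) auto
    with AE_w_pos have "AE x in lebesgue. x \<notin> ball y r"
      by eventually_elim (auto simp: indicator_def split: if_splits)
    then have "vol (ball y r) = 0"
      by (subst (asm) AE_iff_measurable[of "ball y r"]) auto
    moreover have "0 < unit_ball_vol (real CARD('n))" by simp
    ultimately show False using r by (simp add: emeasure_ball del: unit_ball_vol_pos)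
  qed
qed

lemma emeasure_ball_pos: "0 < r \<Longrightarrow> 0 < vol (ball y r :: (real ^ 'n) set)"
  and emeasure_ball_finite: "vol (ball y r :: (real ^ 'n) set) < top"
proof -
  show "vol (ball y r :: (real ^ 'n) set) < top"
    using emeasure_bounded_finite[OF bounded_ball] by auto
  have "0 < unit_ball_vol (real CARD('n))" by simp
  then show "0 < vol (ball y r :: (real ^ 'n) set)" if "0 < r"
    using that by (simp add: emeasure_ball del: unit_ball_vol_pos)
qed

text \<open>Local integrability of w^q follows from the A-condition: the dual factor is strictly
  positive, so an infinite first factor would make the product infinite.\<close>

lemma u_ball_finite: "wvol u (ball y r) < top"
proof (cases "0 < r")
  case True
  obtain K where K: "(wvol u (ball y r) / vol (ball y r)) epowr (1/q) *
    (wvol \<sigma> (ball y r) / vol (ball y r)) epowr (1/p') \<le> ennreal K"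
    using Apq_ball True by metis
  have "wvol \<sigma> (ball y r) / vol (ball y r) \<noteq> 0"
    using emeasure_ball_finite[of y r] \<sigma>_ball(2)[OF True, of y] by (auto simp: ennreal_divide_eq_0_iff)
  then have "(wvol \<sigma> (ball y r) / vol (ball y r)) epowr (1/p') \<noteq> 0"
    using p'(1) by simp
  then have "(wvol u (ball y r) / vol (ball y r)) epowr (1/q) \<noteq> top"
    using K by (auto simp: ennreal_top_mult top_unique)
  then have "wvol u (ball y r) / vol (ball y r) \<noteq> top"
    using q(1) by simp
  moreover have "top / vol (ball y r) = top"
    using emeasure_ball_finite[of y r] by (auto simp: ennreal_top_divide)
  ultimately have "wvol u (ball y r) \<noteq> top" by metis
  then show ?thesis by (simp add: less_top)
qed (simp add: ball_empty)

lemma Apq_pair_exists: "\<exists>K. Apq_pair \<sigma> u p p' q \<gamma> (1 - \<gamma> / real CARD('n)) K"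
proof -
  obtain K where K: "0 < K" "\<And>y r. 0 < r \<Longrightarrow>
    (wvol u (ball y r) / vol (ball y r)) epowr (1/q) *
    (wvol \<sigma> (ball y r) / vol (ball y r)) epowr (1/p') \<le> ennreal K"
    by (rule Apq_ball) blast
  let ?\<theta> = "1 - \<gamma> / real CARD('n)"
  have \<theta>: "1/p' + 1/q = ?\<theta>" using p'(2) q(2) by linarith
  have "Apq_pair \<sigma> u p p' q \<gamma> ?\<theta> K"
  proof
    show "AE x in lebesgue. ennreal (\<sigma> x) epowr (1/p') * ennreal (u x) epowr (1/q) = 1"
      using AE_w_pos
    proof eventually_elim
      case (elim x)
      then have "ennreal (\<sigma> x) epowr (1/p') = ennreal (w x powr (- 1))"
        using p'(1) by (simp add: epowr_ennreal powr_powr)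
      moreover have "ennreal (u x) epowr (1/q) = ennreal (w x)"
        using elim q(1) by (simp add: epowr_ennreal powr_powr)
      ultimately show ?case using elim by (simp add: ennreal_mult'[symmetric] powr_minus)
    qed
    fix y :: "real ^ 'n" and r :: real assume r: "0 < r"
    let ?m = "vol (ball y r)"
    have m: "?m \<noteq> 0" "?m \<noteq> top" using emeasure_ball_pos[OF r, of y] emeasure_ball_finite[of y r] by auto
    have eq: "x = x / ?m * ?m" for x using m by (simp add: ennreal_divide_times ennreal_divide_self less_top)
    let ?S = "wvol \<sigma> (ball y r)" and ?U = "wvol u (ball y r)"
    have "?S epowr (1/p') * ?U epowr (1/q) = (?S / ?m * ?m) epowr (1/p') * (?U / ?m * ?m) epowr (1/q)"
      by (simp only: eq[symmetric])
    also have "\<dots> = ((?U / ?m) epowr (1/q) * (?S / ?m) epowr (1/p')) * (?m epowr (1/p') * ?m epowr (1/q))"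
      using p'(1) q(1) by (simp add: epowr_mult mult.assoc mult.commute mult.left_commute)
    also have "?m epowr (1/p') * ?m epowr (1/q) = ?m epowr ?\<theta>"
      using epowr_add[of "1/p'" "1/q" ?m] p'(1) q(1) \<theta> by simp
    also have "((?U / ?m) epowr (1/q) * (?S / ?m) epowr (1/p')) * ?m epowr ?\<theta> \<le> ennreal K * ?m epowr ?\<theta>"
      by (intro mult_right_mono K r) auto
    finally show "?S epowr (1/p') * ?U epowr (1/q) \<le> ennreal K * ?m epowr ?\<theta>" .
  qed (use p p' q \<gamma> K u_ball_finite \<sigma>_ball in auto)
  then show ?thesis ..
qed

text \<open>Fixing one admissible constant by choice allows the results on pairs to be imported as a
  \<open>sublocale\<close>.\<close>

definition "K = (SOME K. Apq_pair \<sigma> u p p' q \<gamma> (1 - \<gamma> / real CARD('n)) K)"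

sublocale pair: Apq_pair \<sigma> u p p' q \<gamma> "1 - \<gamma> / real CARD('n)" K
  unfolding K_def by (rule someI_ex[OF Apq_pair_exists])

end

section \<open>Local part and tail of the potential\<close>

lemma borel_measurable_kernel:
  "(\<lambda>z. norm (fst z - snd z) powr c) \<in> borel_measurable (borel \<Otimes>\<^sub>M (lebesgue :: (real ^ 'n) measure))"
proof -
  note [measurable] = borel_measurable_snd_lebesgue
  show ?thesis by measurable
qed

lemma borel_measurable_potential:
  fixes F :: "real ^ 'n \<Rightarrow> ennreal"
  assumes [measurable]: "F \<in> borel_measurable lebesgue"
  shows "potential \<gamma> F \<in> borel_measurable lebesgue"
proof -
  interpret sigma_finite_measure "lebesgue :: (real ^ 'n) measure" by (rule sigma_finite_lebesgue)
  have "potential \<gamma> F \<in> borel_measurable borel"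
    unfolding potential_def[abs_def]
  proof (rule borel_measurable_nn_integral)
    note [measurable] = borel_measurable_kernel
    have "(\<lambda>z. F (snd z) * ennreal (norm (fst z - snd z) powr (\<gamma> - real CARD('n)))) \<in> borel_measurable (borel \<Otimes>\<^sub>M lebesgue)"
      by measurable
    then show "(\<lambda>(x, y). F y * ennreal (norm (x - y) powr (\<gamma> - real CARD('n)))) \<in> borel_measurable (borel \<Otimes>\<^sub>M lebesgue)"
      by (simp add: case_prod_unfold)
  qed
  then show ?thesis by (intro measurable_completion) simp
qed

text \<open>Outside the double ball, z has a distance between 2^k r and 2^(k+2) r from y for some k
  \<ge> 0, and its distance to x is at least half of that to y, since x is within r of y. The annuli
  are enlarged to balls, which makes every term an integral over a ball with centre y.\<close>

lemma potential_le_local_plus_tail: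
  fixes F :: "real ^ 'n \<Rightarrow> ennreal"
  assumes \<gamma>: "\<gamma> < real CARD('n)" and r: "0 < r" and x: "x \<in> ball y r"
    and F[measurable]: "F \<in> borel_measurable lebesgue"
  shows "potential \<gamma> F x \<le> potential \<gamma> (\<lambda>z. F z * indicator (ball y (2 * r)) z) x
    + (\<Sum>k. ennreal ((2 ^ k * r / 2) powr (\<gamma> - real CARD('n)))
        * (\<integral>\<^sup>+z. F z * indicator (ball y (2 ^ (k + 2) * r)) z \<partial>lebesgue))"
proof -
  let ?k = "\<lambda>z. ennreal (norm (x - z) powr (\<gamma> - real CARD('n)))"
  let ?c = "\<lambda>k. ennreal ((2 ^ k * r / 2) powr (\<gamma> - real CARD('n)))"
  have "norm (x - y) < r" using x by (simp add: dist_norm norm_minus_commute)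
  have "F z * ?k z \<le> F z * indicator (ball y (2 * r)) z * ?k z
     + (\<Sum>k. ?c k * (F z * indicator (ball y (2 ^ (k + 2) * r)) z))" for z
  proof (cases "z \<in> ball y (2 * r)")
    case False
    define X where "X = dist y z / r"
    have X: "2 \<le> X" "dist y z = X * r" using False r by (auto simp: X_def field_simps)
    obtain j where j: "2 powr real_of_int j < X" "X \<le> 2 powr (real_of_int j + 1)"
      using powr_between[of 2 X] X by auto
    have "0 \<le> j"
    proof (rule ccontr)
      assume "\<not> 0 \<le> j"
      then have "2 powr (real_of_int j + 1) \<le> 2 powr (0::real)" by (intro powr_mono) auto
      then show False using j X by simp
    qed
    then obtain k where "j = int k" using nonneg_int_cases by blast
    \<comment> \<open>The upper end is weakened from 2^(k+1) to 2^(k+2) to make it strict, as the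
      balls are open.\<close>
    then have k: "2 ^ k < X" "X < 2 ^ (k + 2)"
      using j X by (auto simp: powr_realpow powr_add)
    have "z \<in> ball y (2 ^ (k + 2) * r)" using k r X by simp
    moreover have "?k z \<le> ?c k"
    proof -
      have "dist y z \<le> norm (x - z) + norm (x - y)"
        using dist_triangle[of y z x] by (simp add: dist_norm norm_minus_commute)
      then have "X * r - r \<le> norm (x - z)" using \<open>norm (x - y) < r\<close> X by simp
      moreover have "2 ^ k * r \<le> X * r" "2 * r \<le> X * r" using k X r by (auto intro!: mult_right_mono)
      ultimately have "2 ^ k * r / 2 \<le> norm (x - z)" by linarith
      then show ?thesis using r \<gamma> by (intro ennreal_leI powr_mono2') auto
    qed
    ultimately have "F z * ?k z \<le> ?c k * (F z * indicator (ball y (2 ^ (k + 2) * r)) z)"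
      by (simp add: mult.commute[of "F z"] mult_right_mono)
    also have "\<dots> \<le> (\<Sum>k. ?c k * (F z * indicator (ball y (2 ^ (k + 2) * r)) z))"
      using sum_le_suminf[of "\<lambda>k. ?c k * (F z * indicator (ball y (2 ^ (k + 2) * r)) z)" "{k}"]
      by (simp add: summableI)
    finally show ?thesis using False by simp
  qed simp
  then have "potential \<gamma> F x \<le> (\<integral>\<^sup>+z. F z * indicator (ball y (2 * r)) z * ?k z
     + (\<Sum>k. ?c k * (F z * indicator (ball y (2 ^ (k + 2) * r)) z)) \<partial>lebesgue)"
    unfolding potential_def by (intro nn_integral_mono)
  also have "\<dots> = potential \<gamma> (\<lambda>z. F z * indicator (ball y (2 * r)) z) x
     + (\<Sum>k. ?c k * (\<integral>\<^sup>+z. F z * indicator (ball y (2 ^ (k + 2) * r)) z \<partial>lebesgue))"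
  proof -
    have [measurable]: "(\<lambda>z. norm (x - z) powr (\<gamma> - real CARD('n))) \<in> borel_measurable lebesgue"
      by (intro measurable_completion) measurable
    show ?thesis
      unfolding potential_def by (subst nn_integral_add) (auto simp: nn_integral_suminf nn_integral_cmult)
  qed
  finally show ?thesis .
qed

context Apq_weight
begin

lemma AE_dual: "AE x in lebesgue. ennreal (\<sigma> x) * ennreal (w x powr p') = 1"
  using AE_w_pos by eventually_elim (simp add: ennreal_mult'[symmetric] powr_add[symmetric])

text \<open>Substituting F = \<sigma> g with g = w^(p') F turns the measure \<sigma> into w^p,
  because \<sigma> g^p = w^(p'p - p') F^p and p'p - p' = p.\<close>

lemma potential_strong_type:
  obtains C where "0 < C" "\<And>F. F \<in> borel_measurable lebesgue \<Longrightarrow> (\<integral>\<^sup>+x. F x \<partial>lebesgue) < top \<Longrightarrow>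
    pnorm q (wmeasure u) (potential \<gamma> F) \<le> ennreal C * pnorm p (wmeasure v) F"
proof -
  obtain C where C: "0 < C" "\<And>g. g \<in> borel_measurable lebesgue \<Longrightarrow> (\<integral>\<^sup>+x. g x \<partial>wmeasure \<sigma>) < top \<Longrightarrow>
    pnorm q (wmeasure u) (potential \<gamma> (\<lambda>y. ennreal (\<sigma> y) * g y))
      \<le> ennreal C * pnorm p (wmeasure \<sigma>) g"
    by (rule pair.potential_bound) blast
  show ?thesis
  proof (rule that[OF C(1)])
    fix F :: "real ^ 'n \<Rightarrow> ennreal" assume F[measurable]: "F \<in> borel_measurable lebesgue" and fin: "(\<integral>\<^sup>+x. F x \<partial>lebesgue) < top"
    define g where "g x = ennreal (w x powr p') * F x" for x
    have [measurable]: "g \<in> borel_measurable lebesgue" unfolding g_def by measurable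
    have g: "AE x in lebesgue. ennreal (\<sigma> x) * g x = F x"
      using AE_dual by eventually_elim (simp add: g_def mult.assoc[symmetric])
    have "(\<integral>\<^sup>+x. g x \<partial>wmeasure \<sigma>) = (\<integral>\<^sup>+x. F x \<partial>lebesgue)"
      by (subst nn_integral_density) (use g in \<open>auto intro!: nn_integral_cong_AE\<close>)
    then have fin_g: "(\<integral>\<^sup>+x. g x \<partial>wmeasure \<sigma>) < top" using fin by simp
    have J: "potential \<gamma> (\<lambda>y. ennreal (\<sigma> y) * g y) x = potential \<gamma> F x" for x
      unfolding potential_def using g by (intro nn_integral_cong_AE) (auto elim!: eventually_mono)
    have norm_g: "(\<integral>\<^sup>+x. g x epowr p \<partial>wmeasure \<sigma>) = (\<integral>\<^sup>+x. F x epowr p \<partial>wmeasure v)"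
    proof -
      have "AE x in lebesgue. ennreal (\<sigma> x) * g x epowr p = ennreal (v x) * F x epowr p"
        using AE_w_pos
      proof eventually_elim
        case (elim x)
        have "ennreal (\<sigma> x) * ennreal (w x powr p') epowr p = ennreal (w x powr (- p' + p' * p))"
          using elim by (simp add: epowr_ennreal powr_powr ennreal_mult'[symmetric] powr_add[symmetric])
        also have "- p' + p' * p = p" using p'(3) by simp
        finally show ?case using p by (simp add: g_def epowr_mult mult.assoc[symmetric])
      qed
      then show ?thesis
        by (subst (1 2) nn_integral_density) (auto intro!: nn_integral_cong_AE)
    qed
    show "pnorm q (wmeasure u) (potential \<gamma> F) \<le> ennreal C * pnorm p (wmeasure v) F"
      using C(2)[OF _ fin_g] by (simp add: J norm_g)
  qed
qed

definition local_norm :: "(real ^ 'n \<Rightarrow> ennreal) \<Rightarrow> real ^ 'n \<Rightarrow> real \<Rightarrow> ennreal" where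
  "local_norm F y r = pnorm p (wmeasure v) (\<lambda>x. F x * indicator (ball y r) x)"

text \<open>Hoelder's inequality for the factorisation F = (w F) w^(-1), as w^(-1) to the power p'
  is \<sigma>.\<close>

lemma integral_ball_le:
  assumes F[measurable]: "F \<in> borel_measurable lebesgue"
  shows "ball_integral F y r \<le> local_norm F y r * wvol \<sigma> (ball y r) epowr (1/p')"
proof -
  let ?B = "ball y r"
  have "(\<integral>\<^sup>+x. F x * indicator ?B x \<partial>lebesgue)
     = (\<integral>\<^sup>+x. (ennreal (w x) * (F x * indicator ?B x)) * (ennreal (w x powr (-1)) * indicator ?B x) \<partial>lebesgue)"
  proof (intro nn_integral_cong_AE)
    show "AE x in lebesgue. F x * indicator ?B x = (ennreal (w x) * (F x * indicator ?B x)) * (ennreal (w x powr (-1)) * indicator ?B x)"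
      using AE_w_pos
    proof eventually_elim
      case (elim x)
      then have "ennreal (w x) * ennreal (w x powr (-1)) = 1"
        by (simp add: ennreal_mult'[symmetric] powr_minus)
      then have "F x = ennreal (w x) * F x * ennreal (w x powr (-1))"
        by (metis mult.commute mult.left_commute mult_1_right)
      then show ?case by (simp add: indicator_def)
    qed
  qed
  also have "\<dots> \<le> pnorm p lebesgue (\<lambda>x. ennreal (w x) * (F x * indicator ?B x))
      * (\<integral>\<^sup>+x. (ennreal (w x powr (-1)) * indicator ?B x) epowr p' \<partial>lebesgue) epowr (1/p')"
    by (intro Hoelder_nn_integral p p') measurable
  also have "(\<integral>\<^sup>+x. (ennreal (w x) * (F x * indicator ?B x)) epowr p \<partial>lebesgue) = (\<integral>\<^sup>+x. (F x * indicator ?B x) epowr p \<partial>wmeasure v)"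
    using p w_nonneg by (subst nn_integral_density) (auto simp: epowr_mult epowr_ennreal')
  also have "(\<integral>\<^sup>+x. (ennreal (w x powr (-1)) * indicator ?B x) epowr p' \<partial>lebesgue) = wvol \<sigma> ?B"
  proof -
    have "(ennreal (w x powr (-1)) * indicator ?B x) epowr p' = ennreal (\<sigma> x) * indicator ?B x" for x
    proof -
      have "(w x powr (-1)) powr p' = \<sigma> x" by (simp only: powr_powr mult_minus1)
      then have "ennreal (w x powr (-1)) epowr p' = ennreal (\<sigma> x)" using p'(1) by (simp only: epowr_ennreal' powr_ge_zero)
      then show ?thesis using p'(1) by (simp add: epowr_mult indicator_def del: powr_minus_divide)
    qed
    then show ?thesis by (subst emeasure_density) auto
  qed
  finally show ?thesis by (simp add: local_norm_def)
qed

section \<open>Doubling, reverse doubling and the estimate on one ball\<close>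

definition U :: "real ^ 'n \<Rightarrow> real \<Rightarrow> real" where
  "U y r = measure (wmeasure u) (ball y r)"

lemma emeasure_U: "wvol u (ball y r) = ennreal (U y r)"
  unfolding U_def using u_ball_finite[of y r] by (intro emeasure_eq_ennreal_measure) auto

lemma U_pos:
  assumes r: "0 < r"
  shows "0 < U y r"
proof -
  have "wvol u (ball y r) \<noteq> 0"
    using emeasure_ball_pos[OF r, of y] emeasure_ball_finite[of y r]
    by (intro pair.emeasure_nonzero(2)) (auto simp: zero_less_iff_neq_zero)
  then have "U y r \<noteq> 0" by (auto simp: emeasure_U)
  then show ?thesis using measure_nonneg[of "wmeasure u" "ball y r"] by (simp add: U_def less_le)
qed

lemma U_doubling:
  obtains D where "0 < D" "\<And>y r. 0 < r \<Longrightarrow> U y (2 * r) \<le> D * U y r"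
proof -
  let ?c = "2 ^ CARD('n) :: real"
  let ?D = "(K * ?c powr (1 - \<gamma> / real CARD('n))) powr q"
  have "U y (2 * r) \<le> ?D * U y r" if r: "0 < r" for y r
  proof -
    have "vol (ball y (2 * r)) = ennreal ?c * vol (ball y r)"
      using r by (simp add: emeasure_ball power_mult_distrib ennreal_mult''[symmetric] mult.left_commute)
    moreover have "ball y r \<subseteq> ball y (2 * r)" using r by (intro subset_ball) simp
    ultimately have "ennreal (U y (2 * r)) \<le> ennreal ?D * ennreal (U y r)"
      using pair.comparable_ball(2)[of "2 * r" "ball y r" y ?c] r by (auto simp: emeasure_U)
    then show ?thesis using U_pos[OF r, of y] by (simp add: ennreal_mult'[symmetric])
  qed
  moreover have "0 < ?D" using pair.K by simp
  ultimately show ?thesis using that by blast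
qed

text \<open>The shell between B and 2B contains a ball of radius r/2 centred at distance 3r/2 from
  y. Its volume is 4^n times smaller than that of 2B, so it carries at least a fixed fraction 1/D of
  the u-mass of 2B, which B misses.\<close>

lemma U_reverse_doubling:
  obtains \<rho> where "0 < \<rho>" "\<rho> < 1" "\<And>y r. 0 < r \<Longrightarrow> U y r \<le> \<rho> * U y (2 * r)"
proof -
  let ?c = "4 ^ CARD('n) :: real"
  define D where "D = (K * ?c powr (1 - \<gamma> / real CARD('n))) powr q"
  have D: "0 < D" using pair.K by (simp add: D_def)
  have main: "U y (2 * r) \<le> D * (U y (2 * r) - U y r)" if r: "0 < r" for y r
  proof -
    obtain e :: "real ^ 'n" where e: "norm e = 1" using vector_choose_size[of 1] by auto
    let ?E = "ball (y + (3 * r / 2) *\<^sub>R e) (r / 2)"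
    have E: "?E \<subseteq> ball y (2 * r)" "?E \<inter> ball y r = {}"
    proof -
      have *: "dist y z < 2 * r \<and> \<not> dist y z < r" if "z \<in> ?E" for z
      proof -
        have c: "dist y (y + (3 * r / 2) *\<^sub>R e) = 3 * r / 2" using e r by (simp add: dist_norm)
        have "dist (y + (3 * r / 2) *\<^sub>R e) z < r / 2" using that by simp
        then show ?thesis
          using dist_triangle[of y z "y + (3 * r / 2) *\<^sub>R e"] dist_triangle2[of y "y + (3 * r / 2) *\<^sub>R e" z] c
          by linarith
      qed
      show "?E \<subseteq> ball y (2 * r)" using * by auto
      show "?E \<inter> ball y r = {}" using * by auto
    qed
    have "vol (ball y (2 * r)) = ennreal ?c * vol ?E"
    proof -
      have "(2 * r) ^ CARD('n) = ?c * (r / 2) ^ CARD('n)" by (simp only: power_mult_distrib[symmetric]) simp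
      then have "vol (ball y (2 * r)) = ennreal (unit_ball_vol (real CARD('n)) * (?c * (r / 2) ^ CARD('n)))"
        using r by (simp add: emeasure_ball)
      also have "\<dots> = ennreal (?c * (unit_ball_vol (real CARD('n)) * (r / 2) ^ CARD('n)))"
        by (simp only: mult.left_commute)
      also have "\<dots> = ennreal ?c * ennreal (unit_ball_vol (real CARD('n)) * (r / 2) ^ CARD('n))"
        by (rule ennreal_mult') simp
      finally show ?thesis using r by (simp add: emeasure_ball)
    qed
    then have "ennreal (U y (2 * r)) \<le> ennreal D * wvol u ?E"
      using pair.comparable_ball(2)[of "2 * r" ?E y ?c] r E by (auto simp: emeasure_U D_def)
    then have 1: "U y (2 * r) \<le> D * U (y + (3 * r / 2) *\<^sub>R e) (r / 2)"
      using D U_pos[of "r / 2"] r by (simp add: emeasure_U ennreal_mult'[symmetric] less_imp_le)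
    have "wvol u ?E + wvol u (ball y r) = wvol u (?E \<union> ball y r)"
      using E by (intro plus_emeasure) auto
    also have "\<dots> \<le> wvol u (ball y (2 * r))"
      using E r by (intro emeasure_mono) auto
    finally have "U (y + (3 * r / 2) *\<^sub>R e) (r / 2) + U y r \<le> U y (2 * r)"
      using U_pos r by (simp add: emeasure_U ennreal_plus[symmetric] less_imp_le del: ennreal_plus)
    then have "D * U (y + (3 * r / 2) *\<^sub>R e) (r / 2) \<le> D * (U y (2 * r) - U y r)"
      using D by (intro mult_left_mono) auto
    with 1 show ?thesis by linarith
  qed
  \<comment> \<open>The maximum with 1/2 keeps \<rho> positive.\<close>
  define \<rho> where "\<rho> = max (1 - 1 / D) (1 / 2)"
  have "U y r \<le> \<rho> * U y (2 * r)" if "0 < r" for y r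
  proof -
    have "U y r \<le> (1 - 1 / D) * U y (2 * r)"
      using main[OF that, of y] D by (simp add: field_simps)
    also have "\<dots> \<le> \<rho> * U y (2 * r)"
      using U_pos[of "2 * r" y] that by (intro mult_right_mono) (auto simp: \<rho>_def)
    finally show ?thesis .
  qed
  moreover have "0 < \<rho>" "\<rho> < 1" using D by (auto simp: \<rho>_def)
  ultimately show ?thesis using that by blast
qed

text \<open>The A-condition solved for the dual factor. The power of the volume becomes
  R^(n-\<gamma>), the reciprocal of the size of the kernel at distance R.\<close>

lemma dual_ball_le:
  assumes R: "0 < R"
  shows "wvol \<sigma> (ball y R) epowr (1/p')
    \<le> ennreal (K * unit_ball_vol (real CARD('n)) powr (1 - \<gamma> / real CARD('n)) * R powr (real CARD('n) - \<gamma>) * U y R powr (- 1/q))"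
proof -
  let ?\<theta> = "1 - \<gamma> / real CARD('n)" and ?V = "unit_ball_vol (real CARD('n))"
  have V: "0 < ?V" by simp
  have "wvol \<sigma> (ball y R) epowr (1/p') * ennreal (U y R powr (1/q))
     \<le> ennreal K * ennreal ((?V * R ^ CARD('n)) powr ?\<theta>)"
    using pair.Apq[OF R, of y] R V U_pos[OF R, of y] by (simp add: emeasure_U emeasure_ball epowr_ennreal)
  also have "(?V * R ^ CARD('n)) powr ?\<theta> = ?V powr ?\<theta> * R powr (real CARD('n) - \<gamma>)"
  proof -
    have "real CARD('n) * ?\<theta> = real CARD('n) - \<gamma>" by (simp add: field_simps)
    then have "(R ^ CARD('n)) powr ?\<theta> = R powr (real CARD('n) - \<gamma>)"
      using R by (simp only: powr_realpow[symmetric] powr_powr)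
    then show ?thesis using V R by (simp add: powr_mult)
  qed
  finally have *: "wvol \<sigma> (ball y R) epowr (1/p') * ennreal (U y R powr (1/q))
     \<le> ennreal (K * ?V powr ?\<theta> * R powr (real CARD('n) - \<gamma>))"
    using pair.K by (simp add: ennreal_mult'[symmetric] mult.assoc)
  have "wvol \<sigma> (ball y R) epowr (1/p') * ennreal (U y R powr (1/q)) * ennreal (U y R powr (- 1/q))
     \<le> ennreal (K * ?V powr ?\<theta> * R powr (real CARD('n) - \<gamma>)) * ennreal (U y R powr (- 1/q))"
    by (intro mult_right_mono *) auto
  moreover have "ennreal (U y R powr (1/q)) * ennreal (U y R powr (- 1/q)) = 1"
    using U_pos[OF R, of y] by (simp add: ennreal_mult'[symmetric] powr_add[symmetric])
  ultimately show ?thesis using pair.K by (simp add: mult.assoc ennreal_mult''[symmetric])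
qed

text \<open>With R = 2^(k+2) r the lower bound 2^k r / 2 for the distance is R/8. The powers of R
  cancel up to a power of 8.\<close>

lemma tail_term_le:
  fixes F :: "real ^ 'n \<Rightarrow> ennreal"
  assumes R: "0 < R" and F: "F \<in> borel_measurable lebesgue"
  shows "ennreal ((R / 8) powr (\<gamma> - real CARD('n))) * ball_integral F y R
    \<le> ennreal (K * unit_ball_vol (real CARD('n)) powr (1 - \<gamma> / real CARD('n)) * 8 powr (real CARD('n) - \<gamma>))
       * (ennreal (U y R powr (- 1/q)) * local_norm F y R)"
proof -
  let ?V = "K * unit_ball_vol (real CARD('n)) powr (1 - \<gamma> / real CARD('n))"
  have "ball_integral F y R
     \<le> local_norm F y R * ennreal (?V * R powr (real CARD('n) - \<gamma>) * U y R powr (- 1/q))"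
    by (rule order_trans[OF integral_ball_le[OF F]]) (intro mult_left_mono dual_ball_le R, simp)
  then have "ennreal ((R / 8) powr (\<gamma> - real CARD('n))) * ball_integral F y R
    \<le> ennreal ((R / 8) powr (\<gamma> - real CARD('n))) * (local_norm F y R * ennreal (?V * R powr (real CARD('n) - \<gamma>) * U y R powr (- 1/q)))"
    by (rule mult_left_mono) simp
  also have "\<dots> = (ennreal ((R / 8) powr (\<gamma> - real CARD('n))) * ennreal (?V * R powr (real CARD('n) - \<gamma>) * U y R powr (- 1/q))) * local_norm F y R"
    by (simp only: ac_simps)
  also have "ennreal ((R / 8) powr (\<gamma> - real CARD('n))) * ennreal (?V * R powr (real CARD('n) - \<gamma>) * U y R powr (- 1/q))
     = ennreal (?V * 8 powr (real CARD('n) - \<gamma>)) * ennreal (U y R powr (- 1/q))"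
  proof -
    have "(R / 8) powr (\<gamma> - real CARD('n)) * R powr (real CARD('n) - \<gamma>) = 8 powr (real CARD('n) - \<gamma>)"
      using R by (simp add: powr_divide powr_diff field_simps)
    moreover have "(R / 8) powr (\<gamma> - real CARD('n)) * (?V * R powr (real CARD('n) - \<gamma>) * U y R powr (- 1/q))
      = ?V * ((R / 8) powr (\<gamma> - real CARD('n)) * R powr (real CARD('n) - \<gamma>)) * U y R powr (- 1/q)"
      by (simp only: ac_simps)
    ultimately have "(R / 8) powr (\<gamma> - real CARD('n)) * (?V * R powr (real CARD('n) - \<gamma>) * U y R powr (- 1/q))
      = ?V * 8 powr (real CARD('n) - \<gamma>) * U y R powr (- 1/q)" by (simp only:)
    then show ?thesis
      by (simp only: ennreal_mult'[OF powr_ge_zero, symmetric] ennreal_mult''[OF powr_ge_zero, symmetric])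
  qed
  finally show ?thesis by (simp only: mult.assoc)
qed

text \<open>The term k = 0 carries the local part, on 2B, and the terms k \<ge> 1 the tail. Keeping
  the sum on the right, instead of bounding it, leaves the norm in the centre to be taken term by
  term.\<close>

theorem local_potential_bound:
  assumes e: "e \<le> 0" "0 < e + 1/q"
  obtains C \<kappa> where "0 < C" "0 < \<kappa>" "\<kappa> < 1"
    "\<And>F y r. F \<in> borel_measurable lebesgue \<Longrightarrow> (\<And>y r. ball_integral F y r < top) \<Longrightarrow> 0 < r \<Longrightarrow>
      ennreal (U y r powr e) * pnorm q (wmeasure u) (\<lambda>x. potential \<gamma> F x * indicator (ball y r) x)
      \<le> (\<Sum>k. ennreal (C * \<kappa> ^ k) * (ennreal (U y (2 ^ (k + 1) * r) powr e) * local_norm F y (2 ^ (k + 1) * r)))"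
proof -
  obtain C0 where C0: "0 < C0" "\<And>F. F \<in> borel_measurable lebesgue \<Longrightarrow> (\<integral>\<^sup>+x. F x \<partial>lebesgue) < top \<Longrightarrow>
    pnorm q (wmeasure u) (potential \<gamma> F) \<le> ennreal C0 * pnorm p (wmeasure v) F"
    by (rule potential_strong_type) blast
  obtain D where D: "0 < D" "\<And>y r. 0 < r \<Longrightarrow> U y (2 * r) \<le> D * U y r" by (rule U_doubling) blast
  obtain \<rho> where \<rho>: "0 < \<rho>" "\<rho> < 1" "\<And>y r. 0 < r \<Longrightarrow> U y r \<le> \<rho> * U y (2 * r)" by (rule U_reverse_doubling) blast
  \<comment> \<open>In the application \<delta> is 1/\<beta> - 1/s, and \<kappa> is the decay gained
    with each doubling of the radius.\<close>
  define \<delta> where "\<delta> = e + 1/q"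
  define \<kappa> where "\<kappa> = \<rho> powr \<delta>"
  have \<kappa>: "0 < \<kappa>" "\<kappa> < 1" using \<rho> e powr_less_mono2[of \<delta> \<rho> 1] by (auto simp: \<kappa>_def \<delta>_def)
  define c1 where "c1 = K * unit_ball_vol (real CARD('n)) powr (1 - \<gamma> / real CARD('n)) * 8 powr (real CARD('n) - \<gamma>)"
  have c1: "0 \<le> c1" using pair.K by (simp add: c1_def)
  \<comment> \<open>The inequality \<open>epowr_add_le\<close> is applied twice: pointwise with
    exponent q, which costs 2 after taking the root, and with exponent 1/q, which costs
    2^(1/q).\<close>
  define c2 where "c2 = 2 * 2 powr (1/q)"
  have c2: "0 < c2" by (simp add: c2_def)
  define C where "C = c2 * (C0 * D powr (- e) + c1)"
  have "0 < C" using c2 C0 c1 D by (auto simp: C_def intro!: mult_pos_pos add_pos_nonneg)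
  have iter: "U y r \<le> \<rho> ^ k * U y (2 ^ k * r)" if r: "0 < r" for y r k
  proof (induction k)
    case (Suc k)
    have "U y (2 ^ k * r) \<le> \<rho> * U y (2 * (2 ^ k * r))" using r by (intro \<rho>) auto
    then have "\<rho> ^ k * U y (2 ^ k * r) \<le> \<rho> ^ k * (\<rho> * U y (2 * (2 ^ k * r)))"
      using \<rho> by (intro mult_left_mono) auto
    then show ?case using Suc by (simp add: mult.assoc mult.left_commute)
  qed simp
  show ?thesis
  proof (rule that[OF \<open>0 < C\<close> \<kappa>])
    fix F :: "real ^ 'n \<Rightarrow> ennreal" and y :: "real ^ 'n" and r :: real
    assume F[measurable]: "F \<in> borel_measurable lebesgue"
      and fin: "\<And>y r. ball_integral F y r < top" and r: "0 < r"
    let ?B = "ball y r"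
    define R where "R k = 2 ^ (k + 1) * r" for k
    have R: "0 < R k" for k using r by (simp add: R_def)
    define g where "g k = ennreal (U y (R k) powr e) * local_norm F y (R k)" for k
    define a where "a = potential \<gamma> (\<lambda>z. F z * indicator (ball y (2 * r)) z)"
    have [measurable]: "a \<in> borel_measurable lebesgue" unfolding a_def by (intro borel_measurable_potential) measurable
    define T where "T = (\<Sum>k. ennreal ((2 ^ k * r / 2) powr (\<gamma> - real CARD('n)))
        * (\<integral>\<^sup>+z. F z * indicator (ball y (2 ^ (k + 2) * r)) z \<partial>lebesgue))"
    have pt: "(potential \<gamma> F x * indicator ?B x) epowr q \<le> ennreal (2 powr q) * (a x epowr q + T epowr q * indicator ?B x)" for x
    proof (cases "x \<in> ?B")
      case True
      then have "potential \<gamma> F x \<le> a x + T"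
        unfolding a_def T_def by (intro potential_le_local_plus_tail \<gamma> r F)
      then have "potential \<gamma> F x epowr q \<le> (a x + T) epowr q" using q by (intro epowr_mono) auto
      also have "\<dots> \<le> ennreal (2 powr q) * (a x epowr q + T epowr q)" by (rule epowr_add_le[OF q(1)])
      finally show ?thesis using True by simp
    qed (use q(1) in simp)
    have "(\<integral>\<^sup>+x. (potential \<gamma> F x * indicator ?B x) epowr q \<partial>wmeasure u)
       \<le> (\<integral>\<^sup>+x. ennreal (2 powr q) * (a x epowr q + T epowr q * indicator ?B x) \<partial>wmeasure u)"
      by (intro nn_integral_mono pt)
    also have "\<dots> = ennreal (2 powr q) * ((\<integral>\<^sup>+x. a x epowr q \<partial>wmeasure u) + T epowr q * ennreal (U y r))"
      by (simp add: nn_integral_cmult nn_integral_add nn_integral_cmult_indicator emeasure_U)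
    finally have "pnorm q (wmeasure u) (\<lambda>x. potential \<gamma> F x * indicator ?B x)
       \<le> (ennreal (2 powr q) * ((\<integral>\<^sup>+x. a x epowr q \<partial>wmeasure u) + T epowr q * ennreal (U y r))) epowr (1/q)"
      using q(1) by (intro epowr_mono) auto
    also have "\<dots> = ennreal 2 * ((\<integral>\<^sup>+x. a x epowr q \<partial>wmeasure u) + T epowr q * ennreal (U y r)) epowr (1/q)"
      using q(1) by (simp add: epowr_mult epowr_ennreal powr_powr)
    also have "\<dots> \<le> ennreal 2 * (ennreal (2 powr (1/q)) * (pnorm q (wmeasure u) a + (T epowr q * ennreal (U y r)) epowr (1/q)))"
      using q(1) by (intro mult_left_mono epowr_add_le) auto
    also have "\<dots> = ennreal c2 * (pnorm q (wmeasure u) a + T * ennreal (U y r powr (1/q)))"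
    proof -
      have "(T epowr q * ennreal (U y r)) epowr (1/q) = T * ennreal (U y r powr (1/q))"
        using q(1) U_pos[OF r, of y] by (simp add: epowr_mult epowr_epowr epowr_ennreal)
      moreover have "ennreal c2 = ennreal 2 * ennreal (2 powr (1/q))" by (simp add: c2_def ennreal_mult')
      ultimately show ?thesis by (simp only: mult.assoc)
    qed
    also have "pnorm q (wmeasure u) a \<le> ennreal C0 * local_norm F y (R 0)"
      using C0(2)[of "\<lambda>z. F z * indicator (ball y (2 * r)) z"] fin[of y "2 * r"] by (simp add: a_def local_norm_def R_def)
    finally have "ennreal (U y r powr e) * pnorm q (wmeasure u) (\<lambda>x. potential \<gamma> F x * indicator ?B x)
       \<le> ennreal (U y r powr e) * (ennreal c2 * (ennreal C0 * local_norm F y (R 0) + T * ennreal (U y r powr (1/q))))"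
      by (simp add: add_right_mono mult_left_mono)
    \<comment> \<open>The tail \<open>T\<close> is constant on B, so its norm is T u(B)^(1/q); with
      the outer power e this gives the exponent \<delta>.\<close>
    also have "\<dots> = ennreal c2 * (ennreal C0 * (ennreal (U y r powr e) * local_norm F y (R 0)) + ennreal (U y r powr \<delta>) * T)"
      by (simp add: \<delta>_def powr_add ennreal_mult'' distrib_left mult.assoc mult.commute mult.left_commute)
    also have "\<dots> \<le> ennreal c2 * (ennreal (C0 * D powr (- e)) * g 0 + (\<Sum>k. ennreal (c1 * \<kappa> ^ (k + 1)) * g (k + 1)))"
    proof (intro mult_left_mono add_mono)
      have "U y r powr e \<le> D powr (- e) * U y (R 0) powr e"
      proof -
        have "(D * U y r) powr e \<le> U y (R 0) powr e"
          using D(2)[OF r, of y] U_pos[of "2 * r" y] r e by (intro powr_mono2') (auto simp: R_def)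
        then have "D powr (- e) * (D powr e * U y r powr e) \<le> D powr (- e) * U y (R 0) powr e"
          using D U_pos[OF r, of y] by (intro mult_left_mono) (auto simp: powr_mult)
        then show ?thesis using D by (simp add: mult.assoc[symmetric] powr_add[symmetric])
      qed
      then have "ennreal (U y r powr e) \<le> ennreal (D powr (- e)) * ennreal (U y (R 0) powr e)"
        by (simp add: ennreal_mult''[symmetric] ennreal_leI)
      then have "ennreal C0 * (ennreal (U y r powr e) * local_norm F y (R 0)) \<le> ennreal C0 * (ennreal (D powr (- e)) * ennreal (U y (R 0) powr e) * local_norm F y (R 0))"
        by (intro mult_left_mono mult_right_mono) auto
      then show "ennreal C0 * (ennreal (U y r powr e) * local_norm F y (R 0)) \<le> ennreal (C0 * D powr (- e)) * g 0"
        using C0(1) by (simp add: g_def ennreal_mult'' mult.assoc)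
      have "ennreal (U y r powr \<delta>) * (ennreal ((2 ^ k * r / 2) powr (\<gamma> - real CARD('n)))
        * (\<integral>\<^sup>+z. F z * indicator (ball y (2 ^ (k + 2) * r)) z \<partial>lebesgue)) \<le> ennreal (c1 * \<kappa> ^ (k + 1)) * g (k + 1)" for k
      proof -
        let ?R = "R (k + 1)"
        have R8: "2 ^ k * r / 2 = ?R / 8" "2 ^ (k + 2) * r = ?R" by (auto simp: R_def)
        have "ennreal (U y r powr \<delta>) * (ennreal ((?R / 8) powr (\<gamma> - real CARD('n)))
            * ball_integral F y ?R)
          \<le> ennreal (U y r powr \<delta>) * (ennreal c1 * (ennreal (U y ?R powr (- 1/q)) * local_norm F y ?R))"
          unfolding c1_def by (intro mult_left_mono tail_term_le R F) auto
        also have "\<dots> = ennreal c1 * (ennreal (U y r powr \<delta> * U y ?R powr (- 1/q)) * local_norm F y ?R)"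
          by (simp add: ennreal_mult'' mult.assoc mult.left_commute)
        also have "\<dots> \<le> ennreal c1 * (ennreal (\<kappa> ^ (k + 1) * U y ?R powr e) * local_norm F y ?R)"
        proof (intro mult_left_mono mult_right_mono ennreal_leI)
          have "U y r \<le> \<rho> ^ (k + 2) * U y ?R" using iter[OF r, of y "k + 2"] by (simp add: R_def)
          \<comment> \<open>One of the k + 2 factors \<rho> is given up, so that the exponent
            matches the index k + 1 of the term.\<close>
          also have "\<dots> \<le> \<rho> ^ (k + 1) * U y ?R"
            using \<rho> U_pos[OF R, of y] by (intro mult_right_mono power_decreasing) (auto intro: less_imp_le)
          finally have "U y r powr \<delta> \<le> (\<rho> ^ (k + 1) * U y ?R) powr \<delta>"
            using e U_pos[OF r, of y] by (intro powr_mono2) (auto simp: \<delta>_def)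
          also have "\<dots> = \<kappa> ^ (k + 1) * U y ?R powr \<delta>"
          proof -
            have "(\<rho> ^ (k + 1)) powr \<delta> = \<kappa> ^ (k + 1)"
            proof -
              have "(\<rho> ^ (k + 1)) powr \<delta> = \<rho> powr (real (k + 1) * \<delta>)"
                using \<rho>(1) by (simp only: powr_realpow[symmetric] powr_powr)
              also have "\<dots> = \<kappa> powr real (k + 1)"
                unfolding \<kappa>_def by (simp only: powr_powr mult.commute)
              also have "\<dots> = \<kappa> ^ (k + 1)" using \<kappa>(1) by (rule powr_realpow)
              finally show ?thesis .
            qed
            moreover have "(\<rho> ^ (k + 1) * U y ?R) powr \<delta> = (\<rho> ^ (k + 1)) powr \<delta> * U y ?R powr \<delta>"
              by (rule powr_mult)
            ultimately show ?thesis by (simp only:)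
          qed
          finally have "U y r powr \<delta> * U y ?R powr (- 1/q) \<le> \<kappa> ^ (k + 1) * U y ?R powr \<delta> * U y ?R powr (- 1/q)"
            by (rule mult_right_mono) simp
          then show "U y r powr \<delta> * U y ?R powr (- 1/q) \<le> \<kappa> ^ (k + 1) * U y ?R powr e"
            by (simp add: mult.assoc powr_add[symmetric] \<delta>_def)
        qed auto
        also have "\<dots> = ennreal (c1 * \<kappa> ^ (k + 1)) * g (k + 1)"
          using c1 \<kappa> by (simp add: g_def ennreal_mult'' ennreal_mult' mult.assoc)
        finally show ?thesis unfolding R8 .
      qed
      then show "ennreal (U y r powr \<delta>) * T \<le> (\<Sum>k. ennreal (c1 * \<kappa> ^ (k + 1)) * g (k + 1))"
        unfolding T_def ennreal_suminf_cmult[symmetric] by (intro suminf_le) auto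
    qed auto
    \<comment> \<open>A common constant for the local and the tail terms lets the former become the
      term with index 0.\<close>
    also have "\<dots> \<le> ennreal c2 * (ennreal (C0 * D powr (- e) + c1) * g 0 + (\<Sum>k. ennreal ((C0 * D powr (- e) + c1) * \<kappa> ^ (k + 1)) * g (k + 1)))"
      using C0(1) c1 \<kappa> by (intro mult_left_mono add_mono suminf_le mult_right_mono ennreal_leI) auto
    also have "\<dots> = (\<Sum>k. ennreal (C * \<kappa> ^ k) * g k)"
    proof -
      have "ennreal c2 * (ennreal ((C0 * D powr (- e) + c1) * \<kappa> ^ k) * g k) = ennreal (C * \<kappa> ^ k) * g k" for k
        using c2 by (simp add: C_def ennreal_mult'[symmetric] mult.assoc[symmetric])
      then have "(\<Sum>k. ennreal (C * \<kappa> ^ k) * g k) = ennreal c2 * (\<Sum>k. ennreal ((C0 * D powr (- e) + c1) * \<kappa> ^ k) * g k)"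
        by (simp add: ennreal_suminf_cmult[symmetric])
      also have "(\<Sum>k. ennreal ((C0 * D powr (- e) + c1) * \<kappa> ^ k) * g k)
         = (\<Sum>k. ennreal ((C0 * D powr (- e) + c1) * \<kappa> ^ (k + 1)) * g (k + 1)) + ennreal ((C0 * D powr (- e) + c1) * \<kappa> ^ 0) * g 0"
        using suminf_offset[of "\<lambda>k. ennreal ((C0 * D powr (- e) + c1) * \<kappa> ^ k) * g k" 1] by (simp add: summableI)
      finally show ?thesis by (simp add: add.commute)
    qed
    finally show "ennreal (U y r powr e) * pnorm q (wmeasure u) (\<lambda>x. potential \<gamma> F x * indicator (ball y r) x)
      \<le> (\<Sum>k. ennreal (C * \<kappa> ^ k) * (ennreal (U y (2 ^ (k + 1) * r) powr e) * local_norm F y (2 ^ (k + 1) * r)))"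
      by (simp only: g_def R_def)
  qed
qed

end

section \<open>Local integrability and finiteness almost everywhere\<close>

lemma locally_integrable_iff_ball:
  fixes f :: "real ^ 'n \<Rightarrow> 'b :: euclidean_space"
  shows "locally_integrable f \<longleftrightarrow> f \<in> borel_measurable lebesgue \<and>
    (\<forall>y r. (\<integral>\<^sup>+x. ennreal (norm (f x)) * indicator (ball y r) x \<partial>lebesgue) < top)"
proof safe
  assume f: "locally_integrable f"
  show "f \<in> borel_measurable lebesgue" using f by (rule locally_integrable_measurable)
  fix y r
  have "integrable lebesgue (\<lambda>x. indicat_real (cball y r) x *\<^sub>R f x)"
    using f by (auto simp: locally_integrable_def set_integrable_def)
  then have "(\<integral>\<^sup>+x. ennreal (norm (indicat_real (cball y r) x *\<^sub>R f x)) \<partial>lebesgue) < top"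
    by (simp add: integrable_iff_bounded)
  moreover have "(\<integral>\<^sup>+x. ennreal (norm (f x)) * indicator (ball y r) x \<partial>lebesgue) \<le>
     (\<integral>\<^sup>+x. ennreal (norm (indicat_real (cball y r) x *\<^sub>R f x)) \<partial>lebesgue)"
    by (intro nn_integral_mono) (auto simp: indicator_def)
  ultimately show "(\<integral>\<^sup>+x. ennreal (norm (f x)) * indicator (ball y r) x \<partial>lebesgue) < top"
    by (rule le_less_trans[rotated])
next
  assume f[measurable]: "f \<in> borel_measurable lebesgue"
    and fin: "\<forall>y r. (\<integral>\<^sup>+x. ennreal (norm (f x)) * indicator (ball y r) x \<partial>lebesgue) < top"
  show "locally_integrable f"
    unfolding locally_integrable_def
  proof safe
    fix A :: "(real ^ 'n) set" assume A: "compact A"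
    then have [measurable]: "A \<in> sets lebesgue" by (simp add: compact_imp_closed borel_closed)
    obtain r where r: "A \<subseteq> ball 0 r" using bounded_subset_ballD[OF compact_imp_bounded[OF A], of 0] by blast
    have "(\<integral>\<^sup>+x. ennreal (norm (indicat_real A x *\<^sub>R f x)) \<partial>lebesgue) \<le> (\<integral>\<^sup>+x. ennreal (norm (f x)) * indicator (ball 0 r) x \<partial>lebesgue)"
      using r by (intro nn_integral_mono) (auto simp: indicator_def)
    then have "(\<integral>\<^sup>+x. ennreal (norm (indicat_real A x *\<^sub>R f x)) \<partial>lebesgue) < top"
      using fin by (auto intro: le_less_trans)
    then show "f absolutely_integrable_on A"
      by (simp add: set_integrable_def integrable_iff_bounded)
  qed
qed

lemma Lnorm_finite_imp_AE_finite:
  assumes s: "1 < s" and [measurable]: "\<Phi> \<in> borel_measurable M" and fin: "Lnorm s M \<Phi> < top"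
  shows "AE y in M. \<Phi> y < top"
proof (cases "s = top")
  case True
  have "AE y in M. \<Phi> y \<le> esssup M \<Phi>" by (rule esssup_AE)
  then show ?thesis using fin True by (auto simp: Lnorm_def elim!: eventually_mono intro: le_less_trans)
next
  case False
  define t where "t = enn2real s"
  have t: "0 < t" using s False by (auto simp: t_def enn2real_positive_iff less_top intro: less_trans[of 0 1])
  then have "(\<integral>\<^sup>+x. \<Phi> x epowr t \<partial>M) < top" using fin False by (simp add: Lnorm_def t_def)
  then have "AE x in M. \<Phi> x epowr t \<noteq> \<infinity>" by (intro nn_integral_PInf_AE) auto
  then show ?thesis
  proof eventually_elim
    case (elim y)
    then show ?case using t by (simp add: less_top)
  qed
qed

text \<open>If one ball were \<mu>-null, doubling would make its dilates by 2^k null, and these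
  exhaust the space.\<close>

lemma Delta2_emeasure_ball_pos:
  fixes \<mu> :: "real ^ 'n \<Rightarrow> real"
  assumes \<mu>: "\<mu> \<in> Delta2" and nz: "\<not> (AE x in lebesgue. \<mu> x = 0)" and r: "0 < r"
  shows "wvol \<mu> (ball y r) \<noteq> 0"
proof
  assume 0: "wvol \<mu> (ball y r) = 0"
  have nonneg: "0 \<le> \<mu> x" for x using \<mu> by (auto simp: Delta2_def weight_def)
  have loc: "locally_integrable \<mu>" using \<mu> by (auto simp: Delta2_def weight_def)
  have [measurable]: "\<mu> \<in> borel_measurable lebesgue" using loc by (rule locally_integrable_measurable)
  obtain C where C: "\<And>y r. 0 < r \<Longrightarrow> wvol \<mu> (ball y (2 * r)) \<le> ennreal C * wvol \<mu> (ball y r)"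
    using \<mu> by (auto simp: Delta2_def)
  have "wvol \<mu> (ball y (2 ^ k * r)) = 0" for k
  proof (induction k)
    case (Suc k)
    have "0 < 2 ^ k * r" using r by simp
    from C[OF this, of y] Suc show ?case by (simp add: mult.assoc)
  qed (use 0 in simp)
  then have "AE x in lebesgue. ennreal (\<mu> x) * indicator (ball y (2 ^ k * r)) x = 0" for k
    by (subst nn_integral_0_iff_AE[symmetric]) (auto simp: emeasure_density)
  then have "AE x in lebesgue. \<forall>k. ennreal (\<mu> x) * indicator (ball y (2 ^ k * r)) x = 0"
    unfolding AE_all_countable by blast
  then have "AE x in lebesgue. \<mu> x = 0"
  proof eventually_elim
    case (elim x)
    obtain k where "dist y x / r < 2 ^ k" using real_arch_pow[of 2 "dist y x / r"] by auto
    then have "x \<in> ball y (2 ^ k * r)" using r by (simp add: field_simps)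
    then have "ennreal (\<mu> x) = 0" using elim[rule_format, of k] by simp
    then show ?case using nonneg[of x] by (simp add: ennreal_eq_0_iff)
  qed
  then show False using nz by simp
qed

context Apq_weight
begin

text \<open>Young's inequality for G = (w G) w^(-1) bounds G by w^q G^q + w^(-q'), and w^(-q') \<le>
  1 + w^(-p') because q' \<le> p'; both 1 and w^(-p') are integrable over balls.\<close>

lemma integral_ball_finite:
  fixes G :: "real ^ 'n \<Rightarrow> ennreal"
  assumes [measurable]: "G \<in> borel_measurable lebesgue"
    and fin: "(\<integral>\<^sup>+x. (G x * indicator (ball y r) x) epowr q \<partial>wmeasure u) < top"
  shows "ball_integral G y r < top"
proof -
  let ?B = "ball y r"
  define q' where "q' = q / (q - 1)"
  have q': "1 < q'" "1/q + 1/q' = 1" using q_gt by (auto simp: q'_def field_simps)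
  have "1/q \<le> 1/p" using p q_gt by (simp add: field_simps)
  then have "1/p' \<le> 1/q'" using p'(2) q'(2) by linarith
  then have "q' \<le> p'" using p'(1) q'(1) by (simp add: field_simps)
  have "AE x in lebesgue. G x * indicator ?B x
      \<le> ennreal (u x) * (G x * indicator ?B x) epowr q + indicator ?B x + ennreal (\<sigma> x) * indicator ?B x"
    using AE_w_pos
  proof eventually_elim
    case (elim x)
    let ?g = "G x * indicator ?B x"
    show ?case
    proof (cases "x \<in> ?B")
      case True
      have "ennreal (w x) * ennreal (w x powr (-1)) = 1"
        using elim by (simp add: ennreal_mult'[symmetric] powr_minus)
      moreover have "(ennreal (w x) * ?g) * ennreal (w x powr (-1)) = (ennreal (w x) * ennreal (w x powr (-1))) * ?g"
        by (simp only: ac_simps)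
      ultimately have "?g = (ennreal (w x) * ?g) * ennreal (w x powr (-1))"
        by (simp only: mult_1_left)
      also have "\<dots> \<le> ennreal (1/q) * (ennreal (w x) * ?g) epowr q + ennreal (1/q') * ennreal (w x powr (-1)) epowr q'"
        using q_gt q' by (intro Young_ennreal) auto
      also have "\<dots> \<le> 1 * (ennreal (w x) * ?g) epowr q + 1 * ennreal (w x powr (-1)) epowr q'"
        using q_gt q' by (intro add_mono mult_right_mono) (auto simp: ennreal_le_1)
      also have "(ennreal (w x) * ?g) epowr q = ennreal (u x) * ?g epowr q"
        using q(1) elim by (simp add: epowr_mult epowr_ennreal)
      also have "ennreal (w x powr (-1)) epowr q' = ennreal (w x powr (- q'))"
      proof -
        have "(w x powr (-1)) powr q' = w x powr (- q')" by (simp only: powr_powr mult_minus1)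
        then show ?thesis using q' by (simp only: epowr_ennreal' powr_ge_zero)
      qed
      also have "\<dots> \<le> 1 + ennreal (\<sigma> x)"
      proof (cases "1 \<le> w x")
        case True
        then have "w x powr (- q') \<le> 1" using q' powr_mono[of "- q'" 0 "w x"] by simp
        then show ?thesis by (intro order_trans[OF _ add_increasing2[OF _ order_refl]]) (auto simp: ennreal_le_1)
      next
        case False
        then have "w x powr (- q') \<le> \<sigma> x" using elim \<open>q' \<le> p'\<close> by (intro powr_mono') auto
        then show ?thesis by (intro order_trans[OF ennreal_leI add_increasing[OF _ order_refl]]) auto
      qed
      finally show ?thesis using True by (simp add: add.assoc add_left_mono)
    qed simp
  qed
  then have "(\<integral>\<^sup>+x. G x * indicator ?B x \<partial>lebesgue) \<le>
     (\<integral>\<^sup>+x. ennreal (u x) * (G x * indicator ?B x) epowr q + indicator ?B x + ennreal (\<sigma> x) * indicator ?B x \<partial>lebesgue)"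
    by (rule nn_integral_mono_AE)
  also have "\<dots> = (\<integral>\<^sup>+x. (G x * indicator ?B x) epowr q \<partial>wmeasure u) + vol ?B + wvol \<sigma> ?B"
    by (subst nn_integral_density; simp add: nn_integral_add emeasure_density)
  also have "\<dots> < top" using fin emeasure_ball_finite[of y r] \<sigma>_ball(1)[of y r] by simp
  finally show ?thesis .
qed

lemma potential_finite_AE:
  assumes [measurable]: "F \<in> borel_measurable lebesgue"
    and fin: "\<And>R. (\<integral>\<^sup>+x. (potential \<gamma> F x * indicator (ball 0 R) x) epowr q \<partial>wmeasure u) < top"
  shows "AE x in lebesgue. potential \<gamma> F x < top"
proof -
  note [measurable] = borel_measurable_potential[OF assms(1)]
  have "AE x in lebesgue. potential \<gamma> F x * indicator (ball 0 (real n)) x \<noteq> \<infinity>" for n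
    by (rule nn_integral_PInf_AE) (use integral_ball_finite[OF _ fin[of "real n"]] in auto)
  then have "AE x in lebesgue. \<forall>n. potential \<gamma> F x * indicator (ball 0 (real n)) x \<noteq> \<infinity>"
    unfolding AE_all_countable by blast
  then show ?thesis
  proof eventually_elim
    case (elim x)
    obtain n where "norm x < real n" using reals_Archimedean2 by blast
    then show ?case using elim[rule_format, of n] by (simp add: less_top)
  qed
qed

lemma borel_measurable_U [measurable]: "(\<lambda>y. U y r) \<in> borel_measurable lebesgue"
proof -
  have "U y r = enn2real (\<integral>\<^sup>+x. ennreal (u x) * indicator (ball y r) x \<partial>lebesgue)" for y
    by (simp add: U_def measure_def emeasure_density)
  moreover have "(\<lambda>y. enn2real (\<integral>\<^sup>+x. ennreal (u x) * indicator (ball y r) x \<partial>lebesgue)) \<in> borel_measurable lebesgue"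
    using borel_measurable_nn_integral_ball[of "\<lambda>x. ennreal (u x)" r] by measurable
  ultimately show ?thesis by simp
qed

lemma borel_measurable_local_integral:
  fixes G :: "real ^ 'n \<Rightarrow> ennreal" and v' :: "real ^ 'n \<Rightarrow> real"
  assumes a: "0 < a" and [measurable]: "G \<in> borel_measurable lebesgue" "v' \<in> borel_measurable lebesgue"
  shows "(\<lambda>y. \<integral>\<^sup>+x. (G x * indicator (ball y r) x) epowr a \<partial>wmeasure v') \<in> borel_measurable lebesgue"
proof -
  have "(\<integral>\<^sup>+x. (G x * indicator (ball y r) x) epowr a \<partial>wmeasure v') = (\<integral>\<^sup>+x. (ennreal (v' x) * G x epowr a) * indicator (ball y r) x \<partial>lebesgue)" for y
    by (subst nn_integral_density, measurable) (use a in \<open>auto intro!: nn_integral_cong simp: indicator_def\<close>)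
  then show ?thesis
    using borel_measurable_nn_integral_ball[of "\<lambda>x. ennreal (v' x) * G x epowr a" r] by simp
qed

end

section \<open>Passage from the potential to the fractional integral\<close>

lemma borel_measurable_frac_integrand:
  fixes f :: "real ^ 'n \<Rightarrow> complex"
  assumes [measurable]: "f \<in> borel_measurable lebesgue"
  shows "(\<lambda>z. frac_integrand \<gamma> f (fst z) (snd z)) \<in> borel_measurable (borel \<Otimes>\<^sub>M lebesgue)"
proof -
  note [measurable] = borel_measurable_kernel
  show ?thesis unfolding frac_integrand_def by measurable
qed

lemma norm_frac_integrand:
  fixes f :: "real ^ 'n \<Rightarrow> complex"
  shows "ennreal (norm (frac_integrand \<gamma> f x y)) = ennreal (norm (f y)) * ennreal (norm (x - y) powr (\<gamma> - real CARD('n)))"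
proof -
  have "norm (frac_integrand \<gamma> f x y) = norm (f y) * norm (x - y) powr (- (real CARD('n) - \<gamma>))"
    by (simp add: frac_integrand_def norm_divide powr_minus_divide del: minus_diff_eq)
  then show ?thesis by (simp add: ennreal_mult)
qed

lemma borel_measurable_frac_integral:
  fixes f :: "real ^ 'n \<Rightarrow> complex"
  assumes f: "f \<in> borel_measurable lebesgue"
  shows "frac_integral \<gamma> f \<in> borel_measurable lebesgue"
proof -
  interpret sigma_finite_measure "lebesgue :: (real ^ 'n) measure" by (rule sigma_finite_lebesgue)
  have "(\<lambda>x. LINT y|lebesgue. frac_integrand \<gamma> f x y) \<in> borel_measurable borel"
    by (rule borel_measurable_lebesgue_integral) (use borel_measurable_frac_integrand[OF f] in \<open>simp add: case_prod_unfold\<close>)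
  then have "frac_integral \<gamma> f \<in> borel_measurable borel"
    unfolding frac_integral_def[abs_def] by measurable
  then show ?thesis by (intro measurable_completion) simp
qed

text \<open>This holds at every x: where the integrand is not integrable, the Bochner integral is 0.
  The absolute value avoids a discussion of the sign of the Gamma quotient.\<close>

lemma norm_frac_integral_le:
  fixes f :: "real ^ 'n \<Rightarrow> complex"
  shows "ennreal (norm (frac_integral \<gamma> f x)) \<le> ennreal \<bar>1 / frac_const CARD('n) \<gamma>\<bar> * potential \<gamma> (\<lambda>y. ennreal (norm (f y))) x"
proof -
  have "ennreal (norm (LINT y|lebesgue. frac_integrand \<gamma> f x y)) \<le> potential \<gamma> (\<lambda>y. ennreal (norm (f y))) x"
  proof (cases "integrable lebesgue (frac_integrand \<gamma> f x)")
    case True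
    then show ?thesis
      using integral_norm_bound_ennreal[of lebesgue "frac_integrand \<gamma> f x"] by (simp add: potential_def norm_frac_integrand)
  qed (simp add: not_integrable_integral_eq)
  then have "ennreal \<bar>1 / frac_const CARD('n) \<gamma>\<bar> * ennreal (norm (LINT y|lebesgue. frac_integrand \<gamma> f x y))
     \<le> ennreal \<bar>1 / frac_const CARD('n) \<gamma>\<bar> * potential \<gamma> (\<lambda>y. ennreal (norm (f y))) x"
    by (rule mult_left_mono) simp
  then show ?thesis
    by (simp add: frac_integral_def norm_mult ennreal_mult'[symmetric] norm_divide)
qed

lemma enn2real_one_divide: "0 < a \<Longrightarrow> enn2real (1 / ennreal a) = 1 / a"
  by (simp add: ennreal_1[symmetric] divide_ennreal del: ennreal_1)

text \<open>As a divergent Bochner integral has the value 0, the norm inequality alone would not say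
  that the operator is defined; the second conjunct adds existence almost everywhere and membership
  in the target space. If \<mu> vanishes almost everywhere, the source space contains all locally
  integrable functions, and for the constant 1 the integral diverges at every point.\<close>

theorem theorem2p1:
  fixes \<gamma> p q \<alpha> \<beta> :: real and s :: ennreal
    and w \<mu> :: "real ^ 'n \<Rightarrow> real"
  assumes "0 < \<gamma>" and "\<gamma> < real CARD('n)"
    and "1 < p" and "p < real CARD('n) / \<gamma>"
    and "1 / q = 1 / p - \<gamma> / real CARD('n)"
    and "w \<in> A_class p q"
    and "p \<le> \<alpha>" and "\<alpha> < \<beta>" and "ennreal \<beta> < s"
    and "1 / \<beta> = 1 / \<alpha> - \<gamma> / real CARD('n)"
    and "\<mu> \<in> Delta2"
  defines "X \<equiv> amalgam (ennreal p) s (ennreal \<alpha>) (\<lambda>x. w x powr p) (\<lambda>x. w x powr q) \<mu>"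
    and "Y \<equiv> amalgam (ennreal q) s (ennreal \<beta>) (\<lambda>x. w x powr q) (\<lambda>x. w x powr q) \<mu>"
  shows "(\<exists>C>0. \<forall>f\<in>X.
            amalgam_norm (ennreal q) s (ennreal \<beta>) (\<lambda>x. w x powr q) (\<lambda>x. w x powr q) \<mu>
              (frac_integral \<gamma> f)
            \<le> ennreal C *
              amalgam_norm (ennreal p) s (ennreal \<alpha>) (\<lambda>x. w x powr p) (\<lambda>x. w x powr q) \<mu> f)
       \<and> (\<not> (AE x in lebesgue. \<mu> x = 0) \<longrightarrow>
            (\<forall>f\<in>X. (AE x in lebesgue. integrable lebesgue (frac_integrand \<gamma> f x))
                     \<and> frac_integral \<gamma> f \<in> Y))"
proof -
  have "\<gamma> / real CARD('n) < 1 / p" using assms(1,3,4) by (simp add: field_simps)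
  then have "0 < 1 / q" using assms(5) by simp
  then have q: "0 < q" by simp
  interpret Apq_weight w p "p / (p - 1)" q \<gamma>
    by unfold_locales (use assms q in auto)
  define e where "e = 1/\<alpha> - 1/p - enn2real (1 / s)"
  have \<alpha>\<beta>: "0 < \<alpha>" "0 < \<beta>" "1 < \<beta>" using assms by auto
  have e_eq: "e = 1/\<beta> - 1/q - enn2real (1 / s)" using assms by (simp add: e_def)
  have "1/\<alpha> \<le> 1/p" using assms by (intro divide_left_mono) auto
  then have e0: "e \<le> 0" using enn2real_nonneg[of "1/s"] unfolding e_def by linarith
  have "enn2real (1 / s) < 1/\<beta>"
  proof (cases s)
    case (real t)
    then have "\<beta> < t" using assms \<alpha>\<beta> by (simp add: ennreal_less_iff)
    then show ?thesis using real \<alpha>\<beta> by (simp add: enn2real_one_divide field_simps)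
  qed (use \<alpha>\<beta> in simp)
  then have e1: "0 < e + 1/q" by (simp add: e_eq)
  have s: "1 < s"
  proof -
    have "1 < ennreal \<beta>" using \<alpha>\<beta> by (simp add: ennreal_1[symmetric] ennreal_less_iff del: ennreal_1)
    then show ?thesis using assms(9) by (rule less_trans)
  qed
  obtain C \<kappa> where C: "0 < C" "0 < \<kappa>" "\<kappa> < 1"
    "\<And>F y r. F \<in> borel_measurable lebesgue \<Longrightarrow> (\<And>y r. ball_integral F y r < top) \<Longrightarrow> 0 < r \<Longrightarrow>
      ennreal (U y r powr e) * pnorm q (wmeasure u) (\<lambda>x. potential \<gamma> F x * indicator (ball y r) x)
      \<le> (\<Sum>k. ennreal (C * \<kappa> ^ k) * (ennreal (U y (2 ^ (k + 1) * r) powr e) * local_norm F y (2 ^ (k + 1) * r)))"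
    by (rule local_potential_bound[OF e0 e1]) blast
  \<comment> \<open>Adding 1 makes the constant positive without evaluating the Gamma
    function.\<close>
  define c0 where "c0 = \<bar>1 / frac_const CARD('n) \<gamma>\<bar> + 1"
  have c0: "0 < c0" by (simp add: c0_def add_nonneg_pos)
  define S where "S = C / (1 - \<kappa>)"
  have sumsS: "(\<lambda>k. C * \<kappa> ^ k) sums S"
    using sums_mult[OF geometric_sums[of \<kappa>], of C] C by (simp add: S_def)
  have S: "0 < S" using C by (simp add: S_def)
  let ?M = "wmeasure \<mu>"
  let ?\<Phi> = "\<lambda>G r y. ennreal (U y r powr e) * pnorm q (wmeasure u) (\<lambda>x. G x * indicator (ball y r) x)"
  let ?\<Psi> = "\<lambda>F r y. ennreal (U y r powr e) * local_norm F y r"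
  let ?nX = "amalgam_norm (ennreal p) s (ennreal \<alpha>) v u \<mu>"
  let ?nY = "amalgam_norm (ennreal q) s (ennreal \<beta>) u u \<mu>"
  have U_e: "wvol u (ball y r) epowr e = ennreal (U y r powr e)" if "0 < r" for y r
    using U_pos[OF that, of y] by (simp add: emeasure_U epowr_ennreal)
  have nX: "?nX f = (SUP r\<in>{0<..}. Lnorm s ?M (?\<Psi> (\<lambda>x. ennreal (norm (f x))) r))" for f
    unfolding amalgam_norm_def
    by (intro SUP_cong refl arg_cong2[where f = "Lnorm s"] ext)
       (use assms(3) \<alpha>\<beta> in \<open>simp add: enn2real_one_divide e_def[symmetric] U_e local_norm_def Lnorm_def\<close>)
  have nY: "?nY f = (SUP r\<in>{0<..}. Lnorm s ?M (?\<Phi> (\<lambda>x. ennreal (norm (f x))) r))" for f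
    unfolding amalgam_norm_def
    by (intro SUP_cong refl arg_cong2[where f = "Lnorm s"] ext)
       (use q(1) \<alpha>\<beta> in \<open>simp add: enn2real_one_divide e_eq[symmetric] U_e Lnorm_def\<close>)
  have meas_\<Phi>: "?\<Phi> G r \<in> borel_measurable ?M" if [measurable]: "G \<in> borel_measurable lebesgue" for G r
  proof -
    note [measurable] = borel_measurable_local_integral[OF q(1) that, of u r]
    have "?\<Phi> G r \<in> borel_measurable lebesgue" by measurable
    then show ?thesis by simp
  qed
  have meas_\<Psi>: "?\<Psi> F r \<in> borel_measurable ?M" if [measurable]: "F \<in> borel_measurable lebesgue" for F r
  proof -
    have "0 < p" using assms(3) by simp
    note [measurable] = borel_measurable_local_integral[OF this that, of v r]
    have "?\<Psi> F r \<in> borel_measurable lebesgue" unfolding local_norm_def by measurable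
    then show ?thesis by simp
  qed
  \<comment> \<open>\<open>G\<close> is kept general: it is the fractional integral in the norm
    bound and the potential itself, with c = 1, in the proof that the integral exists.\<close>
  have main: "Lnorm s ?M (?\<Phi> G r) \<le> ennreal (c * S) * ?nX f"
    if f: "f \<in> X" and r: "0 < r" and c: "0 < c" and G[measurable]: "G \<in> borel_measurable lebesgue"
      and le: "\<And>x. G x \<le> ennreal c * potential \<gamma> (\<lambda>x. ennreal (norm (f x))) x" for f G r c
  proof -
    let ?F = "\<lambda>x. ennreal (norm (f x))"
    have loc: "f \<in> borel_measurable lebesgue" "\<And>y r. ball_integral ?F y r < top"
      using f by (auto simp: X_def amalgam_def locally_integrable_iff_ball)
    note [measurable] = loc(1)
    have "?\<Phi> G r y \<le> (\<Sum>k. ennreal (c * (C * \<kappa> ^ k)) * ?\<Psi> ?F (2 ^ (k + 1) * r) y)" for y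
    proof -
      have "pnorm q (wmeasure u) (\<lambda>x. G x * indicator (ball y r) x)
        \<le> pnorm q (wmeasure u) (\<lambda>x. ennreal c * (potential \<gamma> ?F x * indicator (ball y r) x))"
        using q(1) le unfolding mult.assoc[symmetric] by (intro epowr_mono nn_integral_mono mult_right_mono) auto
      also have "\<dots> = ennreal c * pnorm q (wmeasure u) (\<lambda>x. potential \<gamma> ?F x * indicator (ball y r) x)"
      proof -
        have "potential \<gamma> ?F \<in> borel_measurable lebesgue" by (rule borel_measurable_potential) measurable
        note [measurable] = this
        show ?thesis
          using q(1) c by (simp add: epowr_mult nn_integral_cmult epowr_epowr)
      qed
      finally have "?\<Phi> G r y \<le> ennreal c * ?\<Phi> (potential \<gamma> ?F) r y"
        unfolding mult.left_commute[of "ennreal c"] by (rule mult_left_mono) simp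
      also have "\<dots> \<le> ennreal c * (\<Sum>k. ennreal (C * \<kappa> ^ k) * ?\<Psi> ?F (2 ^ (k + 1) * r) y)"
        using loc r by (intro mult_left_mono C(4)) auto
      also have "\<dots> = (\<Sum>k. ennreal (c * (C * \<kappa> ^ k)) * ?\<Psi> ?F (2 ^ (k + 1) * r) y)"
        unfolding ennreal_suminf_cmult[symmetric] using c by (simp add: ennreal_mult' mult.assoc)
      finally show ?thesis .
    qed
    \<comment> \<open>Each dilated radius is one of those in the supremum, so all terms have the
      same bound.\<close>
    moreover have "Lnorm s ?M (?\<Psi> ?F (2 ^ (k + 1) * r)) \<le> ?nX f" for k :: nat
      unfolding nX using r by (intro SUP_upper) simp
    moreover have "(\<lambda>k. c * (C * \<kappa> ^ k)) sums (c * S)" by (rule sums_mult[OF sumsS])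
    ultimately show ?thesis
      using C(1,2) c by (intro Lnorm_le_weighted_sum[OF s, where \<Psi> = "\<lambda>k. ?\<Psi> ?F (2 ^ (k + 1) * r)" and a = "\<lambda>k. c * (C * \<kappa> ^ k)"] meas_\<Phi> meas_\<Psi>) auto
  qed
  have meas_f: "f \<in> borel_measurable lebesgue" if "f \<in> X" for f
    using that by (simp add: X_def amalgam_def locally_integrable_measurable)
  have bound: "?nY (frac_integral \<gamma> f) \<le> ennreal (c0 * S) * ?nX f" if f: "f \<in> X" for f
    unfolding nY
  proof (rule SUP_least)
    fix r :: real assume "r \<in> {0<..}"
    then have r: "0 < r" by simp
    note [measurable] = borel_measurable_frac_integral[OF meas_f[OF f]]
    show "Lnorm s ?M (?\<Phi> (\<lambda>x. ennreal (norm (frac_integral \<gamma> f x))) r) \<le> ennreal (c0 * S) * ?nX f"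
    proof (rule main[OF f r c0])
      fix x
      have "ennreal (norm (frac_integral \<gamma> f x)) \<le> ennreal \<bar>1 / frac_const CARD('n) \<gamma>\<bar> * potential \<gamma> (\<lambda>y. ennreal (norm (f y))) x"
        by (rule norm_frac_integral_le)
      also have "\<dots> \<le> ennreal c0 * potential \<gamma> (\<lambda>y. ennreal (norm (f y))) x"
        by (intro mult_right_mono ennreal_leI) (auto simp: c0_def)
      finally show "ennreal (norm (frac_integral \<gamma> f x)) \<le> \<dots>" .
    qed measurable
  qed
  have second: "(AE x in lebesgue. integrable lebesgue (frac_integrand \<gamma> f x)) \<and> frac_integral \<gamma> f \<in> Y"
    if nz: "\<not> (AE x in lebesgue. \<mu> x = 0)" and f: "f \<in> X" for f
  proof
    let ?F = "\<lambda>x. ennreal (norm (f x))"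
    note [measurable] = meas_f[OF f]
    have J[measurable]: "potential \<gamma> ?F \<in> borel_measurable lebesgue" by (rule borel_measurable_potential) measurable
    have fin: "?nX f < top" using f by (simp add: X_def amalgam_def)
    have loc: "(\<integral>\<^sup>+x. (potential \<gamma> ?F x * indicator (ball 0 R) x) epowr q \<partial>wmeasure u) < top" for R
    proof -
      \<comment> \<open>A ball of this radius about any point of the unit ball contains
        \<open>ball 0 R\<close>; the maximum keeps it positive for every R.\<close>
      let ?r = "max R 0 + 1"
      have "Lnorm s ?M (?\<Phi> (potential \<gamma> ?F) ?r) \<le> ennreal (1 * S) * ?nX f"
        by (rule main[OF f]) auto
      also have "\<dots> < top" using fin by (simp add: ennreal_mult_less_top)
      finally have ae: "AE y in ?M. ?\<Phi> (potential \<gamma> ?F) ?r y < top"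
        by (intro Lnorm_finite_imp_AE_finite[OF s meas_\<Phi>] J)
      \<comment> \<open>Otherwise \<mu>-almost every point would avoid the unit ball, although that
        ball has positive \<mu>-mass.\<close>
      have "\<exists>y\<in>ball 0 1. ?\<Phi> (potential \<gamma> ?F) ?r y < top"
      proof (rule ccontr)
        assume "\<not> ?thesis"
        then have "AE y in ?M. y \<notin> ball 0 1" using ae by (auto elim!: eventually_mono)
        then have "emeasure ?M (ball 0 1) = 0" by (subst (asm) AE_iff_measurable[of "ball 0 1"]) auto
        then show False using Delta2_emeasure_ball_pos[OF assms(11) nz, of 1 0] by simp
      qed
      then obtain y where y: "norm y < 1" "?\<Phi> (potential \<gamma> ?F) ?r y < top" by auto
      have "0 < U y ?r" by (intro U_pos) simp
      then have "pnorm q (wmeasure u) (\<lambda>x. potential \<gamma> ?F x * indicator (ball y ?r) x) \<noteq> top"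
        using y(2) by (auto simp: ennreal_mult_eq_top_iff)
      then have *: "(\<integral>\<^sup>+x. (potential \<gamma> ?F x * indicator (ball y ?r) x) epowr q \<partial>wmeasure u) < top"
        using q(1) by (simp add: less_top)
      have "ball 0 R \<subseteq> ball y ?r"
      proof
        fix x :: "real ^ 'n" assume "x \<in> ball 0 R"
        then show "x \<in> ball y ?r" using y(1) norm_triangle_ineq4[of y x] by (auto simp: dist_norm)
      qed
      then have "(\<integral>\<^sup>+x. (potential \<gamma> ?F x * indicator (ball 0 R) x) epowr q \<partial>wmeasure u)
         \<le> (\<integral>\<^sup>+x. (potential \<gamma> ?F x * indicator (ball y ?r) x) epowr q \<partial>wmeasure u)"
        using q(1) by (intro nn_integral_mono epowr_mono mult_left_mono) (auto simp: indicator_def)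
      then show ?thesis using * by (rule le_less_trans)
    qed
    have "AE x in lebesgue. potential \<gamma> ?F x < top"
      by (rule potential_finite_AE[OF _ loc]) measurable
    then show "AE x in lebesgue. integrable lebesgue (frac_integrand \<gamma> f x)"
    proof eventually_elim
      case (elim x)
      have "(\<lambda>y. frac_integrand \<gamma> f x y) \<in> borel_measurable lebesgue"
        using measurable_Pair2[OF borel_measurable_frac_integrand[OF meas_f[OF f], of \<gamma>], of x] by simp
      then show ?case
        using elim by (simp add: integrable_iff_bounded norm_frac_integrand potential_def)
    qed
    have "locally_integrable (frac_integral \<gamma> f)"
      unfolding locally_integrable_iff_ball
    proof safe
      show "frac_integral \<gamma> f \<in> borel_measurable lebesgue" by (rule borel_measurable_frac_integral) measurable
      fix y :: "real ^ 'n" and r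
      \<comment> \<open>\<open>loc\<close> concerns balls about the origin, so the given ball is
        enlarged to such a ball.\<close>
      have "(\<integral>\<^sup>+x. ennreal (norm (frac_integral \<gamma> f x)) * indicator (ball y r) x \<partial>lebesgue)
        \<le> (\<integral>\<^sup>+x. ennreal \<bar>1 / frac_const CARD('n) \<gamma>\<bar> * (potential \<gamma> ?F x * indicator (ball 0 (norm y + r)) x) \<partial>lebesgue)"
      proof (rule nn_integral_mono)
        fix x :: "real ^ 'n"
        have "x \<in> ball y r \<Longrightarrow> x \<in> ball 0 (norm y + r)"
          using norm_triangle_ineq3[of x y] by (auto simp: dist_norm norm_minus_commute)
        then show "ennreal (norm (frac_integral \<gamma> f x)) * indicator (ball y r) x
            \<le> ennreal \<bar>1 / frac_const CARD('n) \<gamma>\<bar> * (potential \<gamma> ?F x * indicator (ball 0 (norm y + r)) x)"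
          using norm_frac_integral_le[of \<gamma> f x] by (simp add: indicator_def)
      qed
      also have "\<dots> = ennreal \<bar>1 / frac_const CARD('n) \<gamma>\<bar> * ball_integral (potential \<gamma> ?F) 0 (norm y + r)"
        by (rule nn_integral_cmult) measurable
      also have "\<dots> < top"
        using integral_ball_finite[OF J loc, of "norm y + r"] by (simp add: ennreal_mult_less_top)
      finally show "(\<integral>\<^sup>+x. ennreal (norm (frac_integral \<gamma> f x)) * indicator (ball y r) x \<partial>lebesgue) < top" .
    qed
    moreover have "ennreal (c0 * S) * ?nX f < top" using fin by (simp add: ennreal_mult_less_top)
    with bound[OF f] have "?nY (frac_integral \<gamma> f) < top" by (rule le_less_trans)
    ultimately show "frac_integral \<gamma> f \<in> Y" by (simp add: Y_def amalgam_def)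
  qed
  show ?thesis
    using bound second c0 S by (intro conjI exI[of _ "c0 * S"]) auto
qed

end
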